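(* Let $G$ be a compact Lie group, $\eta\in\mathfrak g^*$, and let $\mathcal O=\mathcal O_\eta$ be the coadjoint orbit of $\eta$ with its symplectic form $\omega$. Assume that there is a character $\Lambda:G_\eta\to U(1)$ of the isotropy subgroup $G_\eta$ whose derivative is $C\in\mathfrak g_\eta\mapsto 2\pi i\,\eta(C)$. Let $\{A_t\}_{t\in[0,1]}$ be a curve in $\mathfrak g$ such that the Hamiltonian isotopy $\{\psi_t\}_{t\in[0,1]}$ of $\mathcal O$ generated by the vector fields $X_{A_t}$ is closed, i.e. $\frac{d\psi_t(q)}{dt}=X_{A_t}(\psi_t(q))$ and $\psi_0=\psi_1=\mathrm{id}$. Then $$\kappa(\psi)=\Lambda(g_1),$$ where $g_t\in G$ is the solution to $\dot g_t g_t^{-1}=A_t$ with $g_0=e$, and $g_1\in G_\eta$.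
   Context: Curves are smooth and symplectic manifolds are connected; in particular $\mathcal O$ is connected. **Coadjoint orbit.** $G$ acts on $\mathfrak g^*$ by $(g\cdot\nu)(A)=\nu(g^{-1}\cdot A)$, where $g\cdot A=\mathrm{Ad}_gA$. For $A\in\mathfrak g$, $X_A(\nu)=\frac{d}{du}\big|_{u=0}e^{uA}\cdot\nu$. $G_\eta$ is the isotropy subgroup of $\eta$, with Lie algebra $\mathfrak g_\eta$, and $\mathcal O=G\cdot\eta\cong G/G_\eta$. The symplectic form is $\omega_\nu(X_A(\nu),X_B(\nu))=\nu([A,B])$. Put $h_A(\nu)=\nu(A)$, so $\iota_{X_A}\omega=dh_A$; the Hamiltonian of $X_A$ is $f_A=-h_A$ (convention $\iota_{X_A}\omega=-df_A$). **Prequantum bundle.** $L=G\times_\Lambda\mathbb C=(G\times\mathbb C)/\simeq$ with $(g,z)\simeq(gb^{-1},\Lambda(b)z)$ for $b\in G_\eta$, and projection $\pi:L\to\mathcal O$. Let $L^\times=L\setminus\{\text{zero section}\}=(G\times_\Lambda\mathbb C^\times)$. A tangent vector of $L^\times$ at $[g,z]$ is written $[Y,x]$ if it is the velocity at $u=0$ of a curve $[g_u,ze^{ux}]$ with $g_0=g$, $\dot g_0=Y\in T_gG$, $x\in\mathbb C$. The connection form on $L^\times$ is $\Omega([Y,x])=\theta(Y)+(2\pi i)^{-1}x$, where $\theta$ is the left-invariant $1$-form on $G$ with $\theta_e=\eta$. For a section $\sigma$ of $L$ let $\sigma^\sharp:L^\times\to\mathbb C$ be given by $\sigma(\pi(y))=\sigma^\sharp(y)\,y$.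 The covariant derivative $D$ is defined by $(D_Y\sigma)^\sharp=Y^\sharp(\sigma^\sharp)$, where $Y^\sharp$ is the lift of $Y$ with $\Omega(Y^\sharp)=0$; its curvature is $-2\pi i\omega$. **The invariant $\kappa(\psi)$.** For $A\in\mathfrak g$ let $\mathcal P_A=-D_{X_A}-2\pi i f_A=-D_{X_A}+2\pi i h_A$, acting on $C^\infty(L)$. For $\sigma\in C^\infty(L)$ let $\sigma_t$ solve $\frac{d\sigma_t}{dt}=\mathcal P_{A_t}(\sigma_t)$, $\sigma_0=\sigma$. It is known that, $\psi$ being closed, there is a constant $\kappa(\psi)\in U(1)$ with $\sigma_1=\kappa(\psi)\sigma$ for every $\sigma\in C^\infty(L)$, and that $\kappa(\psi)=\exp(2\pi i\,\mathfrak A_\psi(q))$ for any $q\in\mathcal O$, where $$\mathfrak A_\psi(q)=\int_S\omega-\int_0^1 f_{A_t}(\psi_t(q))\,dt+\mathbb Z\in\mathbb R/\mathbb Z$$ is the action integral along $\psi$, $S$ being any $2$-surface whose boundary is the closed curve $\{\psi_t(q)\}_{t\in[0,1]}$. *)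

theory Defs
  imports "HOL-Analysis.Analysis" "HOL-Algebra.Group"
begin

section \<open>Smooth maps between finite-dimensional normed spaces\<close>

text \<open>To be used for open \<open>U\<close> and a finite-dimensional domain, where continuity of all directional
  derivatives of order \<open>k\<close> is the usual notion of being \<open>k\<close> times continuously differentiable.\<close>

primrec Ck_on ::
  "nat \<Rightarrow> ('a::real_normed_vector \<Rightarrow> 'b::real_normed_vector) \<Rightarrow> 'a set \<Rightarrow> bool" where
  "Ck_on 0 f U \<longleftrightarrow> continuous_on U f"
| "Ck_on (Suc k) f U \<longleftrightarrow>
     (\<forall>x\<in>U. f differentiable (at x)) \<and> (\<forall>v. Ck_on k (\<lambda>x. frechet_derivative f (at x) v) U)"

text \<open>On an arbitrary set, smooth means: locally the restriction of a smooth map on an open set.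
  On an open set this is the usual notion; on a compact interval the derivatives at the end points
  are one-sided.\<close>

definition smooth_on ::
  "'a set \<Rightarrow> ('a::real_normed_vector \<Rightarrow> 'b::real_normed_vector) \<Rightarrow> bool" where
  "smooth_on S f \<longleftrightarrow>
     (\<forall>x\<in>S. \<exists>U F. open U \<and> x \<in> U \<and> (\<forall>k. Ck_on k F U) \<and> (\<forall>y\<in>S \<inter> U. F y = f y))"

section \<open>Lie groups\<close>

text \<open>The underlying set of the group is a whole type, which carries the topology. A chart is a pair
  of a domain \<open>U\<close> and a map \<open>\<phi>\<close>, whose values outside \<open>U\<close> are irrelevant. The model space is a
  finite-dimensional Banach space rather than a type of class \<open>euclidean_space\<close>, because the latter
  would exclude dimension zero.\<close>

record ('g, 'e) lie_struct = "'g monoid" +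
  charts :: "('g set \<times> ('g \<Rightarrow> 'e)) set"

definition smooth_into ::
  "('g::topological_space, 'e::real_normed_vector) lie_struct \<Rightarrow> 'a::real_normed_vector set
     \<Rightarrow> ('a \<Rightarrow> 'g) \<Rightarrow> bool" where
  "smooth_into G D f \<longleftrightarrow> continuous_on D f \<and>
     (\<forall>(U, \<phi>)\<in>charts G. smooth_on {x\<in>D. f x \<in> U} (\<phi> \<circ> f))"

locale lie_group = group G
  for G :: "('g::{t2_space,second_countable_topology}, 'e::banach) lie_struct" (structure) +
  assumes carrier_UNIV: "carrier G = UNIV"
    and finite_dim: "\<exists>B::'e set. finite B \<and> span B = UNIV"
    and charts_cover: "(\<Union>(U, \<phi>)\<in>charts G. U) = UNIV"
    and chart_homeomorphism: "(U, \<phi>) \<in> charts G \<Longrightarrow>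
      open U \<and> open (\<phi> ` U) \<and> homeomorphism U (\<phi> ` U) \<phi> (inv_into U \<phi>)"
    and chart_compatible: "(U, \<phi>) \<in> charts G \<Longrightarrow> (V, \<rho>) \<in> charts G \<Longrightarrow>
      smooth_on (\<phi> ` (U \<inter> V)) (\<rho> \<circ> inv_into U \<phi>)"
    and mult_smooth: "(U, \<phi>) \<in> charts G \<Longrightarrow> (V, \<rho>) \<in> charts G \<Longrightarrow>
      smooth_into G (\<phi> ` U \<times> \<rho> ` V) (\<lambda>(x, y). inv_into U \<phi> x \<otimes> inv_into V \<rho> y)"
    and inv_smooth: "(U, \<phi>) \<in> charts G \<Longrightarrow>
      smooth_into G (\<phi> ` U) (\<lambda>x. inv (inv_into U \<phi> x))"

text \<open>The Lie algebra, i.e. the tangent space at the identity, is identified with the model space by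
  means of the differential of one fixed chart around the identity. A tangent vector is given as the
  velocity of a curve.\<close>

definition chart_one :: "('g::topological_space, 'e::real_normed_vector) lie_struct \<Rightarrow> 'g \<Rightarrow> 'e" where
  "chart_one G = (SOME \<phi>. \<exists>U. (U, \<phi>) \<in> charts G \<and> \<one>\<^bsub>G\<^esub> \<in> U)"

definition has_velocity_one ::
  "('g::topological_space, 'e::real_normed_vector) lie_struct
     \<Rightarrow> (real \<Rightarrow> 'g) \<Rightarrow> 'e \<Rightarrow> real \<Rightarrow> real set \<Rightarrow> bool" where
  "has_velocity_one G c C t I \<longleftrightarrow>
     c t = \<one>\<^bsub>G\<^esub> \<and> ((\<lambda>s. chart_one G (c s)) has_vector_derivative C) (at t within I)"

definition smooth_curve_at_0 ::
  "('g::topological_space, 'e::real_normed_vector) lie_struct \<Rightarrow> (real \<Rightarrow> 'g) \<Rightarrow> bool" where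
  "smooth_curve_at_0 G c \<longleftrightarrow> (\<exists>I. open I \<and> 0 \<in> I \<and> smooth_into G I c)"

definition one_parameter_subgroup ::
  "('g::topological_space, 'e::real_normed_vector) lie_struct \<Rightarrow> 'e \<Rightarrow> (real \<Rightarrow> 'g) \<Rightarrow> bool" where
  "one_parameter_subgroup G C c \<longleftrightarrow>
     smooth_into G UNIV c \<and> (\<forall>s t. c (s + t) = c s \<otimes>\<^bsub>G\<^esub> c t) \<and> has_velocity_one G c C 0 UNIV"

definition lie_exp :: "('g::topological_space, 'e::real_normed_vector) lie_struct \<Rightarrow> 'e \<Rightarrow> 'g" where
  "lie_exp G C = (THE c. one_parameter_subgroup G C c) 1"

definition Ad ::
  "('g::topological_space, 'e::real_normed_vector) lie_struct \<Rightarrow> 'g \<Rightarrow> 'e \<Rightarrow> 'e" where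
  "Ad G g C = vector_derivative
     (\<lambda>u. chart_one G (g \<otimes>\<^bsub>G\<^esub> lie_exp G (u *\<^sub>R C) \<otimes>\<^bsub>G\<^esub> inv\<^bsub>G\<^esub> g)) (at 0)"

section \<open>The coadjoint orbit\<close>

definition coadj ::
  "('g::topological_space, 'e::real_normed_vector) lie_struct \<Rightarrow> 'g
     \<Rightarrow> ('e \<Rightarrow>\<^sub>L real) \<Rightarrow> ('e \<Rightarrow>\<^sub>L real)" where
  "coadj G g \<nu> = Blinfun (\<lambda>C. blinfun_apply \<nu> (Ad G (inv\<^bsub>G\<^esub> g) C))"

definition fund_field ::
  "('g::topological_space, 'e::real_normed_vector) lie_struct \<Rightarrow> 'e
     \<Rightarrow> ('e \<Rightarrow>\<^sub>L real) \<Rightarrow> ('e \<Rightarrow>\<^sub>L real)" where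
  "fund_field G C \<nu> = vector_derivative (\<lambda>u. coadj G (lie_exp G (u *\<^sub>R C)) \<nu>) (at 0)"

definition isotropy ::
  "('g::topological_space, 'e::real_normed_vector) lie_struct \<Rightarrow> ('e \<Rightarrow>\<^sub>L real) \<Rightarrow> 'g set" where
  "isotropy G \<eta> = {g \<in> carrier G. coadj G g \<eta> = \<eta>}"

definition coadjoint_orbit ::
  "('g::topological_space, 'e::real_normed_vector) lie_struct
     \<Rightarrow> ('e \<Rightarrow>\<^sub>L real) \<Rightarrow> ('e \<Rightarrow>\<^sub>L real) set" where
  "coadjoint_orbit G \<eta> = (\<lambda>g. coadj G g \<eta>) ` carrier G"

text \<open>A continuous homomorphism from the isotropy subgroup to \<open>U(1)\<close> whose differential at the
  identity is \<open>C \<mapsto> 2\<pi>i \<eta>(C)\<close>. As the isotropy subgroup is closed in \<open>G\<close>, hence an embedded submanifold,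
  its tangent vectors \<open>C\<close> at the identity are the velocities of the smooth curves of \<open>G\<close> that
  stay in it.\<close>

definition isotropy_character ::
  "('g::topological_space, 'e::real_normed_vector) lie_struct \<Rightarrow> ('e \<Rightarrow>\<^sub>L real)
     \<Rightarrow> ('g \<Rightarrow> complex) \<Rightarrow> bool" where
  "isotropy_character G \<eta> \<Lambda> \<longleftrightarrow>
     (\<forall>b\<in>isotropy G \<eta>. \<forall>b'\<in>isotropy G \<eta>. \<Lambda> (b \<otimes>\<^bsub>G\<^esub> b') = \<Lambda> b * \<Lambda> b') \<and>
     (\<forall>b\<in>isotropy G \<eta>. norm (\<Lambda> b) = 1) \<and>
     continuous_on (isotropy G \<eta>) \<Lambda> \<and>
     (\<forall>I c C. open I \<and> 0 \<in> I \<and> smooth_into G I c \<and> c ` I \<subseteq> isotropy G \<eta> \<and>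
        has_velocity_one G c C 0 UNIV \<longrightarrow>
        ((\<lambda>u. \<Lambda> (c u)) has_vector_derivative 2 * of_real pi * \<i> * of_real (blinfun_apply \<eta> C)) (at 0))"

section \<open>The prequantum bundle\<close>

text \<open>The bundle \<open>L\<close> is the set of the classes \<open>[g, z]\<close>.\<close>

definition prequantum_rel ::
  "('g::topological_space, 'e::real_normed_vector) lie_struct \<Rightarrow> ('e \<Rightarrow>\<^sub>L real)
     \<Rightarrow> ('g \<Rightarrow> complex) \<Rightarrow> (('g \<times> complex) \<times> ('g \<times> complex)) set" where
  "prequantum_rel G \<eta> \<Lambda> =
     {((g, z), (g \<otimes>\<^bsub>G\<^esub> inv\<^bsub>G\<^esub> b, \<Lambda> b * z)) | g z b. g \<in> carrier G \<and> b \<in> isotropy G \<eta>}"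

definition prequantum_bundle ::
  "('g::topological_space, 'e::real_normed_vector) lie_struct \<Rightarrow> ('e \<Rightarrow>\<^sub>L real)
     \<Rightarrow> ('g \<Rightarrow> complex) \<Rightarrow> ('g \<times> complex) set set" where
  "prequantum_bundle G \<eta> \<Lambda> = (carrier G \<times> UNIV) // prequantum_rel G \<eta> \<Lambda>"

definition bundle_class ::
  "('g::topological_space, 'e::real_normed_vector) lie_struct \<Rightarrow> ('e \<Rightarrow>\<^sub>L real)
     \<Rightarrow> ('g \<Rightarrow> complex) \<Rightarrow> 'g \<Rightarrow> complex \<Rightarrow> ('g \<times> complex) set" where
  "bundle_class G \<eta> \<Lambda> g z = prequantum_rel G \<eta> \<Lambda> `` {(g, z)}"

definition bundle_nonzero ::
  "('g::topological_space, 'e::real_normed_vector) lie_struct \<Rightarrow> ('e \<Rightarrow>\<^sub>L real)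
     \<Rightarrow> ('g \<Rightarrow> complex) \<Rightarrow> ('g \<times> complex) set set" where
  "bundle_nonzero G \<eta> \<Lambda> = {bundle_class G \<eta> \<Lambda> g z | g z. g \<in> carrier G \<and> z \<noteq> 0}"

definition bundle_proj ::
  "('g::topological_space, 'e::real_normed_vector) lie_struct \<Rightarrow> ('e \<Rightarrow>\<^sub>L real)
     \<Rightarrow> ('g \<times> complex) set \<Rightarrow> ('e \<Rightarrow>\<^sub>L real)" where
  "bundle_proj G \<eta> y = (THE \<nu>. \<exists>(g, z)\<in>y. \<nu> = coadj G g \<eta>)"

text \<open>The vector space structure of the fibres: \<open>a [g, z] = [g, a z]\<close> and
  \<open>[g, z] + [g, z'] = [g, z + z']\<close>.\<close>

definition fibre_scale :: "complex \<Rightarrow> ('g \<times> complex) set \<Rightarrow> ('g \<times> complex) set" where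
  "fibre_scale a y = {(g, a * z) | g z. (g, z) \<in> y}"

definition fibre_add ::
  "('g \<times> complex) set \<Rightarrow> ('g \<times> complex) set \<Rightarrow> ('g \<times> complex) set" where
  "fibre_add y y' = {(g, z + z') | g z z'. (g, z) \<in> y \<and> (g, z') \<in> y'}"

text \<open>Sections are functions on the whole dual space; only their values on the orbit matter.\<close>

definition bundle_section ::
  "('g::topological_space, 'e::real_normed_vector) lie_struct \<Rightarrow> ('e \<Rightarrow>\<^sub>L real)
     \<Rightarrow> ('g \<Rightarrow> complex) \<Rightarrow> (('e \<Rightarrow>\<^sub>L real) \<Rightarrow> ('g \<times> complex) set) \<Rightarrow> bool" where
  "bundle_section G \<eta> \<Lambda> \<sigma> \<longleftrightarrow> (\<forall>\<nu>\<in>coadjoint_orbit G \<eta>.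
     \<sigma> \<nu> \<in> prequantum_bundle G \<eta> \<Lambda> \<and> bundle_proj G \<eta> (\<sigma> \<nu>) = \<nu>)"

definition sharp ::
  "('g::topological_space, 'e::real_normed_vector) lie_struct \<Rightarrow> ('e \<Rightarrow>\<^sub>L real)
     \<Rightarrow> (('e \<Rightarrow>\<^sub>L real) \<Rightarrow> ('g \<times> complex) set) \<Rightarrow> ('g \<times> complex) set \<Rightarrow> complex" where
  "sharp G \<eta> \<sigma> y = (THE a. \<sigma> (bundle_proj G \<eta> y) = fibre_scale a y)"

text \<open>A section \<open>\<sigma>\<close> is smooth iff the function \<open>\<sigma>\<^sup>\<sharp>\<close> is smooth on the bundle \<open>L\<close> without its zero
  section, i.e. iff its pull-back along the submersion \<open>(g, z) \<mapsto> [g, z]\<close> is smooth. For families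
  depending on \<open>t\<close> in the unit interval, smoothness is meant jointly in all the variables.\<close>

definition smooth_section ::
  "('g::topological_space, 'e::real_normed_vector) lie_struct \<Rightarrow> ('e \<Rightarrow>\<^sub>L real)
     \<Rightarrow> ('g \<Rightarrow> complex) \<Rightarrow> (('e \<Rightarrow>\<^sub>L real) \<Rightarrow> ('g \<times> complex) set) \<Rightarrow> bool" where
  "smooth_section G \<eta> \<Lambda> \<sigma> \<longleftrightarrow> bundle_section G \<eta> \<Lambda> \<sigma> \<and>
     (\<forall>(U, \<phi>)\<in>charts G. smooth_on (\<phi> ` U \<times> (- {0}))
        (\<lambda>(x, z). sharp G \<eta> \<sigma> (bundle_class G \<eta> \<Lambda> (inv_into U \<phi> x) z)))"

definition smooth_section_family ::
  "('g::topological_space, 'e::real_normed_vector) lie_struct \<Rightarrow> ('e \<Rightarrow>\<^sub>L real)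
     \<Rightarrow> ('g \<Rightarrow> complex) \<Rightarrow> (real \<Rightarrow> ('e \<Rightarrow>\<^sub>L real) \<Rightarrow> ('g \<times> complex) set) \<Rightarrow> bool" where
  "smooth_section_family G \<eta> \<Lambda> \<sigma> \<longleftrightarrow> (\<forall>t\<in>{0..1}. bundle_section G \<eta> \<Lambda> (\<sigma> t)) \<and>
     (\<forall>(U, \<phi>)\<in>charts G. smooth_on ({0..1} \<times> \<phi> ` U \<times> (- {0}))
        (\<lambda>(t, x, z). sharp G \<eta> (\<sigma> t) (bundle_class G \<eta> \<Lambda> (inv_into U \<phi> x) z)))"

section \<open>The connection\<close>

text \<open>\<open>theta\<close> is evaluated on the velocity of \<open>c\<close> at \<open>0\<close>, and \<open>connection_form\<close> on the tangent vector
  \<open>[Y, x]\<close>, where \<open>Y\<close> is this velocity. The tangent vector \<open>[Y, x]\<close> at \<open>[c 0, z]\<close> is the velocity of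
  \<open>u \<mapsto> [c u, z exp(ux)]\<close> at \<open>0\<close>.\<close>

definition theta ::
  "('g::topological_space, 'e::real_normed_vector) lie_struct \<Rightarrow> ('e \<Rightarrow>\<^sub>L real)
     \<Rightarrow> (real \<Rightarrow> 'g) \<Rightarrow> real" where
  "theta G \<eta> c = blinfun_apply \<eta>
     (vector_derivative (\<lambda>u. chart_one G (inv\<^bsub>G\<^esub> (c 0) \<otimes>\<^bsub>G\<^esub> c u)) (at 0))"

definition connection_form ::
  "('g::topological_space, 'e::real_normed_vector) lie_struct \<Rightarrow> ('e \<Rightarrow>\<^sub>L real)
     \<Rightarrow> (real \<Rightarrow> 'g) \<Rightarrow> complex \<Rightarrow> complex" where
  "connection_form G \<eta> c x = of_real (theta G \<eta> c) + x / (2 * of_real pi * \<i>)"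

text \<open>The derivative at \<open>y\<close> of a function \<open>F\<close> along the horizontal lift of the vector field \<open>Y\<close>
  on the orbit.\<close>

definition lift_derivative ::
  "('g::topological_space, 'e::real_normed_vector) lie_struct \<Rightarrow> ('e \<Rightarrow>\<^sub>L real) \<Rightarrow> ('g \<Rightarrow> complex)
     \<Rightarrow> (('e \<Rightarrow>\<^sub>L real) \<Rightarrow> ('e \<Rightarrow>\<^sub>L real)) \<Rightarrow> (('g \<times> complex) set \<Rightarrow> complex)
     \<Rightarrow> ('g \<times> complex) set \<Rightarrow> complex" where
  "lift_derivative G \<eta> \<Lambda> Y F y = (THE d. \<exists>c z x.
     smooth_curve_at_0 G c \<and> z \<noteq> 0 \<and> y = bundle_class G \<eta> \<Lambda> (c 0) z \<and>
     ((\<lambda>u. coadj G (c u) \<eta>) has_vector_derivative Y (bundle_proj G \<eta> y)) (at 0) \<and>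
     connection_form G \<eta> c x = 0 \<and>
     ((\<lambda>u. F (bundle_class G \<eta> \<Lambda> (c u) (z * exp (of_real u * x)))) has_vector_derivative d) (at 0))"

text \<open>\<open>covariant_derivative G \<eta> \<Lambda> Y \<sigma>\<close> is the section with \<open>(D\<^sub>Y \<sigma>)\<^sup>\<sharp> = Y\<^sup>\<sharp>(\<sigma>\<^sup>\<sharp>)\<close>.\<close>

definition covariant_derivative ::
  "('g::topological_space, 'e::real_normed_vector) lie_struct \<Rightarrow> ('e \<Rightarrow>\<^sub>L real) \<Rightarrow> ('g \<Rightarrow> complex)
     \<Rightarrow> (('e \<Rightarrow>\<^sub>L real) \<Rightarrow> ('e \<Rightarrow>\<^sub>L real)) \<Rightarrow> (('e \<Rightarrow>\<^sub>L real) \<Rightarrow> ('g \<times> complex) set)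
     \<Rightarrow> ('e \<Rightarrow>\<^sub>L real) \<Rightarrow> ('g \<times> complex) set" where
  "covariant_derivative G \<eta> \<Lambda> Y \<sigma> \<nu> =
     (THE p. \<forall>y\<in>bundle_nonzero G \<eta> \<Lambda>. bundle_proj G \<eta> y = \<nu> \<longrightarrow>
        p = fibre_scale (lift_derivative G \<eta> \<Lambda> Y (sharp G \<eta> \<sigma>) y) y)"

section \<open>The evolution of sections and the invariant \<open>\<kappa>\<close>\<close>

text \<open>The Hamiltonian \<open>f\<^sub>C = - h\<^sub>C\<close> of the vector field \<open>fund_field G C\<close>.\<close>

definition hamiltonian_fun :: "'e::real_normed_vector \<Rightarrow> ('e \<Rightarrow>\<^sub>L real) \<Rightarrow> real" where
  "hamiltonian_fun C \<nu> = - blinfun_apply \<nu> C"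

definition prequantum_op ::
  "('g::topological_space, 'e::real_normed_vector) lie_struct \<Rightarrow> ('e \<Rightarrow>\<^sub>L real) \<Rightarrow> ('g \<Rightarrow> complex)
     \<Rightarrow> 'e \<Rightarrow> (('e \<Rightarrow>\<^sub>L real) \<Rightarrow> ('g \<times> complex) set) \<Rightarrow> ('e \<Rightarrow>\<^sub>L real) \<Rightarrow> ('g \<times> complex) set" where
  "prequantum_op G \<eta> \<Lambda> C \<sigma> \<nu> =
     fibre_add (fibre_scale (- 1) (covariant_derivative G \<eta> \<Lambda> (fund_field G C) \<sigma> \<nu>))
       (fibre_scale (- 2 * of_real pi * \<i> * of_real (hamiltonian_fun C \<nu>)) (\<sigma> \<nu>))"

text \<open>The equation \<open>d\<sigma>\<^sub>t/dt = P\<^sub>A\<^sub>t(\<sigma>\<^sub>t)\<close> in the fibre over \<open>\<nu>\<close> is expressed in the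
  coordinate given by an arbitrary nonzero vector \<open>y\<close> of that fibre.\<close>

definition evolution ::
  "('g::topological_space, 'e::real_normed_vector) lie_struct \<Rightarrow> ('e \<Rightarrow>\<^sub>L real) \<Rightarrow> ('g \<Rightarrow> complex)
     \<Rightarrow> (real \<Rightarrow> 'e) \<Rightarrow> (real \<Rightarrow> ('e \<Rightarrow>\<^sub>L real) \<Rightarrow> ('g \<times> complex) set) \<Rightarrow> bool" where
  "evolution G \<eta> \<Lambda> A \<sigma> \<longleftrightarrow> smooth_section_family G \<eta> \<Lambda> \<sigma> \<and>
     (\<forall>t\<in>{0..1}. \<forall>y\<in>bundle_nonzero G \<eta> \<Lambda>.
        ((\<lambda>s. sharp G \<eta> (\<sigma> s) y) has_vector_derivative
           sharp G \<eta> (prequantum_op G \<eta> \<Lambda> (A t) (\<sigma> t)) y) (at t within {0..1}))"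

definition kappa ::
  "('g::topological_space, 'e::real_normed_vector) lie_struct \<Rightarrow> ('e \<Rightarrow>\<^sub>L real) \<Rightarrow> ('g \<Rightarrow> complex)
     \<Rightarrow> (real \<Rightarrow> 'e) \<Rightarrow> complex" where
  "kappa G \<eta> \<Lambda> A = (THE k. norm k = 1 \<and>
     (\<forall>\<sigma> \<sigma>t. smooth_section G \<eta> \<Lambda> \<sigma> \<longrightarrow> evolution G \<eta> \<Lambda> A \<sigma>t \<longrightarrow>
        (\<forall>\<nu>\<in>coadjoint_orbit G \<eta>. \<sigma>t 0 \<nu> = \<sigma> \<nu>) \<longrightarrow>
        (\<forall>\<nu>\<in>coadjoint_orbit G \<eta>. \<sigma>t 1 \<nu> = fibre_scale k (\<sigma> \<nu>))))"

text \<open>\<open>\<psi>\<close> is the isotopy of the orbit generated by the vector fields \<open>fund_field G (A t)\<close>, and it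
  is closed.\<close>

definition closed_isotopy ::
  "('g::topological_space, 'e::real_normed_vector) lie_struct \<Rightarrow> ('e \<Rightarrow>\<^sub>L real)
     \<Rightarrow> (real \<Rightarrow> 'e) \<Rightarrow> (real \<Rightarrow> ('e \<Rightarrow>\<^sub>L real) \<Rightarrow> ('e \<Rightarrow>\<^sub>L real)) \<Rightarrow> bool" where
  "closed_isotopy G \<eta> A \<psi> \<longleftrightarrow> (\<forall>q\<in>coadjoint_orbit G \<eta>.
     (\<forall>t\<in>{0..1}. \<psi> t q \<in> coadjoint_orbit G \<eta> \<and>
        ((\<lambda>s. \<psi> s q) has_vector_derivative fund_field G (A t) (\<psi> t q)) (at t within {0..1})) \<and>
     \<psi> 0 q = q \<and> \<psi> 1 q = q)"

text \<open>\<open>g\<close> is the solution of \<open>g' g\<^sup>-\<^sup>1 = A\<close> on the unit interval starting at the identity.\<close>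

definition right_log_solution ::
  "('g::topological_space, 'e::real_normed_vector) lie_struct
     \<Rightarrow> (real \<Rightarrow> 'e) \<Rightarrow> (real \<Rightarrow> 'g) \<Rightarrow> bool" where
  "right_log_solution G A g \<longleftrightarrow> smooth_into G {0..1} g \<and> g 0 = \<one>\<^bsub>G\<^esub> \<and>
     (\<forall>t\<in>{0..1}. has_velocity_one G (\<lambda>s. g s \<otimes>\<^bsub>G\<^esub> inv\<^bsub>G\<^esub> (g t)) (A t) t {0..1})"

end

theory Submission
  imports Defs
begin

text \<open>
  A section \<open>\<sigma>\<close> of \<open>L\<close> is the same as a function \<open>f\<close> on \<open>G\<close> with \<open>f (h b) = f h / \<Lambda> b\<close> for \<open>b\<close> in the
  isotropy subgroup. Along the curve \<open>exp (u C) h\<close>, which projects to \<open>X\<^sub>C\<close>, the form \<open>\<theta>\<close> takes the value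
  \<open>h\<^sub>C\<close>; hence in \<open>P\<^sub>C\<close> the zeroth order terms cancel and \<open>P\<^sub>C\<close> acts on \<open>f\<close> as minus the right-invariant
  vector field of \<open>C\<close>. Therefore \<open>f\<^sub>t (g\<^sub>t h)\<close> is constant in \<open>t\<close>. Since \<open>\<psi>\<close> is closed, \<open>g\<^sub>1\<close> acts
  trivially on the orbit, and equivariance gives \<open>f\<^sub>1 h = \<Lambda> (h\<^sup>-\<^sup>1 g\<^sub>1 h) f\<^sub>0 h\<close>. The factor does not depend on
  \<open>h\<close>: its logarithmic derivative along a curve with left velocity \<open>Y\<close> is
  \<open>2\<pi>i \<eta> (Y - Ad (b\<^sup>-\<^sup>1) Y) = 0\<close>, where \<open>b = h\<^sup>-\<^sup>1 g\<^sub>1 h\<close>, and the orbit is connected.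

  For \<open>\<kappa>\<close> to be determined by its property, a nonzero smooth section is needed: a bump function on
  \<open>G\<close>, multiplied by \<open>\<Lambda>\<close>, is averaged over the isotropy subgroup. The average comes from von Neumann's construction of
  the invariant mean, so neither Haar measure nor the closed subgroup theorem is used.
\<close>

section \<open>Finite-dimensional normed spaces\<close>

text \<open>The statement is built from definite descriptions: \<open>lie_exp\<close>,
  \<open>lift_derivative\<close>, \<open>covariant_derivative\<close> and \<open>kappa\<close> can
  be computed only after existence and uniqueness are settled. For \<open>lie_exp\<close> this means
  constructing all one-parameter subgroups from a local flow; for \<open>lift_derivative\<close>,
  independence of the curve, the representative and the lift. The derivative of \<Lambda> is given
  only at the identity and only along smooth curves of the group that stay in the isotropy subgroup.
  Each use of it must exhibit such a curve: a conjugate of \<open>exp(uX)\<close> with the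
  fundamental field of X vanishing at a point, or a quotient of two conjugates of
  \<open>g 1\<close>. Compactness enters in three ways: a bump function extends from a chart by
  zero, means over the isotropy subgroup exist and can be differentiated under, and open-closed
  subsets of the group have closed images in the orbit. Tangent vectors are handled as velocities of
  curves through the identity; a curve elsewhere is first translated back.\<close>

definition fin_dim :: "'a::real_normed_vector itself \<Rightarrow> bool" where
  "fin_dim _ \<longleftrightarrow> (\<exists>B::'a set. finite B \<and> span B = UNIV)"

text \<open>The span of the smaller set is complete: by the induction hypothesis the coordinates of
  a Cauchy sequence are Cauchy. Hence \<open>b0\<close> has a positive distance d from it, which
  bounds the coefficient of \<open>b0\<close> and, once that term is subtracted, the others.\<close>

lemma independent_coords_bounded:
  fixes B :: "'a::real_normed_vector set"
  assumes "finite B" "independent B"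
  shows "\<exists>K>0. \<forall>a. \<forall>b\<in>B. \<bar>a b\<bar> \<le> K * norm (\<Sum>b\<in>B. a b *\<^sub>R b)"
  using assms
proof (induction B rule: finite_induct)
  case empty
  show ?case by (intro exI[of _ 1]) auto
next
  case (insert b0 B)
  have ind: "independent B" and b0: "b0 \<notin> span B"
    using insert.prems insert.hyps by (auto simp: independent_insert)
  obtain K where K: "K > 0" "\<And>a b. b \<in> B \<Longrightarrow> \<bar>a b\<bar> \<le> K * norm (\<Sum>b\<in>B. a b *\<^sub>R b)"
    using insert.IH[OF ind] by blast
  have "\<exists>d>0. \<forall>a. d \<le> norm (b0 + (\<Sum>b\<in>B. a b *\<^sub>R b))"
  proof (rule ccontr)
    assume neg: "\<not> ?thesis"
    have "\<exists>a. norm (b0 + (\<Sum>b\<in>B. a b *\<^sub>R b)) < 1 / Suc n" for n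
    proof -
      have "(0::real) < 1 / Suc n" by simp
      then show ?thesis using neg by (meson not_le)
    qed
    then obtain a where a: "\<And>n. norm (b0 + (\<Sum>b\<in>B. a n b *\<^sub>R b)) < 1 / Suc n"
      by metis
    define y where "y n = (\<Sum>b\<in>B. a n b *\<^sub>R b)" for n
    have y: "y \<longlonglongrightarrow> - b0"
    proof -
      have "(\<lambda>n. b0 + y n) \<longlonglongrightarrow> 0"
        by (rule LIMSEQ_norm_0) (use a in \<open>auto simp: y_def\<close>)
      from tendsto_add[OF tendsto_const[of "- b0"] this] show ?thesis by simp
    qed
    then have Cy: "Cauchy y" by (rule LIMSEQ_imp_Cauchy)
    have "convergent (\<lambda>n. a n b)" if b: "b \<in> B" for b
    proof -
      have *: "\<bar>a n b - a m b\<bar> \<le> K * norm (y n - y m)" for n m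
        using K(2)[OF b, of "\<lambda>b. a n b - a m b"]
        by (simp add: y_def sum_subtractf scaleR_diff_left)
      have "Cauchy (\<lambda>n. a n b)"
      proof (rule CauchyI)
        fix e :: real assume "e > 0"
        then have "e / K > 0" using K(1) by simp
        then obtain M where M: "\<And>m n. m \<ge> M \<Longrightarrow> n \<ge> M \<Longrightarrow> norm (y m - y n) < e / K"
          using Cy unfolding Cauchy_iff by blast
        show "\<exists>M. \<forall>m\<ge>M. \<forall>n\<ge>M. norm (a m b - a n b) < e"
        proof (intro exI[of _ M] allI impI)
          fix m n assume "M \<le> m" "M \<le> n"
          then have "K * norm (y m - y n) < e"
            using M K(1) by (simp add: pos_less_divide_eq mult.commute)
          then show "norm (a m b - a n b) < e" using *[of m n] by simp
        qed
      qed
      then show ?thesis by (rule real_Cauchy_convergent)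
    qed
    then have "(\<lambda>n. \<Sum>b\<in>B. a n b *\<^sub>R b) \<longlonglongrightarrow> (\<Sum>b\<in>B. lim (\<lambda>n. a n b) *\<^sub>R b)"
      by (intro tendsto_intros) (auto simp: convergent_LIMSEQ_iff)
    then have "- b0 = (\<Sum>b\<in>B. lim (\<lambda>n. a n b) *\<^sub>R b)"
      using y LIMSEQ_unique unfolding y_def by blast
    then have "- b0 \<in> span B"
      by (metis (no_types, lifting) span_base span_scale span_sum)
    then show False using b0 by (metis span_neg minus_minus)
  qed
  then obtain d where d: "d > 0" "\<And>a. d \<le> norm (b0 + (\<Sum>b\<in>B. a b *\<^sub>R b))" by blast
  have bd0: "\<bar>a b0\<bar> * d \<le> norm (\<Sum>b\<in>insert b0 B. a b *\<^sub>R b)" for a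
  proof (cases "a b0 = 0")
    case False
    have "(\<Sum>b\<in>insert b0 B. a b *\<^sub>R b) = a b0 *\<^sub>R (b0 + (\<Sum>b\<in>B. (a b / a b0) *\<^sub>R b))"
      using insert.hyps False by (simp add: scaleR_add_right scaleR_sum_right)
    then show ?thesis using d(2)[of "\<lambda>b. a b / a b0"] by (simp add: mult_left_mono)
  qed simp
  \<comment> \<open>\<open>1 / d\<close> bounds the coefficient of \<open>b0\<close>; removing the
    term of \<open>b0\<close> multiplies the norm by at most \<open>1 + norm b0 / d\<close> before K
    is applied.\<close>
  define L where "L = 1 / d + K * (1 + norm b0 / d)"
  have "L > 0" using d(1) K(1) by (auto simp: L_def intro!: add_pos_nonneg)
  moreover have "\<bar>a b\<bar> \<le> L * norm (\<Sum>b\<in>insert b0 B. a b *\<^sub>R b)" if "b \<in> insert b0 B" for a b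
  proof -
    let ?N = "norm (\<Sum>b\<in>insert b0 B. a b *\<^sub>R b)"
    have 1: "\<bar>a b0\<bar> \<le> ?N / d" using bd0[of a] d(1) by (simp add: pos_le_divide_eq)
    have "norm (\<Sum>b\<in>B. a b *\<^sub>R b) = norm ((\<Sum>b\<in>insert b0 B. a b *\<^sub>R b) - a b0 *\<^sub>R b0)"
      using insert.hyps by simp
    also have "\<dots> \<le> ?N + norm (a b0 *\<^sub>R b0)" by (rule norm_triangle_ineq4)
    also have "\<dots> \<le> ?N + ?N / d * norm b0" using mult_right_mono[OF 1 norm_ge_zero[of b0]] by simp
    finally have 2: "norm (\<Sum>b\<in>B. a b *\<^sub>R b) \<le> ?N * (1 + norm b0 / d)" by (simp add: algebra_simps)
    show ?thesis
    proof (cases "b = b0")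
      case True
      have "0 \<le> K * (1 + norm b0 / d) * ?N" using K(1) d(1) by simp
      then show ?thesis using 1 True by (simp add: L_def algebra_simps)
    next
      case False
      then have "\<bar>a b\<bar> \<le> K * norm (\<Sum>b\<in>B. a b *\<^sub>R b)" using that K(2) by blast
      also have "\<dots> \<le> K * (?N * (1 + norm b0 / d))" using 2 K(1) by (simp add: mult_left_mono)
      also have "\<dots> \<le> L * ?N" using d(1) by (simp add: L_def algebra_simps)
      finally show ?thesis .
    qed
  qed
  ultimately show ?case by blast
qed

text \<open>Coordinate functionals of a basis extracted from a spanning set. They take over the role
  that inner products with \<open>Basis\<close> have in a euclidean space.\<close>

lemma fin_dim_coords:
  assumes "fin_dim TYPE('a::real_normed_vector)"
  obtains B :: "'a::real_normed_vector set" and c :: "'a \<Rightarrow> 'a \<Rightarrow> real" where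
    "finite B" "\<And>b. bounded_linear (c b)" "\<And>x. x = (\<Sum>b\<in>B. c b x *\<^sub>R b)"
proof -
  obtain S :: "'a set" where S: "finite S" "span S = UNIV" using assms by (auto simp: fin_dim_def)
  obtain B where B: "B \<subseteq> S" "independent B" "S \<subseteq> span B"
    using maximal_independent_subset[of S] by blast
  have fB: "finite B" using B(1) S(1) finite_subset by blast
  have sB: "span B = UNIV" using B(3) S(2) by (metis span_minimal subspace_span top.extremum_unique)
  obtain K where K: "K > 0" "\<And>a b. b \<in> B \<Longrightarrow> \<bar>a b\<bar> \<le> K * norm (\<Sum>b\<in>B. a b *\<^sub>R b)"
    using independent_coords_bounded[OF fB B(2)] by blast
  have rep: "(\<Sum>b\<in>B. representation B x b *\<^sub>R b) = x" for x
    using sum_representation_eq[of B x B] B(2) fB sB by auto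
  have bl: "bounded_linear (\<lambda>x. representation B x b)" for b
  proof (cases "b \<in> B")
    case True
    show ?thesis
    proof (rule bounded_linear_intro[of _ K])
      fix x show "norm (representation B x b) \<le> norm x * K"
        using K(2)[OF True, of "representation B x"] rep[of x] by (simp add: mult.commute)
    qed (use B(2) sB in \<open>auto simp: representation_add representation_scale\<close>)
  next
    case False
    then have "(\<lambda>x. representation B x b) = (\<lambda>x. 0)"
      using representation_ne_zero by blast
    then show ?thesis by (simp add: bounded_linear_zero)
  qed
  show thesis by (rule that[of B "\<lambda>b x. representation B x b"]) (use fB bl rep in auto)
qed

lemma fin_dim_euclidean: "fin_dim TYPE('a::euclidean_space)"
  unfolding fin_dim_def by (intro exI[of _ Basis]) auto

lemma fin_dim_prod:
  assumes "fin_dim TYPE('a::real_normed_vector)" "fin_dim TYPE('b::real_normed_vector)"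
  shows "fin_dim TYPE('a::real_normed_vector \<times> 'b::real_normed_vector)"
proof -
  obtain B :: "'a set" where B: "finite B" "span B = UNIV" using assms(1) by (auto simp: fin_dim_def)
  obtain C :: "'b set" where C: "finite C" "span C = UNIV" using assms(2) by (auto simp: fin_dim_def)
  have "span ((B \<times> {0}) \<union> ({0} \<times> C)) = UNIV"
    using B C by (simp add: span_Times_sing1 span_Times_sing2 span_Un set_eq_iff)
  then show ?thesis using B C unfolding fin_dim_def
    by (intro exI[of _ "(B \<times> {0}) \<union> ({0} \<times> C)"]) auto
qed

text \<open>B and K are chosen before the map. Operator norms of a whole family of derivatives are
  thus controlled by finitely many directional derivatives, the quantities whose continuity
  \<open>Ck_on\<close> provides.\<close>

lemma linear_bound_on_basis:
  assumes "fin_dim TYPE('a::real_normed_vector)"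
  obtains B :: "'a::real_normed_vector set" and K :: real where "finite B" "K > 0"
    "\<And>(f::'a::real_normed_vector \<Rightarrow> 'b::real_normed_vector) x. linear f \<Longrightarrow> norm (f x) \<le> K * norm x * (\<Sum>b\<in>B. norm (f b))"
proof -
  obtain B :: "'a set" and c where B: "finite B" "\<And>b. bounded_linear (c b)" "\<And>x. x = (\<Sum>b\<in>B. c b x *\<^sub>R b)"
    using fin_dim_coords[OF assms] by blast
  have "\<exists>M>0. \<forall>x. \<bar>c b x\<bar> \<le> norm x * M" for b
    using bounded_linear.pos_bounded[OF B(2)] by simp
  then obtain M where M: "\<And>b. M b > 0" "\<And>b x. \<bar>c b x\<bar> \<le> norm x * M b" by metis
  define K where "K = 1 + sum M B"
  have MK: "M b \<le> K" if "b \<in> B" for b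
    using member_le_sum[of b B M] that B(1) M(1) by (auto simp: K_def less_imp_le intro: add_increasing)
  have "K > 0" using M(1) by (auto simp: K_def less_imp_le intro!: add_pos_nonneg sum_nonneg)
  moreover have "norm (f x) \<le> K * norm x * (\<Sum>b\<in>B. norm (f b))" if "linear f" for f :: "'a \<Rightarrow> 'b" and x
  proof -
    have "f x = (\<Sum>b\<in>B. c b x *\<^sub>R f b)"
      by (subst B(3)[of x]) (simp add: linear_sum[OF that] linear_scale[OF that])
    also have "norm \<dots> \<le> (\<Sum>b\<in>B. \<bar>c b x\<bar> * norm (f b))" by (rule sum_norm_le) simp
    also have "\<dots> \<le> (\<Sum>b\<in>B. (norm x * K) * norm (f b))"
    proof (intro sum_mono mult_right_mono)
      fix b assume "b \<in> B"
      then show "\<bar>c b x\<bar> \<le> norm x * K"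
        using M(2)[of b x] MK[of b] by (meson mult_left_mono norm_ge_zero order_trans)
    qed simp
    finally show ?thesis by (simp add: sum_distrib_left mult.commute)
  qed
  ultimately show thesis using B(1) that by blast
qed

text \<open>Every functional combines the fixed functionals \<open>c b\<close>, with its own values
  on B as coefficients. Continuity and differentiability in the norm of the dual space can therefore
  be checked at each vector separately.\<close>

lemma blinfun_coords:
  assumes "fin_dim TYPE('a::real_normed_vector)"
  obtains B :: "'a::real_normed_vector set" and c :: "'a \<Rightarrow> ('a \<Rightarrow>\<^sub>L real)" where
    "finite B" "\<And>g :: 'a \<Rightarrow>\<^sub>L real. g = (\<Sum>b\<in>B. blinfun_apply g b *\<^sub>R c b)"
proof -
  obtain B :: "'a set" and c where B: "finite B" "\<And>b. bounded_linear (c b)" "\<And>x. x = (\<Sum>b\<in>B. c b x *\<^sub>R b)"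
    using fin_dim_coords[OF assms] by blast
  have rep: "g = (\<Sum>b\<in>B. blinfun_apply g b *\<^sub>R Blinfun (c b))" for g :: "'a \<Rightarrow>\<^sub>L real"
  proof (rule blinfun_eqI)
    fix x
    have "g x = g (\<Sum>b\<in>B. c b x *\<^sub>R b)" using B(3) by simp
    also have "\<dots> = (\<Sum>b\<in>B. g b *\<^sub>R Blinfun (c b)) x"
      by (simp add: blinfun.sum_right blinfun.scaleR_right blinfun.sum_left blinfun.scaleR_left
          bounded_linear_Blinfun_apply B(2) mult.commute)
    finally show "g x = (\<Sum>b\<in>B. g b *\<^sub>R Blinfun (c b)) x" .
  qed
  show thesis by (rule that[OF B(1) rep])
qed

lemma blinfun_continuous_on_pointwise:
  fixes f :: "'b::topological_space \<Rightarrow> 'a::real_normed_vector \<Rightarrow>\<^sub>L real"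
  assumes "fin_dim TYPE('a::real_normed_vector)" "\<And>b. continuous_on S (\<lambda>u. f u b)"
  shows "continuous_on S f"
proof -
  obtain B :: "'a set" and c :: "'a \<Rightarrow> ('a \<Rightarrow>\<^sub>L real)" where
    B: "finite B" "\<And>g :: 'a \<Rightarrow>\<^sub>L real. g = (\<Sum>b\<in>B. blinfun_apply g b *\<^sub>R c b)"
    using blinfun_coords[OF assms(1)] by blast
  have "continuous_on S (\<lambda>u. \<Sum>b\<in>B. f u b *\<^sub>R c b)"
    using assms(2) by (intro continuous_on_sum continuous_on_scaleR continuous_on_const)
  then show ?thesis unfolding B(2)[symmetric] .
qed

lemma blinfun_has_vector_derivative_pointwise:
  fixes f :: "real \<Rightarrow> 'a::real_normed_vector \<Rightarrow>\<^sub>L real"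
  assumes "fin_dim TYPE('a::real_normed_vector)"
    and "\<And>b. ((\<lambda>u. f u b) has_vector_derivative f' b) (at t)"
  shows "\<exists>D. (f has_vector_derivative D) (at t) \<and> (\<forall>b. D b = f' b)"
proof -
  obtain B :: "'a set" and c :: "'a \<Rightarrow> ('a \<Rightarrow>\<^sub>L real)" where
    B: "finite B" "\<And>g :: 'a \<Rightarrow>\<^sub>L real. g = (\<Sum>b\<in>B. blinfun_apply g b *\<^sub>R c b)"
    using blinfun_coords[OF assms(1)] by blast
  have "((\<lambda>u. \<Sum>b\<in>B. f u b *\<^sub>R c b) has_vector_derivative (\<Sum>b\<in>B. f' b *\<^sub>R c b)) (at t)"
    using assms(2)
    by (intro has_vector_derivative_sum)
      (auto intro!: derivative_eq_intros simp: has_real_derivative_iff_has_vector_derivative[symmetric])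
  then have D: "(f has_vector_derivative (\<Sum>b\<in>B. f' b *\<^sub>R c b)) (at t)"
    unfolding B(2)[symmetric] .
  moreover have "(\<Sum>b\<in>B. f' b *\<^sub>R c b) b = f' b" for b
    using bounded_linear.has_vector_derivative[OF blinfun.bounded_linear_left[of b] D] assms(2)[of b]
      vector_derivative_unique_at by blast
  ultimately show ?thesis by blast
qed

section \<open>Calculus of smooth maps\<close>

lemma Ck_on_subset: "Ck_on k f U \<Longrightarrow> V \<subseteq> U \<Longrightarrow> Ck_on k f V"
  by (induction k arbitrary: f) (auto intro: continuous_on_subset)

lemma Ck_on_cong:
  assumes "open U" "\<And>x. x \<in> U \<Longrightarrow> f x = g x" "Ck_on k f U"
  shows "Ck_on k g U"
  using assms
proof (induction k arbitrary: f g)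
  case 0
  then show ?case using continuous_on_cong[of U U f g] by simp
next
  case (Suc k)
  have d: "g differentiable (at x)" "frechet_derivative f (at x) = frechet_derivative g (at x)"
    if "x \<in> U" for x
  proof -
    have "(f has_derivative frechet_derivative f (at x)) (at x)"
      using Suc.prems(3) that by (simp add: frechet_derivative_works)
    then have "(g has_derivative frechet_derivative f (at x)) (at x)"
      by (rule has_derivative_transform_within_open[OF _ Suc.prems(1) that Suc.prems(2)])
    then show "g differentiable (at x)" "frechet_derivative f (at x) = frechet_derivative g (at x)"
      using frechet_derivative_at differentiableI by blast+
  qed
  show ?case
  proof (simp, intro conjI ballI allI)
    fix v
    show "Ck_on k (\<lambda>x. frechet_derivative g (at x) v) U"
      by (rule Suc.IH[OF Suc.prems(1), of "\<lambda>x. frechet_derivative f (at x) v"]) (use Suc.prems d in auto)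
  qed (use d in auto)
qed

text \<open>\<open>Ck_on\<close> is phrased with \<open>frechet_derivative\<close>; on an open set
  any explicit family of derivatives may stand in for it, and the closure properties below are
  proved in this way.\<close>

lemma Ck_on_SucI:
  assumes "open U" "\<And>x. x \<in> U \<Longrightarrow> (f has_derivative f' x) (at x)" "\<And>v. Ck_on k (\<lambda>x. f' x v) U"
  shows "Ck_on (Suc k) f U"
proof (simp, intro conjI ballI allI)
  fix v show "Ck_on k (\<lambda>x. frechet_derivative f (at x) v) U"
    by (rule Ck_on_cong[OF assms(1) _ assms(3)[of v]]) (use assms(2) frechet_derivative_at in fastforce)
qed (use assms(2) differentiableI in blast)

lemma Ck_on_SucD:
  assumes "Ck_on (Suc k) f U" "x \<in> U"
  shows "(f has_derivative frechet_derivative f (at x)) (at x)"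
  using assms by (simp add: frechet_derivative_works)

lemma Ck_on_Suc_lower: "Ck_on (Suc k) f U \<Longrightarrow> Ck_on k f U"
proof (induction k arbitrary: f)
  case 0
  then show ?case
    by (auto simp: differentiable_imp_continuous_within intro!: differentiable_imp_continuous_on
        differentiable_at_imp_differentiable_on)
next
  case (Suc k)
  then show ?case using Ck_on.simps(2) by blast
qed

lemma Ck_on_continuous: "Ck_on k f U \<Longrightarrow> continuous_on U f"
proof (induction k)
  case (Suc k)
  then show ?case using Ck_on_Suc_lower by blast
qed simp

lemma Ck_on_local:
  assumes "\<And>x. x \<in> S \<Longrightarrow> \<exists>U. open U \<and> x \<in> U \<and> Ck_on k f U"
  shows "Ck_on k f S"
  using assms
proof (induction k arbitrary: f)
  case 0
  then have "continuous (at x within S) f" if "x \<in> S" for x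
    using that by (metis Ck_on.simps(1) continuous_at_imp_continuous_within continuous_on_eq_continuous_at)
  then show ?case by (simp add: continuous_on_eq_continuous_within)
next
  case (Suc k)
  show ?case
  proof (simp, intro conjI ballI allI)
    fix v show "Ck_on k (\<lambda>x. frechet_derivative f (at x) v) S"
      by (rule Suc.IH) (use Suc.prems in fastforce)
  qed (use Suc.prems in fastforce)
qed

lemma Ck_on_const: "Ck_on k (\<lambda>x. c) U"
  by (induction k arbitrary: c) auto

lemma Ck_on_bounded_linear_compose:
  assumes "bounded_linear L" "open U" "Ck_on k f U"
  shows "Ck_on k (\<lambda>x. L (f x)) U"
  using assms(3)
proof (induction k arbitrary: f)
  case 0
  then show ?case using linear_continuous_on_compose bounded_linear.continuous_on[OF assms(1)] by auto
next
  case (Suc k)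
  show ?case
  proof (rule Ck_on_SucI[OF assms(2)])
    fix x assume "x \<in> U"
    then show "((\<lambda>x. L (f x)) has_derivative (\<lambda>v. L (frechet_derivative f (at x) v))) (at x)"
      using bounded_linear.has_derivative[OF assms(1) Ck_on_SucD[OF Suc.prems]] by blast
  qed (use Suc in auto)
qed

lemma Ck_on_bounded_linear:
  assumes "bounded_linear L" "open U" shows "Ck_on k L U"
proof (cases k)
  case 0
  then show ?thesis using assms by (simp add: linear_continuous_on)
next
  case (Suc k)
  show ?thesis unfolding Suc
    by (rule Ck_on_SucI[OF assms(2), of _ "\<lambda>x. L"])
      (auto simp: Ck_on_const intro: bounded_linear_imp_has_derivative[OF assms(1)])
qed

lemma Ck_on_add:
  assumes "open U" "Ck_on k f U" "Ck_on k g U"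
  shows "Ck_on k (\<lambda>x. f x + g x) U"
  using assms(2,3)
proof (induction k arbitrary: f g)
  case 0
  then show ?case by (auto intro: continuous_intros)
next
  case (Suc k)
  show ?case
  proof (rule Ck_on_SucI[OF assms(1)])
    fix x assume "x \<in> U"
    then show "((\<lambda>x. f x + g x) has_derivative
        (\<lambda>v. frechet_derivative f (at x) v + frechet_derivative g (at x) v)) (at x)"
      using has_derivative_add Ck_on_SucD Suc.prems by blast
  qed (use Suc in auto)
qed

lemma Ck_on_sum:
  assumes "open U" "finite I" "\<And>i. i \<in> I \<Longrightarrow> Ck_on k (f i) U"
  shows "Ck_on k (\<lambda>x. \<Sum>i\<in>I. f i x) U"
  using assms(2,3) by (induction I rule: finite_induct) (auto simp: Ck_on_const intro: Ck_on_add assms(1))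

lemma Ck_on_bounded_bilinear:
  assumes "bounded_bilinear pr" "open U" "Ck_on k f U" "Ck_on k g U"
  shows "Ck_on k (\<lambda>x. pr (f x) (g x)) U"
  using assms(3,4)
proof (induction k arbitrary: f g)
  case 0
  then show ?case using bounded_bilinear.continuous_on[OF assms(1)] by auto
next
  case (Suc k)
  show ?case
  proof (rule Ck_on_SucI[OF assms(2)])
    fix x assume "x \<in> U"
    then show "((\<lambda>x. pr (f x) (g x)) has_derivative
        (\<lambda>v. pr (f x) (frechet_derivative g (at x) v) + pr (frechet_derivative f (at x) v) (g x))) (at x)"
      by (intro bounded_bilinear.FDERIV[OF assms(1)] Ck_on_SucD[of k _ U] Suc.prems)
  next
    fix v
    have "Ck_on k f U" "Ck_on k g U" using Suc.prems by (blast intro: Ck_on_Suc_lower)+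
    then show "Ck_on k (\<lambda>x. pr (f x) (frechet_derivative g (at x) v) + pr (frechet_derivative f (at x) v) (g x)) U"
      using Suc.prems by (intro Ck_on_add assms(2) Suc.IH) auto
  qed
qed

lemma Ck_on_Pair:
  assumes "open U" "Ck_on k f U" "Ck_on k g U"
  shows "Ck_on k (\<lambda>x. (f x, g x)) U"
  using Ck_on_add[OF assms(1)
      Ck_on_bounded_linear_compose[OF bounded_linear_Pair[OF bounded_linear_ident bounded_linear_zero] assms(1,2)]
      Ck_on_bounded_linear_compose[OF bounded_linear_Pair[OF bounded_linear_zero bounded_linear_ident] assms(1,3)]]
  by simp

text \<open>In the chain rule the derivative of g is applied to a direction that varies with x,
  while \<open>Ck_on\<close> controls fixed directions. Expanding that direction in coordinates of
  the intermediate space turns the derivative into a finite sum of products, to which the induction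
  hypothesis applies.\<close>

lemma Ck_on_compose:
  fixes f :: "'a::real_normed_vector \<Rightarrow> 'b::real_normed_vector"
    and g :: "'b \<Rightarrow> 'c::real_normed_vector"
  assumes fd: "fin_dim TYPE('b)" and "open U" "open V" "f ` U \<subseteq> V" "Ck_on k f U" "Ck_on k g V"
  shows "Ck_on k (\<lambda>x. g (f x)) U"
  using assms(5,6)
proof (induction k arbitrary: g)
  case 0
  then show ?case using assms(4) continuous_on_compose2 by auto
next
  case (Suc k)
  obtain B :: "'b set" and c where B: "finite B" "\<And>b. bounded_linear (c b)" "\<And>x. x = (\<Sum>b\<in>B. c b x *\<^sub>R b)"
    using fin_dim_coords[OF fd] by blast
  define h where "h x v = (\<Sum>b\<in>B. c b (frechet_derivative f (at x) v) *\<^sub>R frechet_derivative g (at (f x)) b)" for x v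
  show ?case
  proof (rule Ck_on_SucI[OF assms(2)])
    fix x assume x: "x \<in> U"
    have g: "(g has_derivative frechet_derivative g (at (f x))) (at (f x))"
      using Ck_on_SucD[OF Suc.prems(2)] x assms(4) by blast
    then have lin: "linear (frechet_derivative g (at (f x)))" by (rule has_derivative_linear)
    have "(\<lambda>v. frechet_derivative g (at (f x)) (frechet_derivative f (at x) v)) = h x"
    proof
      fix v
      show "frechet_derivative g (at (f x)) (frechet_derivative f (at x) v) = h x v"
        unfolding h_def by (subst B(3)) (simp add: linear_sum[OF lin] linear_scale[OF lin])
    qed
    then show "((\<lambda>x. g (f x)) has_derivative h x) (at x)"
      using diff_chain_at[OF Ck_on_SucD[OF Suc.prems(1) x] g] by (simp add: o_def)
  next
    fix v
    show "Ck_on k (\<lambda>x. h x v) U"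
      unfolding h_def
    proof (intro Ck_on_sum assms(2) B(1) Ck_on_bounded_bilinear[OF bounded_bilinear_scaleR])
      fix b
      show "Ck_on k (\<lambda>x. c b (frechet_derivative f (at x) v)) U"
        using Ck_on_bounded_linear_compose[OF B(2) assms(2)] Suc.prems(1) by simp
      show "Ck_on k (\<lambda>x. frechet_derivative g (at (f x)) b) U"
        by (rule Suc.IH) (use Suc.prems Ck_on_Suc_lower in auto)
    qed
  qed
qed

lemma smooth_onE:
  assumes "smooth_on S f" "x \<in> S"
  obtains U F where "open U" "x \<in> U" "\<And>k. Ck_on k F U" "\<And>y. y \<in> S \<Longrightarrow> y \<in> U \<Longrightarrow> F y = f y"
proof -
  have "\<exists>U F. open U \<and> x \<in> U \<and> (\<forall>k. Ck_on k F U) \<and> (\<forall>y\<in>S \<inter> U. F y = f y)"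
    using assms unfolding smooth_on_def by (rule bspec)
  then show thesis by (elim exE conjE) (rule_tac U=U and F=F in that, simp_all)
qed

lemma smooth_onI:
  assumes "\<And>x. x \<in> S \<Longrightarrow> \<exists>U F. open U \<and> x \<in> U \<and> (\<forall>k. Ck_on k F U) \<and> (\<forall>y\<in>S \<inter> U. F y = f y)"
  shows "smooth_on S f"
  unfolding smooth_on_def by (intro ballI assms)

lemma smooth_on_open_iff:
  assumes S: "open S"
  shows "smooth_on S f \<longleftrightarrow> (\<forall>k. Ck_on k f S)"
proof
  assume f: "smooth_on S f"
  show "\<forall>k. Ck_on k f S"
  proof (intro allI Ck_on_local)
    fix k x assume x: "x \<in> S"
    obtain U F where U: "open U" "x \<in> U" "\<And>k. Ck_on k F U" "\<And>y. y \<in> S \<Longrightarrow> y \<in> U \<Longrightarrow> F y = f y"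
      using smooth_onE[OF f x] by blast
    have "Ck_on k f (S \<inter> U)"
      by (rule Ck_on_cong[OF _ _ Ck_on_subset[OF U(3), of "S \<inter> U"]]) (use S U in auto)
    then show "\<exists>U. open U \<and> x \<in> U \<and> Ck_on k f U"
      using S x U by (intro exI[of _ "S \<inter> U"]) auto
  qed
qed (use S in \<open>auto simp: smooth_on_def\<close>)

lemma smooth_on_subset:
  assumes "smooth_on S f" "T \<subseteq> S" shows "smooth_on T f"
proof (rule smooth_onI)
  fix x assume "x \<in> T"
  then have x: "x \<in> S" using assms(2) by blast
  obtain U F where U: "open U" "x \<in> U" "\<And>k. Ck_on k F U" "\<And>y. y \<in> S \<Longrightarrow> y \<in> U \<Longrightarrow> F y = f y"
    using smooth_onE[OF assms(1) x] by blast
  then show "\<exists>U F. open U \<and> x \<in> U \<and> (\<forall>k. Ck_on k F U) \<and> (\<forall>y\<in>T \<inter> U. F y = f y)"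
    using assms(2) by (intro exI[of _ U] exI[of _ F]) auto
qed

lemma smooth_on_cong:
  assumes "smooth_on S f" "\<And>x. x \<in> S \<Longrightarrow> f x = g x"
  shows "smooth_on S g"
proof (rule smooth_onI)
  fix x assume x: "x \<in> S"
  obtain U F where U: "open U" "x \<in> U" "\<And>k. Ck_on k F U" "\<And>y. y \<in> S \<Longrightarrow> y \<in> U \<Longrightarrow> F y = f y"
    using smooth_onE[OF assms(1) x] by blast
  then show "\<exists>U F. open U \<and> x \<in> U \<and> (\<forall>k. Ck_on k F U) \<and> (\<forall>y\<in>S \<inter> U. F y = g y)"
    using assms(2) by (intro exI[of _ U] exI[of _ F]) auto
qed

lemma smooth_on_local:
  assumes "\<And>x. x \<in> S \<Longrightarrow> \<exists>U. open U \<and> x \<in> U \<and> smooth_on (S \<inter> U) f"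
  shows "smooth_on S f"
proof (rule smooth_onI)
  fix x assume x: "x \<in> S"
  then obtain U where U: "open U" "x \<in> U" "smooth_on (S \<inter> U) f" using assms by blast
  have x': "x \<in> S \<inter> U" using x U by blast
  obtain V F where V: "open V" "x \<in> V" "\<And>k. Ck_on k F V" "\<And>y. y \<in> S \<inter> U \<Longrightarrow> y \<in> V \<Longrightarrow> F y = f y"
    using smooth_onE[OF U(3) x'] by blast
  show "\<exists>U F. open U \<and> x \<in> U \<and> (\<forall>k. Ck_on k F U) \<and> (\<forall>y\<in>S \<inter> U. F y = f y)"
  proof (rule exI[of _ "U \<inter> V"], rule exI[of _ F], intro conjI allI)
    fix k show "Ck_on k F (U \<inter> V)" by (rule Ck_on_subset[of _ _ V]) (use V in auto)
  qed (use U V in auto)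
qed

lemma smooth_on_continuous:
  assumes "smooth_on S f" shows "continuous_on S f"
  unfolding continuous_on_eq_continuous_within
proof
  fix x assume x: "x \<in> S"
  obtain U F where U: "open U" "x \<in> U" "\<And>k. Ck_on k F U" "\<And>y. y \<in> S \<Longrightarrow> y \<in> U \<Longrightarrow> F y = f y"
    using smooth_onE[OF assms x] by blast
  have "isCont F x" using U(1,2) Ck_on_continuous[OF U(3)] by (simp add: continuous_on_eq_continuous_at)
  then have "continuous (at x within S) F" by (rule continuous_at_imp_continuous_within)
  moreover have "\<forall>\<^sub>F y in at x within S. F y = f y"
    using U x by (auto simp: eventually_at_topological)
  ultimately show "continuous (at x within S) f"
    using U(4)[OF x U(2)] by (simp add: continuous_within tendsto_cong)
qed

lemma smooth_on_const: "smooth_on S (\<lambda>x. c)"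
  by (rule smooth_on_subset[of UNIV]) (auto simp: smooth_on_open_iff Ck_on_const)

lemma smooth_on_bounded_linear: "bounded_linear L \<Longrightarrow> smooth_on S L"
  by (rule smooth_on_subset[of UNIV]) (auto simp: smooth_on_open_iff Ck_on_bounded_linear)

lemma smooth_on_id: "smooth_on S (\<lambda>x. x)"
  by (rule smooth_on_bounded_linear[OF bounded_linear_ident])

lemma smooth_on_compose:
  fixes f :: "'a::real_normed_vector \<Rightarrow> 'b::real_normed_vector"
    and g :: "'b \<Rightarrow> 'c::real_normed_vector"
  assumes fd: "fin_dim TYPE('b)" and g: "smooth_on T g" and f: "smooth_on S f" and "f ` S \<subseteq> T"
  shows "smooth_on S (\<lambda>x. g (f x))"
proof (rule smooth_onI)
  fix x assume x: "x \<in> S"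
  then obtain U F where U: "open U" "x \<in> U" "\<And>k. Ck_on k F U" "\<And>y. y \<in> S \<Longrightarrow> y \<in> U \<Longrightarrow> F y = f y"
    using smooth_onE[OF f x] by blast
  have "f x \<in> T" using x assms(4) by blast
  then obtain V H where V: "open V" "f x \<in> V" "\<And>k. Ck_on k H V" "\<And>y. y \<in> T \<Longrightarrow> y \<in> V \<Longrightarrow> H y = g y"
    using smooth_onE[OF g \<open>f x \<in> T\<close>] by blast
  have "continuous_on U F" using U(3) Ck_on_continuous by blast
  then have W: "open (U \<inter> F -` V)" using U(1) V(1) by (simp add: continuous_open_preimage)
  show "\<exists>U F. open U \<and> x \<in> U \<and> (\<forall>k. Ck_on k F U) \<and> (\<forall>y\<in>S \<inter> U. F y = g (f y))"
  proof (rule exI[of _ "U \<inter> F -` V"], rule exI[of _ "\<lambda>x. H (F x)"], intro conjI allI)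
    fix k show "Ck_on k (\<lambda>x. H (F x)) (U \<inter> F -` V)"
      by (rule Ck_on_compose[OF fd W V(1)]) (use U V Ck_on_subset in blast)+
  qed (use W U V x assms(4) in auto)
qed

lemma smooth_on_Pair:
  assumes "smooth_on S f" "smooth_on S g"
  shows "smooth_on S (\<lambda>x. (f x, g x))"
proof (rule smooth_onI)
  fix x assume x: "x \<in> S"
  then obtain U F where U: "open U" "x \<in> U" "\<And>k. Ck_on k F U" "\<And>y. y \<in> S \<Longrightarrow> y \<in> U \<Longrightarrow> F y = f y"
    using smooth_onE[OF assms(1) x] by blast
  obtain V H where V: "open V" "x \<in> V" "\<And>k. Ck_on k H V" "\<And>y. y \<in> S \<Longrightarrow> y \<in> V \<Longrightarrow> H y = g y"
    using smooth_onE[OF assms(2) x] by blast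
  show "\<exists>U F. open U \<and> x \<in> U \<and> (\<forall>k. Ck_on k F U) \<and> (\<forall>y\<in>S \<inter> U. F y = (f y, g y))"
  proof (rule exI[of _ "U \<inter> V"], rule exI[of _ "\<lambda>x. (F x, H x)"], intro conjI allI)
    fix k show "Ck_on k (\<lambda>x. (F x, H x)) (U \<inter> V)"
      by (rule Ck_on_Pair) (use U V Ck_on_subset[of k F U "U \<inter> V"] Ck_on_subset[of k H V "U \<inter> V"] in auto)
  qed (use U V in auto)
qed

lemma smooth_on_bounded_bilinear:
  assumes "bounded_bilinear pr" "smooth_on S f" "smooth_on S g"
  shows "smooth_on S (\<lambda>x. pr (f x) (g x))"
proof (rule smooth_onI)
  fix x assume x: "x \<in> S"
  then obtain U F where U: "open U" "x \<in> U" "\<And>k. Ck_on k F U" "\<And>y. y \<in> S \<Longrightarrow> y \<in> U \<Longrightarrow> F y = f y"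
    using smooth_onE[OF assms(2) x] by blast
  obtain V H where V: "open V" "x \<in> V" "\<And>k. Ck_on k H V" "\<And>y. y \<in> S \<Longrightarrow> y \<in> V \<Longrightarrow> H y = g y"
    using smooth_onE[OF assms(3) x] by blast
  show "\<exists>U F. open U \<and> x \<in> U \<and> (\<forall>k. Ck_on k F U) \<and> (\<forall>y\<in>S \<inter> U. F y = pr (f y) (g y))"
  proof (rule exI[of _ "U \<inter> V"], rule exI[of _ "\<lambda>x. pr (F x) (H x)"], intro conjI allI)
    fix k show "Ck_on k (\<lambda>x. pr (F x) (H x)) (U \<inter> V)"
      by (rule Ck_on_bounded_bilinear[OF assms(1)])
        (use U V Ck_on_subset[of k F U "U \<inter> V"] Ck_on_subset[of k H V "U \<inter> V"] in auto)
  qed (use U V in auto)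
qed

lemma smooth_on_bounded_linear_compose:
  assumes "bounded_linear L" "smooth_on S f" shows "smooth_on S (\<lambda>x. L (f x))"
proof (rule smooth_onI)
  fix x assume x: "x \<in> S"
  then obtain U F where U: "open U" "x \<in> U" "\<And>k. Ck_on k F U" "\<And>y. y \<in> S \<Longrightarrow> y \<in> U \<Longrightarrow> F y = f y"
    using smooth_onE[OF assms(2) x] by blast
  then show "\<exists>U F. open U \<and> x \<in> U \<and> (\<forall>k. Ck_on k F U) \<and> (\<forall>y\<in>S \<inter> U. F y = L (f y))"
    by (intro exI[of _ U] exI[of _ "\<lambda>x. L (F x)"]) (auto intro!: Ck_on_bounded_linear_compose[OF assms(1)])
qed

lemma smooth_on_fst: "smooth_on S f \<Longrightarrow> smooth_on S (\<lambda>x. fst (f x))"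
  by (rule smooth_on_bounded_linear_compose[OF bounded_linear_fst])

lemma smooth_on_snd: "smooth_on S f \<Longrightarrow> smooth_on S (\<lambda>x. snd (f x))"
  by (rule smooth_on_bounded_linear_compose[OF bounded_linear_snd])

lemma smooth_on_add: "smooth_on S f \<Longrightarrow> smooth_on S g \<Longrightarrow> smooth_on S (\<lambda>x. f x + g x)"
  using smooth_on_bounded_linear_compose[OF bounded_linear_add[OF bounded_linear_fst bounded_linear_snd] smooth_on_Pair]
  by simp

lemma smooth_on_sum:
  "(\<And>i. i \<in> I \<Longrightarrow> smooth_on S (f i)) \<Longrightarrow> smooth_on S (\<lambda>x. \<Sum>i\<in>I. f i x)"
  by (induction I rule: infinite_finite_induct) (auto intro: smooth_on_const smooth_on_add)

lemma smooth_on_derivative: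
  assumes "open S" "smooth_on S f" "x \<in> S"
  shows "(f has_derivative frechet_derivative f (at x)) (at x)"
  using assms Ck_on_SucD by (metis smooth_on_open_iff)

lemma smooth_on_frechet_derivative:
  assumes "open S" "smooth_on S f"
  shows "smooth_on S (\<lambda>x. frechet_derivative f (at x) v)"
  using assms by (metis smooth_on_open_iff Ck_on.simps(2))

text \<open>The derivative \<open>- x^-1 v x^-1\<close> is again a product of inverses, so the
  induction on k closes up.\<close>

lemma smooth_on_inverse: "smooth_on (- {0}) (inverse :: 'a::real_normed_field \<Rightarrow> 'a)"
proof -
  have op: "open (- {0} :: 'a set)" by auto
  have "Ck_on k (inverse :: 'a \<Rightarrow> 'a) (- {0})" for k
  proof (induction k)
    case 0
    then show ?case by (auto intro!: continuous_intros)
  next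
    case (Suc k)
    show ?case
    proof (rule Ck_on_SucI[OF op])
      fix x :: 'a assume "x \<in> - {0}"
      then show "(inverse has_derivative (\<lambda>v. - (inverse x * v * inverse x))) (at x)"
        by (intro has_derivative_inverse') auto
    next
      fix v :: 'a
      have "Ck_on k (\<lambda>x. inverse x * (- v) * inverse x) (- {0})"
        by (intro Ck_on_bounded_bilinear[OF bounded_bilinear_mult] op Suc Ck_on_const)
      then show "Ck_on k (\<lambda>x. - (inverse x * v * inverse x)) (- {0})" by simp
    qed
  qed
  then show ?thesis using smooth_on_open_iff[OF op] by blast
qed

lemma partial_derivative_at:
  fixes f :: "'a::real_normed_vector \<times> 'b::real_normed_vector \<Rightarrow> 'c::real_normed_vector"
  assumes "open S" "smooth_on S f" "(x, b) \<in> S"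
  shows "((\<lambda>z. f (x, z)) has_derivative (\<lambda>v. frechet_derivative f (at (x, b)) (0, v))) (at b)"
proof -
  have "((\<lambda>z. (x, z)) has_derivative (\<lambda>v. (0, v))) (at b)" by (auto intro!: derivative_eq_intros)
  from diff_chain_at[OF this smooth_on_derivative[OF assms]] show ?thesis by (simp add: o_def)
qed

text \<open>The partial derivative is the full derivative in the fixed direction
  \<open>(0, v)\<close>, hence smooth in x. For products in the chart this gives smoothness of
  left-invariant vector fields, for conjugation smoothness of the adjoint action.\<close>

lemma smooth_on_partial_derivative:
  fixes f :: "'a::real_normed_vector \<times> 'b::real_normed_vector \<Rightarrow> 'c::real_normed_vector"
  assumes "fin_dim TYPE('a)" "fin_dim TYPE('b)" and "open S" "smooth_on S f" "\<And>x. x \<in> D \<Longrightarrow> (x, b) \<in> S"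
  shows "smooth_on D (\<lambda>x. frechet_derivative (\<lambda>z. f (x, z)) (at b) v)"
proof -
  have "smooth_on D (\<lambda>x. frechet_derivative f (at (x, b)) (0, v))"
    by (rule smooth_on_compose[OF fin_dim_prod[OF assms(1,2)] smooth_on_frechet_derivative[OF assms(3,4)]])
      (use assms(5) in \<open>auto intro!: smooth_on_Pair smooth_on_id smooth_on_const\<close>)
  then show ?thesis
    by (rule smooth_on_cong) (use frechet_derivative_at[OF partial_derivative_at[OF assms(3,4)]] assms(5) in metis)
qed

lemma has_vector_derivative_transform_eventually:
  assumes "(f has_vector_derivative D) (at t within I)" "\<forall>\<^sub>F s in at t within I. f s = g s" "t \<in> I" "f t = g t"
  shows "(g has_vector_derivative D) (at t within I)"
  using has_derivative_transform_eventually[OF assms(1)[unfolded has_vector_derivative_def] assms(2,4,3)]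
  unfolding has_vector_derivative_def .

lemma isCont_of_continuous_on_UNIV:
  assumes "continuous_on UNIV F" shows "isCont F x"
  using assms by (simp add: continuous_on_eq_continuous_at)

section \<open>Local flows\<close>

text \<open>Finitely many directional derivatives are continuous, so they bound the operator norm
  near \<open>x0\<close>; the mean value inequality on a ball does the rest.\<close>

lemma smooth_locally_Lipschitz:
  fixes V :: "'e::real_normed_vector \<Rightarrow> 'b::real_normed_vector"
  assumes fd: "fin_dim TYPE('e)" and "open W" "x0 \<in> W" "smooth_on W V"
  obtains r L where "r > 0" "L > 0" "cball x0 r \<subseteq> W"
    "\<And>x y. x \<in> cball x0 r \<Longrightarrow> y \<in> cball x0 r \<Longrightarrow> norm (V x - V y) \<le> L * norm (x - y)"
proof -
  obtain B :: "'e set" and K where B: "finite B" "K > 0"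
    "\<And>(f::'e \<Rightarrow> 'b) x. linear f \<Longrightarrow> norm (f x) \<le> K * norm x * (\<Sum>b\<in>B. norm (f b))"
    using linear_bound_on_basis[OF fd] by blast
  define N where "N x = (\<Sum>b\<in>B. norm (frechet_derivative V (at x) b))" for x
  have "continuous_on W N" unfolding N_def
    by (intro continuous_intros smooth_on_continuous smooth_on_frechet_derivative assms)
  then have "isCont N x0" using assms(2,3) by (simp add: continuous_on_eq_continuous_at)
  then have "\<forall>\<^sub>F x in at x0. N x < N x0 + 1" by (rule order_tendstoD(2)[OF isContD]) simp
  then obtain d where d: "d > 0" "\<And>x. dist x x0 < d \<Longrightarrow> N x < N x0 + 1"
    unfolding eventually_at by (metis UNIV_I less_add_one)
  obtain r' where r': "r' > 0" "cball x0 r' \<subseteq> W" using assms(2,3) open_contains_cball by blast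
  \<comment> \<open>Half of d keeps the closed ball inside the open set on which N is
    controlled.\<close>
  define r where "r = min r' (d / 2)"
  define L where "L = K * (N x0 + 1)"
  have N0: "N x \<ge> 0" for x by (auto simp: N_def intro: sum_nonneg)
  have r: "r > 0" "cball x0 r \<subseteq> W" using r' d(1) by (auto simp: r_def)
  have L: "L > 0" using N0[of x0] B(2) by (auto simp: L_def)
  have "norm (V x - V y) \<le> L * norm (x - y)" if "x \<in> cball x0 r" "y \<in> cball x0 r" for x y
  proof (rule differentiable_bound[of "cball x0 r" V "\<lambda>x. frechet_derivative V (at x)"])
    fix x assume x: "x \<in> cball x0 r"
    have D: "(V has_derivative frechet_derivative V (at x)) (at x)"
      using smooth_on_derivative[OF assms(2,4)] x r(2) by blast
    then show "(V has_derivative frechet_derivative V (at x)) (at x within cball x0 r)"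
      by (rule has_derivative_at_withinI)
    have "dist x x0 < d" using x r(1) d(1) by (auto simp: r_def dist_commute)
    then have Nx: "N x \<le> N x0 + 1" using d(2) by (simp add: less_imp_le)
    show "onorm (frechet_derivative V (at x)) \<le> L"
    proof (rule onorm_bound)
      fix v
      have "norm (frechet_derivative V (at x) v) \<le> K * norm v * N x"
        using B(3)[OF has_derivative_linear[OF D]] by (simp add: N_def)
      also have "\<dots> \<le> K * norm v * (N x0 + 1)" using Nx B(2) by (intro mult_left_mono) auto
      finally show "norm (frechet_derivative V (at x) v) \<le> L * norm v" by (simp add: L_def mult_ac)
    qed (use L in simp)
  qed (use that in auto)
  then show thesis using that r L by blast
qed

lemma norm_antiderivative_le:
  fixes h :: "real \<Rightarrow> 'e::real_normed_vector"
  assumes "\<And>t. t \<in> {-d..d} \<Longrightarrow> (h has_vector_derivative f t) (at t within {-d..d})"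
    and "\<And>t. t \<in> {-d..d} \<Longrightarrow> norm (f t) \<le> c" and "h 0 = 0" "t \<in> {-d..d}" "d > 0"
  shows "norm (h t) \<le> c * \<bar>t\<bar>"
proof -
  have c: "c \<ge> 0" using assms(2)[of 0] assms(5) norm_ge_zero order_trans by (metis assms(2,4))
  have "norm (h t - h 0) \<le> c * norm (t - 0)"
  proof (rule differentiable_bound[of "{-d..d}" h "\<lambda>t v. v *\<^sub>R f t"])
    fix x assume x: "x \<in> {-d..d}"
    show "(h has_derivative (\<lambda>v. v *\<^sub>R f x)) (at x within {- d..d})"
      using assms(1)[OF x] by (simp add: has_vector_derivative_def)
    show "onorm (\<lambda>v. v *\<^sub>R f x) \<le> c"
      using assms(2)[OF x] by (intro onorm_bound c) (metis mult.commute mult_left_mono abs_ge_zero norm_scaleR real_norm_def)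
  qed (use assms in auto)
  then show ?thesis using assms(3) by simp
qed

text \<open>Picard iteration as a contraction of bounded continuous functions on the whole line. The
  integral is evaluated at the time clamped to \<open>[-d, d]\<close>, so that the complete space of
  functions on the line can be used without restricting domains.\<close>

lemma local_flow:
  fixes V :: "'e::banach \<Rightarrow> 'e"
  assumes fd: "fin_dim TYPE('e)" and "open W" "x0 \<in> W" "smooth_on W V"
  obtains d y where "d > 0" "y 0 = x0"
    "\<And>t. \<bar>t\<bar> < d \<Longrightarrow> y t \<in> W"
    "\<And>t. \<bar>t\<bar> < d \<Longrightarrow> (y has_vector_derivative V (y t)) (at t)"
proof -
  obtain r L where r: "r > 0" "L > 0" "cball x0 r \<subseteq> W"
    and Lip: "\<And>x y. x \<in> cball x0 r \<Longrightarrow> y \<in> cball x0 r \<Longrightarrow> norm (V x - V y) \<le> L * norm (x - y)"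
    using smooth_locally_Lipschitz[OF assms] by blast
  \<comment> \<open>A bound of V on the ball, by the Lipschitz estimate; the summand 1 makes M
    positive, so that one may divide by it.\<close>
  define M where "M = norm (V x0) + L * r + 1"
  have M: "norm (V x) \<le> M" if "x \<in> cball x0 r" for x
  proof -
    have "norm (V x) \<le> norm (V x0) + norm (V x - V x0)" by (metis norm_triangle_sub)
    also have "\<dots> \<le> norm (V x0) + L * norm (x - x0)" using Lip that r by auto
    also have "\<dots> \<le> M"
    proof -
      have "L * norm (x - x0) \<le> L * r"
        using that r by (intro mult_left_mono) (auto simp: dist_norm norm_minus_commute)
      then show ?thesis unfolding M_def by linarith
    qed
    finally show ?thesis .
  qed
  have Mpos: "M > 0" using r by (simp add: M_def add_nonneg_pos)
  \<comment> \<open>\<open>r / M\<close> keeps the iterates in the ball, \<open>1 / (2 * L)\<close>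
    makes the contraction factor 1/2.\<close>
  define d where "d = min (r / M) (1 / (2 * L))"
  have d: "d > 0" "d * M \<le> r" "L * d \<le> 1 / 2"
  proof -
    show "d > 0" using r Mpos by (simp add: d_def)
    have "d \<le> r / M" "d \<le> 1 / (2 * L)" by (auto simp: d_def)
    then show "d * M \<le> r" "L * d \<le> 1 / 2" using Mpos r(2) by (auto simp: field_simps)
  qed
  \<comment> \<open>The signed integral from 0 to t, written as a difference of integrals from
    \<open>-d\<close> so that negative t are covered.\<close>
  define J where "J f t = integral {-d..t} f - integral {-d..0} f" for f :: "real \<Rightarrow> 'e" and t
  have J0: "J f 0 = 0" for f by (simp add: J_def)
  have J': "(J f has_vector_derivative f t) (at t within {-d..d})"
    if "continuous_on {-d..d} f" "t \<in> {-d..d}" for f t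
    unfolding J_def[abs_def]
    using has_vector_derivative_diff_const[of "\<lambda>t. integral {-d..t} f"]
      integral_has_vector_derivative[OF that] by simp
  define cl where "cl t = max (-d) (min d t)" for t :: real
  have cl: "cl t \<in> {-d..d}" "t \<in> {-d..d} \<Longrightarrow> cl t = t" "\<bar>cl t\<bar> \<le> d" for t
    using d(1) by (auto simp: cl_def)
  have clc: "continuous_on UNIV cl" unfolding cl_def by (intro continuous_intros)
  define X where "X = {y :: real \<Rightarrow>\<^sub>C 'e. \<forall>t. apply_bcontfun y t \<in> cball x0 r}"
  have Vc: "continuous_on {-d..d} (\<lambda>t. V (apply_bcontfun y t))" if "y \<in> X" for y
    by (rule continuous_on_compose2[OF smooth_on_continuous[OF assms(4)]])
      (use that r(3) in \<open>auto simp: X_def\<close>)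
  have JX: "x0 + J (\<lambda>t. V (apply_bcontfun y t)) (cl t) \<in> cball x0 r" if "y \<in> X" for y t
  proof -
    have "norm (J (\<lambda>t. V (apply_bcontfun y t)) (cl t)) \<le> M * \<bar>cl t\<bar>"
      by (rule norm_antiderivative_le[OF J'[OF Vc[OF that]]]) (use that M d J0 cl in \<open>auto simp: X_def\<close>)
    also have "\<dots> \<le> M * d" using cl(3) Mpos by simp
    finally show ?thesis using d(2) by (simp add: dist_norm mult.commute)
  qed
  define T where "T y = Bcontfun (\<lambda>t. x0 + J (\<lambda>t. V (apply_bcontfun y t)) (cl t))" for y
  have T: "apply_bcontfun (T y) t = x0 + J (\<lambda>t. V (apply_bcontfun y t)) (cl t)" if "y \<in> X" for y t
  proof -
    have "continuous_on {-d..d} (J (\<lambda>t. V (apply_bcontfun y t)))"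
      using J'[OF Vc[OF that]] has_vector_derivative_continuous continuous_on_eq_continuous_within by blast
    then have "continuous_on UNIV (\<lambda>t. x0 + J (\<lambda>t. V (apply_bcontfun y t)) (cl t))"
      by (intro continuous_on_add continuous_on_const continuous_on_compose2[OF _ clc]) (use cl in auto)
    moreover have "bounded (range (\<lambda>t. x0 + J (\<lambda>t. V (apply_bcontfun y t)) (cl t)))"
      using JX[OF that] by (intro bounded_subset[OF bounded_cball[of x0 r]]) blast
    ultimately have "(\<lambda>t. x0 + J (\<lambda>t. V (apply_bcontfun y t)) (cl t)) \<in> bcontfun"
      by (simp add: bcontfun_def)
    then show ?thesis by (simp add: T_def Bcontfun_inverse)
  qed
  have "\<exists>!y\<in>X. T y = y"
  proof (rule Banach_fix)
    have "X = (\<Inter>t. {y. apply_bcontfun y t \<in> cball x0 r})" by (auto simp: X_def)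
    moreover have "closed {y :: real \<Rightarrow>\<^sub>C 'e. apply_bcontfun y t \<in> cball x0 r}" for t
    proof -
      have "continuous_on UNIV (\<lambda>y :: real \<Rightarrow>\<^sub>C 'e. apply_bcontfun y t)"
        unfolding continuous_on_iff using dist_bounded order_le_less_trans by blast
      then have "closed ((\<lambda>y :: real \<Rightarrow>\<^sub>C 'e. apply_bcontfun y t) -` cball x0 r)"
        by (rule continuous_closed_vimage[OF closed_cball, OF continuous_on_eq_continuous_at[THEN iffD1, OF open_UNIV, rule_format]]) auto
      then show ?thesis by (simp add: vimage_def)
    qed
    ultimately show "complete X" by (simp add: complete_eq_closed closed_INT)
    show "X \<noteq> {}" using r(1) by (auto simp: X_def intro!: exI[of _ "const_bcontfun x0"])
    show "0 \<le> (1/2::real)" "(1/2::real) < 1" by auto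
    show "T ` X \<subseteq> X" using T JX by (auto simp: X_def)
    show "dist (T y) (T z) \<le> 1 / 2 * dist y z" if y: "y \<in> X" "z \<in> X" for y z
    proof (rule dist_bound)
      fix t
      define h where "h t = J (\<lambda>t. V (apply_bcontfun y t)) t - J (\<lambda>t. V (apply_bcontfun z t)) t" for t
      have "norm (h (cl t)) \<le> (L * dist y z) * \<bar>cl t\<bar>"
      proof (rule norm_antiderivative_le[of d h "\<lambda>t. V (apply_bcontfun y t) - V (apply_bcontfun z t)"])
        fix t assume "t \<in> {-d..d}"
        then show "(h has_vector_derivative V (apply_bcontfun y t) - V (apply_bcontfun z t)) (at t within {- d..d})"
          unfolding h_def by (intro has_vector_derivative_diff J' Vc y)
        have "norm (V (apply_bcontfun y t) - V (apply_bcontfun z t)) \<le> L * norm (apply_bcontfun y t - apply_bcontfun z t)"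
          using y Lip by (simp add: X_def)
        also have "\<dots> \<le> L * dist y z" using dist_bounded[of y t z] r(2) by (simp add: dist_norm)
        finally show "norm (V (apply_bcontfun y t) - V (apply_bcontfun z t)) \<le> L * dist y z" .
      qed (use cl d(1) in \<open>auto simp: h_def J0\<close>)
      also have "\<dots> \<le> (L * dist y z) * d" using cl(3)[of t] r(2) by (intro mult_left_mono) auto
      also have "\<dots> \<le> 1 / 2 * dist y z" using mult_right_mono[OF d(3) zero_le_dist[of y z]] by (simp add: mult_ac)
      finally show "dist (apply_bcontfun (T y) t) (apply_bcontfun (T z) t) \<le> 1 / 2 * dist y z"
        by (simp add: T y dist_norm h_def)
    qed
  qed
  then obtain y where y: "y \<in> X" "T y = y" by blast
  have eq: "apply_bcontfun y t = x0 + J (\<lambda>t. V (apply_bcontfun y t)) t" if "t \<in> {-d..d}" for t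
    using T[OF y(1), of t] y(2) cl(2)[OF that] by simp
  show thesis
  proof (rule that[of d "apply_bcontfun y"])
    show "apply_bcontfun y 0 = x0" using eq[of 0] d(1) J0 by simp
    fix t :: real assume t: "\<bar>t\<bar> < d"
    show "apply_bcontfun y t \<in> W" using y(1) r(3) by (auto simp: X_def)
    have "((\<lambda>t. x0 + J (\<lambda>t. V (apply_bcontfun y t)) t) has_vector_derivative 0 + V (apply_bcontfun y t)) (at t within {-d..d})"
      using t by (intro has_vector_derivative_add has_vector_derivative_const J' Vc y) auto
    then have "(apply_bcontfun y has_vector_derivative V (apply_bcontfun y t)) (at t within {-d..d})"
      using t eq by (intro has_vector_derivative_transform[of t "{-d..d}" "apply_bcontfun y"]) auto
    moreover have "at t within {-d..d} = at t" using t by (intro at_within_interior) auto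
    ultimately show "(apply_bcontfun y has_vector_derivative V (apply_bcontfun y t)) (at t)" by simp
  qed (use d in auto)
qed

text \<open>Bootstrapping: if y is k times continuously differentiable, so is V along y, which is
  the derivative of y.\<close>

lemma integral_curve_smooth:
  fixes V :: "'e::real_normed_vector \<Rightarrow> 'e"
  assumes fd: "fin_dim TYPE('e)" and "open W" "smooth_on W V" and "open I" "y ` I \<subseteq> W"
    and "\<And>t. t \<in> I \<Longrightarrow> (y has_vector_derivative V (y t)) (at t)"
  shows "smooth_on I y"
proof -
  have "Ck_on k y I" for k
  proof (induction k)
    case 0
    then show ?case
      using assms(4,6) has_vector_derivative_continuous by (force simp: continuous_on_eq_continuous_at)
  next
    case (Suc k)
    show ?case
    proof (rule Ck_on_SucI[OF assms(4)])
      fix t assume "t \<in> I"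
      then show "(y has_derivative (\<lambda>v. v *\<^sub>R V (y t))) (at t)"
        using assms(6) by (simp add: has_vector_derivative_def)
    next
      fix v :: real
      have "Ck_on k (\<lambda>t. V (y t)) I"
        using Ck_on_compose[OF fd assms(4,2,5) Suc] assms(2,3) smooth_on_open_iff by blast
      then show "Ck_on k (\<lambda>t. v *\<^sub>R V (y t)) I"
        using Ck_on_bounded_linear_compose[OF bounded_linear_scaleR_right assms(4)] by blast
    qed
  qed
  then show ?thesis using assms(4) by (simp add: smooth_on_open_iff)
qed

section \<open>A bump function\<close>

text \<open>The classical flat function \<open>exp (-1/x)\<close> divided by a power of x. The
  powers make the family closed under differentiation, which leads from n to \<open>n + 1\<close>
  and \<open>n + 2\<close>.\<close>

definition flat_exp :: "nat \<Rightarrow> real \<Rightarrow> real" where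
  "flat_exp n x = (if x \<le> 0 then 0 else exp (- inverse x) * inverse x ^ n)"

lemma flat_exp_tendsto_0: "(flat_exp n \<longlongrightarrow> 0) (at 0)"
proof -
  have "((\<lambda>y::real. y ^ n / exp y) \<longlongrightarrow> 0) at_top" by (rule tendsto_power_div_exp_0)
  then have "((\<lambda>x::real. inverse x ^ n / exp (inverse x)) \<longlongrightarrow> 0) (at_right 0)"
    by (rule filterlim_compose) (rule filterlim_inverse_at_top_right)
  then have r: "(flat_exp n \<longlongrightarrow> 0) (at_right 0)"
    by (rule Lim_transform_eventually)
      (auto simp: flat_exp_def exp_minus divide_inverse eventually_at_right_field mult.commute intro: exI[of _ 1])
  have l: "(flat_exp n \<longlongrightarrow> 0) (at_left 0)"
    by (rule Lim_transform_eventually[OF tendsto_const])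
      (auto simp: flat_exp_def eventually_at_left_field intro: exI[of _ "-1"])
  show ?thesis using filterlim_split_at_real[OF l r] .
qed

lemma flat_exp_DERIV:
  "(flat_exp n has_real_derivative flat_exp (n + 2) x - n * flat_exp (n + 1) x) (at x)"
proof -
  consider "x < 0" | "x = 0" | "x > 0" by linarith
  then show ?thesis
  proof cases
    case 1
    have "((\<lambda>x. 0) has_real_derivative 0) (at x)" by simp
    then have "(flat_exp n has_real_derivative 0) (at x)"
      by (rule has_field_derivative_transform_within_open[of _ _ _ "{..<0}"]) (use 1 in \<open>auto simp: flat_exp_def\<close>)
    then show ?thesis using 1 by (simp add: flat_exp_def)
  next
    case 2
    \<comment> \<open>The difference quotient at 0 is the next member of the family, whose limit at
      0 is already known.\<close>
    have "flat_exp n h / h = flat_exp (n + 1) h" for h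
      by (simp add: flat_exp_def divide_inverse)
    then have "(flat_exp n has_real_derivative 0) (at 0)"
      using flat_exp_tendsto_0[of "n + 1"] by (simp add: DERIV_def flat_exp_def[of n 0])
    then show ?thesis using 2 by (simp add: flat_exp_def)
  next
    case 3
    have "((\<lambda>x. exp (- inverse x) * inverse x ^ n) has_real_derivative
        exp (- inverse x) * (inverse x ^ 2) * inverse x ^ n - exp (- inverse x) * (n * inverse x ^ (n - 1) * inverse x ^ 2)) (at x)"
      using 3 by (auto intro!: derivative_eq_intros simp: power2_eq_square)
    moreover have "exp (- inverse x) * (inverse x ^ 2) * inverse x ^ n
        - exp (- inverse x) * (n * inverse x ^ (n - 1) * inverse x ^ 2) = flat_exp (n + 2) x - n * flat_exp (n + 1) x"
      using 3 by (cases n) (auto simp: flat_exp_def power2_eq_square algebra_simps)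
    ultimately have "((\<lambda>x. exp (- inverse x) * inverse x ^ n) has_real_derivative
        flat_exp (n + 2) x - n * flat_exp (n + 1) x) (at x)" by simp
    then show ?thesis
      by (rule has_field_derivative_transform_within_open[of _ _ _ "{0<..}"]) (use 3 in \<open>auto simp: flat_exp_def\<close>)
  qed
qed

lemma flat_exp_smooth: "smooth_on S (flat_exp n)"
proof -
  have "Ck_on k (flat_exp n) UNIV" for k
  proof (induction k arbitrary: n)
    case 0
    then show ?case
      using DERIV_isCont[OF flat_exp_DERIV] by (simp add: continuous_on_eq_continuous_at)
  next
    case (Suc k)
    show ?case
    proof (rule Ck_on_SucI[OF open_UNIV])
      fix x show "(flat_exp n has_derivative (\<lambda>v. v * (flat_exp (n + 2) x + (- n) * flat_exp (n + 1) x))) (at x)"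
        using flat_exp_DERIV[of n x] by (simp add: has_field_derivative_def mult_commute_abs)
    next
      fix v :: real
      show "Ck_on k (\<lambda>x. v * (flat_exp (n + 2) x + (- n) * flat_exp (n + 1) x)) UNIV"
        by (intro Ck_on_bounded_linear_compose[OF bounded_linear_mult_right] Ck_on_add Suc open_UNIV)
    qed
  qed
  then have "smooth_on UNIV (flat_exp n)" by (simp add: smooth_on_open_iff)
  then show ?thesis by (rule smooth_on_subset) simp
qed

text \<open>A norm need not be smooth, so the squared distance to \<open>x0\<close> is replaced by
  the sum of the squared coordinates.\<close>

lemma smooth_bump:
  fixes x0 :: "'e::real_normed_vector"
  assumes "fin_dim TYPE('e)" "r > 0"
  obtains \<beta> :: "'e \<Rightarrow> real" where "smooth_on UNIV \<beta>" "\<And>x. \<beta> x \<ge> 0" "\<beta> x0 > 0"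
    "\<And>x. norm (x - x0) \<ge> r \<Longrightarrow> \<beta> x = 0"
proof -
  obtain B :: "'e set" and c where B: "finite B" "\<And>b. bounded_linear (c b)" "\<And>x. x = (\<Sum>b\<in>B. c b x *\<^sub>R b)"
    using fin_dim_coords[OF assms(1)] by blast
  \<comment> \<open>If all coordinates of \<open>x - x0\<close> are below \<open>r / K\<close>, the
    triangle inequality gives a norm below r; the summand 1 makes K positive and the inequality
    strict.\<close>
  define K where "K = 1 + (\<Sum>b\<in>B. norm b)"
  have K: "K > 0" by (auto simp: K_def intro!: add_pos_nonneg sum_nonneg)
  define s where "s = (r / K)\<^sup>2"
  have s: "s > 0" using K assms(2) by (simp add: s_def)
  define \<beta> where "\<beta> x = flat_exp 0 (s + (\<Sum>b\<in>B. (- 1) * (c b (x - x0) * c b (x - x0))))" for x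
  have "smooth_on UNIV \<beta>"
    unfolding \<beta>_def
  proof (rule smooth_on_compose[OF fin_dim_euclidean flat_exp_smooth[of UNIV]])
    have sub: "smooth_on UNIV (\<lambda>x. x - x0)"
      using smooth_on_add[OF smooth_on_id smooth_on_const[of _ "- x0"]] by simp
    have "smooth_on UNIV (\<lambda>x. c b (x - x0))" for b
      by (rule smooth_on_bounded_linear_compose[OF B(2) sub])
    then show "smooth_on UNIV (\<lambda>x. s + (\<Sum>b\<in>B. (- 1) * (c b (x - x0) * c b (x - x0))))"
      by (intro smooth_on_add smooth_on_sum smooth_on_const smooth_on_bounded_bilinear[OF bounded_bilinear_mult])
  qed simp
  moreover have "\<beta> x \<ge> 0" for x by (simp add: \<beta>_def flat_exp_def)
  moreover have "\<beta> x0 > 0"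
    using s by (simp add: \<beta>_def flat_exp_def bounded_linear.linear[OF B(2)] linear_0)
  moreover have "\<beta> x = 0" if x: "norm (x - x0) \<ge> r" for x
  proof (rule ccontr)
    assume "\<beta> x \<noteq> 0"
    then have lt: "(\<Sum>b\<in>B. (c b (x - x0))\<^sup>2) < s"
      by (auto simp: \<beta>_def flat_exp_def sum_negf power2_eq_square split: if_splits)
    have le: "\<bar>c b (x - x0)\<bar> < r / K" if "b \<in> B" for b
    proof -
      have "(c b (x - x0))\<^sup>2 \<le> (\<Sum>b\<in>B. (c b (x - x0))\<^sup>2)"
        by (rule member_le_sum[of b B "\<lambda>b. (c b (x - x0))\<^sup>2"]) (use that B in auto)
      then have "(c b (x - x0))\<^sup>2 < (r / K)\<^sup>2" using lt by (simp add: s_def)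
      then show ?thesis using K assms(2) by (metis abs_le_square_iff abs_of_pos divide_pos_pos not_le)
    qed
    have "norm (x - x0) = norm (\<Sum>b\<in>B. c b (x - x0) *\<^sub>R b)" using B(3) by simp
    also have "\<dots> \<le> (\<Sum>b\<in>B. \<bar>c b (x - x0)\<bar> * norm b)" by (rule sum_norm_le) simp
    also have "\<dots> \<le> (\<Sum>b\<in>B. r / K * norm b)" using le by (intro sum_mono mult_right_mono) (auto simp: less_imp_le)
    also have "\<dots> = r / K * (K - 1)" by (simp add: K_def sum_distrib_left)
    also have "\<dots> < r" using K assms(2) by (simp add: field_simps)
    finally show False using x by simp
  qed
  ultimately show thesis using that by blast
qed

section \<open>Smooth maps into a Lie group\<close>

context lie_group
begin

lemma in_carrier [simp]: "x \<in> carrier G"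
  by (simp add: carrier_UNIV)

lemma inv_cancel: "inv a \<otimes> (a \<otimes> b) = b" "a \<otimes> (inv a \<otimes> b) = b"
  by (simp_all add: m_assoc[symmetric])

lemma fin_dim_model: "fin_dim TYPE('e)"
  using finite_dim by (simp add: fin_dim_def)

lemma fin_dim_model2: "fin_dim TYPE('e \<times> 'e)"
  by (intro fin_dim_prod fin_dim_model)

lemma chartE:
  obtains U \<rho> where "(U, \<rho>) \<in> charts G" "h \<in> U"
proof -
  have "h \<in> (\<Union>(U, \<phi>)\<in>charts G. U)" using charts_cover by simp
  then show thesis by (rule UN_E) (simp split: prod.splits add: that)
qed

lemma chart_open:
  assumes "(U, \<rho>) \<in> charts G" shows "open U" "open (\<rho> ` U)"
  using chart_homeomorphism[OF assms] by simp_all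

lemma chart_continuous:
  assumes "(U, \<rho>) \<in> charts G"
  shows "continuous_on U \<rho>" "continuous_on (\<rho> ` U) (inv_into U \<rho>)"
  using chart_homeomorphism[OF assms] by (simp_all add: homeomorphism_def)

lemma chart_inv_into [simp]:
  assumes "(U, \<rho>) \<in> charts G" "h \<in> U" shows "inv_into U \<rho> (\<rho> h) = h"
  using chart_homeomorphism[OF assms(1)] assms(2) by (simp add: homeomorphism_def)

lemma smooth_intoI:
  assumes "continuous_on D f"
    "\<And>U \<rho>. (U, \<rho>) \<in> charts G \<Longrightarrow> smooth_on {x\<in>D. f x \<in> U} (\<lambda>x. \<rho> (f x))"
  shows "smooth_into G D f"
  unfolding smooth_into_def using assms(1) by (auto intro!: assms(2) simp: o_def)

lemma smooth_intoD:
  assumes "smooth_into G D f" "(U, \<rho>) \<in> charts G"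
  shows "smooth_on {x\<in>D. f x \<in> U} (\<lambda>x. \<rho> (f x))"
proof -
  have "\<forall>(U, \<rho>)\<in>charts G. smooth_on {x\<in>D. f x \<in> U} (\<rho> \<circ> f)"
    using assms(1) by (simp add: smooth_into_def)
  from bspec[OF this assms(2)] show ?thesis by (simp add: o_def)
qed

lemma smooth_into_continuous: "smooth_into G D f \<Longrightarrow> continuous_on D f"
  by (simp add: smooth_into_def)

lemma smooth_into_chart:
  assumes "smooth_into G D f" "(U, \<rho>) \<in> charts G" "f ` D \<subseteq> U"
  shows "smooth_on D (\<lambda>x. \<rho> (f x))"
proof -
  have "{x \<in> D. f x \<in> U} = D" using assms(3) by blast
  then show ?thesis using smooth_intoD[OF assms(1,2)] by simp
qed

lemma smooth_into_subset:
  assumes "smooth_into G D f" "D' \<subseteq> D" shows "smooth_into G D' f"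
proof (rule smooth_intoI)
  show "continuous_on D' f" by (rule continuous_on_subset[OF smooth_into_continuous[OF assms(1)] assms(2)])
  fix U \<rho> assume "(U, \<rho>) \<in> charts G"
  from smooth_intoD[OF assms(1) this]
  show "smooth_on {x \<in> D'. f x \<in> U} (\<lambda>x. \<rho> (f x))"
    by (rule smooth_on_subset) (use assms(2) in blast)
qed

lemma smooth_into_cong:
  assumes "smooth_into G D f" "\<And>x. x \<in> D \<Longrightarrow> f x = f' x" shows "smooth_into G D f'"
proof (rule smooth_intoI)
  show "continuous_on D f'"
    by (rule continuous_on_cong[THEN iffD1, OF refl _ smooth_into_continuous[OF assms(1)]]) (rule assms(2))
  fix U \<rho> assume c: "(U, \<rho>) \<in> charts G"
  have "{x \<in> D. f' x \<in> U} = {x \<in> D. f x \<in> U}" using assms(2) by auto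
  then show "smooth_on {x \<in> D. f' x \<in> U} (\<lambda>x. \<rho> (f' x))"
    using smooth_on_cong[OF smooth_intoD[OF assms(1) c], of "\<lambda>x. \<rho> (f' x)"] assms(2) by simp
qed

lemma smooth_into_local:
  assumes "\<And>x. x \<in> D \<Longrightarrow> \<exists>N. open N \<and> x \<in> N \<and> smooth_into G (D \<inter> N) f"
  shows "smooth_into G D f"
proof (rule smooth_intoI)
  show "continuous_on D f"
    unfolding continuous_on_eq_continuous_within
  proof
    fix x assume x: "x \<in> D"
    then obtain N where N: "open N" "x \<in> N" "smooth_into G (D \<inter> N) f" using assms by blast
    then have "continuous (at x within D \<inter> N) f"
      using x smooth_into_continuous[OF N(3)] by (simp add: continuous_on_eq_continuous_within)
    then show "continuous (at x within D) f"
      using at_within_nhd[OF N(2,1), of "D \<inter> N" D] by (simp add: continuous_within Int_assoc)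
  qed
  fix U \<rho> assume c: "(U, \<rho>) \<in> charts G"
  show "smooth_on {x \<in> D. f x \<in> U} (\<lambda>x. \<rho> (f x))"
  proof (rule smooth_on_local)
    fix x assume "x \<in> {x \<in> D. f x \<in> U}"
    then obtain N where N: "open N" "x \<in> N" "smooth_into G (D \<inter> N) f" using assms by blast
    have "{x \<in> D. f x \<in> U} \<inter> N = {x \<in> D \<inter> N. f x \<in> U}" by auto
    then have "smooth_on ({x \<in> D. f x \<in> U} \<inter> N) (\<lambda>x. \<rho> (f x))"
      using smooth_intoD[OF N(3) c] by simp
    then show "\<exists>N. open N \<and> x \<in> N \<and> smooth_on ({x \<in> D. f x \<in> U} \<inter> N) (\<lambda>x. \<rho> (f x))"
      using N by blast
  qed
qed

lemma smooth_into_compose: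
  fixes q :: "'a::real_normed_vector \<Rightarrow> 'b::real_normed_vector"
  assumes fd: "fin_dim TYPE('b)" and f: "smooth_into G T f" and q: "smooth_on S q" and "q ` S \<subseteq> T"
  shows "smooth_into G S (\<lambda>x. f (q x))"
proof (rule smooth_intoI)
  show "continuous_on S (\<lambda>x. f (q x))"
    by (rule continuous_on_compose2[OF smooth_into_continuous[OF f] smooth_on_continuous[OF q] assms(4)])
  fix U \<rho> assume c: "(U, \<rho>) \<in> charts G"
  have "smooth_on {x \<in> S. f (q x) \<in> U} q" by (rule smooth_on_subset[OF q]) auto
  with smooth_intoD[OF f c] show "smooth_on {x \<in> S. f (q x) \<in> U} (\<lambda>x. \<rho> (f (q x)))"
    by (rule smooth_on_compose[OF fd]) (use assms(4) in auto)
qed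

lemma smooth_into_chart_nbhd:
  assumes "smooth_into G D f" "x \<in> D" "(U, \<rho>) \<in> charts G" "f x \<in> U"
  obtains N where "open N" "x \<in> N" "f ` (D \<inter> N) \<subseteq> U" "smooth_on (D \<inter> N) (\<lambda>x. \<rho> (f x))"
proof -
  have "continuous_on D f" using assms(1) by (rule smooth_into_continuous)
  then obtain N where N: "open N" "x \<in> N" "\<forall>y\<in>D. y \<in> N \<longrightarrow> f y \<in> U"
    using assms(2,4) chart_open(1)[OF assms(3)] unfolding continuous_on_topological by meson
  then have "f ` (D \<inter> N) \<subseteq> U" by blast
  moreover from this have "smooth_on (D \<inter> N) (\<lambda>x. \<rho> (f x))"
    by (intro smooth_into_chart[OF smooth_into_subset[OF assms(1)] assms(3)]) auto
  ultimately show thesis using N that by blast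
qed

lemma smooth_into_chart_inv:
  assumes c: "(U, \<rho>) \<in> charts G"
  shows "smooth_into G (\<rho> ` U) (inv_into U \<rho>)"
proof (rule smooth_intoI)
  fix V \<tau> assume "(V, \<tau>) \<in> charts G"
  moreover have "{x \<in> \<rho> ` U. inv_into U \<rho> x \<in> V} = \<rho> ` (U \<inter> V)" using c by auto
  ultimately show "smooth_on {x \<in> \<rho> ` U. inv_into U \<rho> x \<in> V} (\<lambda>x. \<tau> (inv_into U \<rho> x))"
    using chart_compatible[OF c] by (simp add: o_def)
qed (rule chart_continuous[OF c])

lemma smooth_into_const: "smooth_into G D (\<lambda>x. h)"
  by (rule smooth_intoI) (auto simp: smooth_on_const)

lemma smooth_into_mult:
  assumes "smooth_into G D f" "smooth_into G D g"
  shows "smooth_into G D (\<lambda>x. f x \<otimes> g x)"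
proof (rule smooth_into_local)
  fix x assume x: "x \<in> D"
  obtain U \<rho> where U: "(U, \<rho>) \<in> charts G" "f x \<in> U" by (rule chartE)
  obtain V \<tau> where V: "(V, \<tau>) \<in> charts G" "g x \<in> V" by (rule chartE)
  obtain M where M: "open M" "x \<in> M" "f ` (D \<inter> M) \<subseteq> U" "smooth_on (D \<inter> M) (\<lambda>x. \<rho> (f x))"
    using smooth_into_chart_nbhd[OF assms(1) x U] by blast
  obtain N where N: "open N" "x \<in> N" "g ` (D \<inter> N) \<subseteq> V" "smooth_on (D \<inter> N) (\<lambda>x. \<tau> (g x))"
    using smooth_into_chart_nbhd[OF assms(2) x V] by blast
  have "smooth_into G (D \<inter> (M \<inter> N)) (\<lambda>x. (\<lambda>(x, y). inv_into U \<rho> x \<otimes> inv_into V \<tau> y) (\<rho> (f x), \<tau> (g x)))"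
    by (rule smooth_into_compose[OF fin_dim_model2 mult_smooth[OF U(1) V(1)]])
      (use M N in \<open>auto intro!: smooth_on_Pair intro: smooth_on_subset\<close>)
  then have "smooth_into G (D \<inter> (M \<inter> N)) (\<lambda>x. f x \<otimes> g x)"
    by (rule smooth_into_cong) (use M N U V in \<open>auto simp: image_subset_iff\<close>)
  then show "\<exists>N. open N \<and> x \<in> N \<and> smooth_into G (D \<inter> N) (\<lambda>x. f x \<otimes> g x)"
    using M N by blast
qed

lemma smooth_into_inv:
  assumes "smooth_into G D f"
  shows "smooth_into G D (\<lambda>x. inv (f x))"
proof (rule smooth_into_local)
  fix x assume x: "x \<in> D"
  obtain U \<rho> where U: "(U, \<rho>) \<in> charts G" "f x \<in> U" by (rule chartE)
  obtain M where M: "open M" "x \<in> M" "f ` (D \<inter> M) \<subseteq> U" "smooth_on (D \<inter> M) (\<lambda>x. \<rho> (f x))"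
    using smooth_into_chart_nbhd[OF assms(1) x U] by blast
  have "smooth_into G (D \<inter> M) (\<lambda>x. (\<lambda>x. inv (inv_into U \<rho> x)) (\<rho> (f x)))"
    by (rule smooth_into_compose[OF fin_dim_model inv_smooth[OF U(1)] M(4)]) (use M in auto)
  then have "smooth_into G (D \<inter> M) (\<lambda>x. inv (f x))"
    by (rule smooth_into_cong) (use M U in \<open>auto simp: image_subset_iff\<close>)
  then show "\<exists>N. open N \<and> x \<in> N \<and> smooth_into G (D \<inter> N) (\<lambda>x. inv (f x))"
    using M by blast
qed

lemma continuous_mult: "continuous_on UNIV (\<lambda>p. fst p \<otimes> snd p)"
  unfolding continuous_on_eq_continuous_within
proof
  fix p :: "'g \<times> 'g"
  obtain U \<rho> where U: "(U, \<rho>) \<in> charts G" "fst p \<in> U" by (rule chartE)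
  obtain V \<tau> where V: "(V, \<tau>) \<in> charts G" "snd p \<in> V" by (rule chartE)
  have "continuous_on (U \<times> V) (\<lambda>p. (\<lambda>(x, y). inv_into U \<rho> x \<otimes> inv_into V \<tau> y) (\<rho> (fst p), \<tau> (snd p)))"
    by (rule continuous_on_compose2[OF smooth_into_continuous[OF mult_smooth[OF U(1) V(1)]]])
      (auto intro!: continuous_intros continuous_on_compose2[OF chart_continuous(1)] U V)
  then have "continuous_on (U \<times> V) (\<lambda>p. fst p \<otimes> snd p)"
    by (rule continuous_on_cong[THEN iffD1, rotated -1]) (use U V in auto)
  moreover have "open (U \<times> V)" "p \<in> U \<times> V"
    using U V chart_open by (auto intro: open_Times simp: mem_Times_iff)
  ultimately show "isCont (\<lambda>p. fst p \<otimes> snd p) p" using continuous_on_eq_continuous_at by blast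
qed

lemma continuous_inv: "continuous_on UNIV (\<lambda>h. inv h)"
  unfolding continuous_on_eq_continuous_within
proof
  fix p :: "'g"
  obtain U \<rho> where U: "(U, \<rho>) \<in> charts G" "p \<in> U" by (rule chartE)
  have "continuous_on U (\<lambda>p. (\<lambda>x. inv (inv_into U \<rho> x)) (\<rho> p))"
    by (rule continuous_on_compose2[OF smooth_into_continuous[OF inv_smooth[OF U(1)]]])
      (auto intro!: chart_continuous(1) U)
  then have "continuous_on U (\<lambda>h. inv h)"
    by (rule continuous_on_cong[THEN iffD1, rotated -1]) (use U in auto)
  then show "isCont (\<lambda>h. inv h) p" using U chart_open continuous_on_eq_continuous_at by blast
qed

lemma continuous_on_group_mult [continuous_intros]:
  assumes "continuous_on S f" "continuous_on S g" shows "continuous_on S (\<lambda>x. f x \<otimes> g x)"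
  using continuous_on_compose2[OF continuous_mult continuous_on_Pair[OF assms]] by simp

lemma continuous_on_group_inv [continuous_intros]:
  assumes "continuous_on S f" shows "continuous_on S (\<lambda>x. inv (f x))"
  using continuous_on_compose2[OF continuous_inv assms] by simp

lemma continuous_group_mult [continuous_intros]:
  assumes "continuous F f" "continuous F g" shows "continuous F (\<lambda>x. f x \<otimes> g x)"
proof -
  have "((\<lambda>x. fst (f x, g x) \<otimes> snd (f x, g x)) \<longlongrightarrow> fst (f (netlimit F), g (netlimit F)) \<otimes> snd (f (netlimit F), g (netlimit F))) F"
    using continuous_mult assms unfolding continuous_def
    by (intro isCont_tendsto_compose[of _ "\<lambda>p. fst p \<otimes> snd p"] tendsto_Pair) (auto simp: continuous_on_eq_continuous_at)
  then show ?thesis by (simp add: continuous_def)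
qed

section \<open>Velocities\<close>

definition phi :: "'g \<Rightarrow> 'e" where "phi = chart_one G"
text \<open>\<open>chart_one\<close> selects a map only; a domain on which this map is a chart
  around the identity has to be selected separately.\<close>

definition dom1 :: "'g set" where "dom1 = (SOME U. (U, phi) \<in> charts G \<and> \<one> \<in> U)"
definition E :: "'e \<Rightarrow> 'g" where "E = inv_into dom1 phi"
definition W :: "'e set" where "W = phi ` dom1"
definition e0 :: 'e where "e0 = phi \<one>"

lemma chart1: "(dom1, phi) \<in> charts G" and one_dom1 [simp]: "\<one> \<in> dom1"
proof -
  have "\<exists>\<phi> U. (U, \<phi>) \<in> charts G \<and> \<one> \<in> U" using chartE by metis
  then have "\<exists>U. (U, phi) \<in> charts G \<and> \<one> \<in> U"
    unfolding phi_def chart_one_def by (rule someI_ex)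
  then have "(dom1, phi) \<in> charts G \<and> \<one> \<in> dom1"
    unfolding dom1_def by (rule someI_ex)
  then show "(dom1, phi) \<in> charts G" "\<one> \<in> dom1" by auto
qed

lemma open_dom1: "open dom1" and open_W: "open W"
  using chart_open[OF chart1] by (auto simp: W_def)

lemma E_phi [simp]: "h \<in> dom1 \<Longrightarrow> E (phi h) = h"
  using chart1 by (simp add: E_def)

lemma phi_E [simp]: "x \<in> W \<Longrightarrow> phi (E x) = x"
  by (simp add: E_def W_def f_inv_into_f)

lemma E_dom1 [simp]: "x \<in> W \<Longrightarrow> E x \<in> dom1"
  by (simp add: E_def W_def inv_into_into)

lemma phi_W [simp]: "h \<in> dom1 \<Longrightarrow> phi h \<in> W"
  by (simp add: W_def)

lemma e0_W [simp]: "e0 \<in> W" and E_e0 [simp]: "E e0 = \<one>"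
  by (auto simp: e0_def)

lemma smooth_into_E: "smooth_into G W E"
  using smooth_into_chart_inv[OF chart1] by (simp add: E_def W_def)

lemma smooth_into_E_compose:
  fixes q :: "'a::real_normed_vector \<Rightarrow> 'e"
  assumes "smooth_on S q" "q ` S \<subseteq> W" shows "smooth_into G S (\<lambda>x. E (q x))"
  by (rule smooth_into_compose[OF fin_dim_model smooth_into_E assms])

lemma continuous_E: "continuous_on W E"
  by (rule smooth_into_continuous[OF smooth_into_E])

lemma continuous_phi: "continuous_on dom1 phi"
  by (rule chart_continuous[OF chart1])

lemma smooth_into_phi_nbhd:
  assumes "smooth_into G D f" "open D" "x \<in> D" "f x \<in> dom1"
  obtains N where "open N" "x \<in> N" "N \<subseteq> D" "f ` N \<subseteq> dom1" "smooth_on N (\<lambda>x. phi (f x))"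
  using smooth_into_chart_nbhd[OF assms(1,3) chart1 assms(4)] assms(2,3) by (metis Int_iff Int_lower1 open_Int)

lemma smooth_into_phi_derivative:
  assumes "smooth_into G D f" "open D" "x \<in> D" "f x \<in> dom1"
  shows "((\<lambda>x. phi (f x)) has_derivative frechet_derivative (\<lambda>x. phi (f x)) (at x)) (at x)"
  using smooth_into_phi_nbhd[OF assms] smooth_on_derivative by metis

text \<open>The continuity makes \<open>has_velocity_one\<close> meaningful: it keeps the curve inside the chart.\<close>

definition vel1 :: "(real \<Rightarrow> 'g) \<Rightarrow> 'e \<Rightarrow> real \<Rightarrow> real set \<Rightarrow> bool" where
  "vel1 k C t I \<longleftrightarrow> t \<in> I \<and> has_velocity_one G k C t I \<and> continuous (at t within I) k"

lemma vel1_iff: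
  "vel1 k C t I \<longleftrightarrow> t \<in> I \<and> k t = \<one> \<and> continuous (at t within I) k \<and>
     ((\<lambda>s. phi (k s)) has_vector_derivative C) (at t within I)"
  by (auto simp: vel1_def has_velocity_one_def phi_def)

lemma vel1_eventually:
  assumes "vel1 k C t I" shows "\<forall>\<^sub>F s in at t within I. k s \<in> dom1"
proof -
  have "(k \<longlongrightarrow> \<one>) (at t within I)" using assms by (auto simp: vel1_iff continuous_within)
  then show ?thesis using open_dom1 one_dom1 by (rule topological_tendstoD)
qed

text \<open>Near t the curve lies in \<open>dom1\<close>, where it equals
  \<open>E (phi (k s))\<close>; differentiability of F is thus required only through the chart at
  the identity.\<close>

lemma vel1_chain:
  assumes "vel1 k C t I" "((\<lambda>x. F (E x)) has_derivative D) (at e0)"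
  shows "((\<lambda>s. F (k s)) has_vector_derivative D C) (at t within I)"
proof -
  have k: "t \<in> I" "k t = \<one>" "((\<lambda>s. phi (k s)) has_vector_derivative C) (at t within I)" using assms by (auto simp: vel1_iff)
  have "phi (k t) = e0" using k by (simp add: e0_def)
  then have "((\<lambda>x. F (E x)) has_derivative D) (at (phi (k t)) within (\<lambda>s. phi (k s)) ` I)"
    using has_derivative_at_withinI[OF assms(2)] by simp
  from diff_chain_within[OF k(3)[unfolded has_vector_derivative_def] this]
  have "((\<lambda>s. F (E (phi (k s)))) has_derivative (\<lambda>h. D (h *\<^sub>R C))) (at t within I)" by (simp add: o_def)
  then have "((\<lambda>s. F (E (phi (k s)))) has_vector_derivative D C) (at t within I)"
    by (simp add: has_vector_derivative_def linear_scale[OF has_derivative_linear[OF assms(2)]])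
  then show ?thesis
    by (rule has_vector_derivative_transform_eventually)
      (use vel1_eventually[OF assms(1)] k in \<open>auto elim: eventually_mono\<close>)
qed

lemma vel1_chain2:
  assumes "vel1 k C t I" "vel1 l B t I" "((\<lambda>p. F (E (fst p)) (E (snd p))) has_derivative D) (at (e0, e0))"
  shows "((\<lambda>s. F (k s) (l s)) has_vector_derivative D (C, B)) (at t within I)"
proof -
  have k: "t \<in> I" "k t = \<one>" "((\<lambda>s. phi (k s)) has_vector_derivative C) (at t within I)" using assms by (auto simp: vel1_iff)
  have l: "l t = \<one>" "((\<lambda>s. phi (l s)) has_vector_derivative B) (at t within I)" using assms by (auto simp: vel1_iff)
  have "(phi (k t), phi (l t)) = (e0, e0)" using k l by (simp add: e0_def)
  then have "((\<lambda>p. F (E (fst p)) (E (snd p))) has_derivative D) (at (phi (k t), phi (l t)) within (\<lambda>s. (phi (k s), phi (l s))) ` I)"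
    using has_derivative_at_withinI[OF assms(3)] by simp
  from diff_chain_within[OF has_vector_derivative_Pair[OF k(3) l(2), unfolded has_vector_derivative_def] this]
  have "((\<lambda>s. F (E (phi (k s))) (E (phi (l s)))) has_derivative (\<lambda>h. D (h *\<^sub>R (C, B)))) (at t within I)" by (simp add: o_def)
  then have "((\<lambda>s. F (E (phi (k s))) (E (phi (l s)))) has_vector_derivative D (C, B)) (at t within I)"
    unfolding has_vector_derivative_def linear_scale[OF has_derivative_linear[OF assms(3)]] .
  then show ?thesis
    by (rule has_vector_derivative_transform_eventually)
      (use eventually_conj[OF vel1_eventually[OF assms(1)] vel1_eventually[OF assms(2)]] k l in \<open>auto elim!: eventually_mono\<close>)
qed

lemma vel1_compose_phi:
  assumes "vel1 k C t I" "F \<one> = \<one>" "isCont F \<one>" "((\<lambda>x. phi (F (E x))) has_derivative D) (at e0)"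
  shows "vel1 (\<lambda>s. F (k s)) (D C) t I"
proof -
  have "continuous (at t within I) (\<lambda>s. F (k s))"
    using assms(1,3) by (auto simp: vel1_iff continuous_within intro: isCont_tendsto_compose[of \<one> F])
  then show ?thesis using vel1_chain[OF assms(1), of "\<lambda>h. phi (F h)"] assms by (auto simp: vel1_iff)
qed

text \<open>Every vector of the model space is realized as a velocity. Linear maps that are known
  only through velocities are identified by testing them on these curves.\<close>

lemma vel1_line: "vel1 (\<lambda>s. E (e0 + s *\<^sub>R C)) C 0 UNIV"
proof -
  have cl: "continuous (at 0) (\<lambda>s. e0 + s *\<^sub>R C)" by (intro continuous_intros)
  have "isCont E e0" using continuous_E open_W by (simp add: continuous_on_eq_continuous_at)
  then have cE: "continuous (at 0) (\<lambda>s. E (e0 + s *\<^sub>R C))" using continuous_at_compose[OF cl, of E] by (simp add: o_def)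
  have "((\<lambda>s. e0 + s *\<^sub>R C) has_vector_derivative C) (at 0)" by (auto intro!: derivative_eq_intros)
  moreover have "\<forall>\<^sub>F s in at 0. e0 + s *\<^sub>R C \<in> W"
    using cl open_W e0_W unfolding continuous_at by (auto intro!: topological_tendstoD)
  ultimately have "((\<lambda>s. phi (E (e0 + s *\<^sub>R C))) has_vector_derivative C) (at 0)"
    by (rule has_vector_derivative_transform_eventually[OF _ eventually_mono]) (auto simp: e0_def)
  then show ?thesis using cE by (simp add: vel1_iff)
qed

lemma vel1_unique:
  assumes "vel1 k C 0 UNIV" "vel1 k B 0 UNIV" shows "C = B"
  using assms vector_derivative_unique_at by (auto simp: vel1_iff)

lemma vel1_const: "t \<in> I \<Longrightarrow> vel1 (\<lambda>s. \<one>) 0 t I"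
  by (simp add: vel1_iff)

text \<open>The differential of multiplication at the pair of identities restricts to the identity
  map on each factor, hence it is addition.\<close>

lemma vel1_mult:
  assumes "vel1 k C t I" "vel1 l B t I" shows "vel1 (\<lambda>s. k s \<otimes> l s) (C + B) t I"
proof -
  let ?m = "\<lambda>p. phi (E (fst p) \<otimes> E (snd p))"
  have sm: "smooth_into G (W \<times> W) (\<lambda>p. E (fst p) \<otimes> E (snd p))"
    by (intro smooth_into_mult smooth_into_E_compose smooth_on_fst smooth_on_snd smooth_on_id) auto
  obtain D where D: "(?m has_derivative D) (at (e0, e0))"
    using smooth_into_phi_derivative[OF sm, of "(e0, e0)"] open_W by (auto intro: open_Times)
  have *: "\<forall>\<^sub>F x in at e0. x \<in> W" using open_W by (simp add: eventually_at_in_open')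
  have D1: "D (X, 0) = X" for X
  proof -
    have "((\<lambda>x. (x, e0)) has_derivative (\<lambda>x. (x, 0))) (at e0)" by (auto intro!: derivative_eq_intros)
    from diff_chain_at[OF this D]
    have "((\<lambda>x. phi (E x)) has_derivative (\<lambda>x. D (x, 0))) (at e0)" by (simp add: o_def)
    then have "((\<lambda>x. x) has_derivative (\<lambda>x. D (x, 0))) (at e0)"
      by (rule has_derivative_transform_eventually) (use * in \<open>auto elim: eventually_mono simp: e0_def\<close>)
    then show ?thesis using has_derivative_unique[OF has_derivative_ident] by metis
  qed
  have D2: "D (0, X) = X" for X
  proof -
    have "((\<lambda>x. (e0, x)) has_derivative (\<lambda>x. (0, x))) (at e0)" by (auto intro!: derivative_eq_intros)
    from diff_chain_at[OF this D]
    have "((\<lambda>x. phi (E x)) has_derivative (\<lambda>x. D (0, x))) (at e0)" by (simp add: o_def)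
    then have "((\<lambda>x. x) has_derivative (\<lambda>x. D (0, x))) (at e0)"
      by (rule has_derivative_transform_eventually) (use * in \<open>auto elim: eventually_mono simp: e0_def\<close>)
    then show ?thesis using has_derivative_unique[OF has_derivative_ident] by metis
  qed
  have "D (C, B) = D (C, 0) + D (0, B)" using linear_add[OF has_derivative_linear[OF D], of "(C, 0)" "(0, B)"] by simp
  then have "D (C, B) = C + B" using D1 D2 by simp
  then have "((\<lambda>s. phi (k s \<otimes> l s)) has_vector_derivative C + B) (at t within I)"
    using vel1_chain2[OF assms, of "\<lambda>x y. phi (x \<otimes> y)" D] D by simp
  then show ?thesis using assms by (auto simp: vel1_iff intro: continuous_group_mult)
qed

text \<open>The differential of inversion is determined by differentiating the constant product of a
  chart line with its inverse. The line lives on a full neighbourhood of 0, where velocities are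
  unique; the given curve may be one-sided.\<close>

lemma vel1_inv:
  assumes "vel1 k C t I" shows "vel1 (\<lambda>s. inv (k s)) (- C) t I"
proof -
  have sm: "smooth_into G W (\<lambda>x. inv (E x))" by (intro smooth_into_inv smooth_into_E)
  obtain D where D: "((\<lambda>x. phi (inv (E x))) has_derivative D) (at e0)"
    using smooth_into_phi_derivative[OF sm open_W e0_W] by auto
  have v: "vel1 (\<lambda>s. inv (k s)) (D C) t I" if "vel1 k C t I" for k C t I
    by (rule vel1_compose_phi[OF that _ _ D]) (auto intro!: isCont_of_continuous_on_UNIV continuous_inv)
  have "C + D C = 0"
  proof -
    let ?k = "\<lambda>s. E (e0 + s *\<^sub>R C)"
    have "vel1 (\<lambda>s. ?k s \<otimes> inv (?k s)) (C + D C) 0 UNIV"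
      by (intro vel1_mult vel1_line v)
    then have "vel1 (\<lambda>s. \<one>) (C + D C) 0 UNIV" by simp
    then show ?thesis using vel1_unique[OF vel1_const[OF UNIV_I]] by metis
  qed
  then have "D C = - C" by (simp add: add_eq_0_iff)
  then show ?thesis using v[OF assms] by simp
qed

text \<open>The adjoint action as a Frechet derivative of conjugation. It makes sense before the
  exponential map exists and is linear by construction; agreement with \<open>Ad\<close> follows
  once one-parameter subgroups are available.\<close>

definition Adj :: "'g \<Rightarrow> 'e \<Rightarrow> 'e" where
  "Adj h = frechet_derivative (\<lambda>x. phi (h \<otimes> E x \<otimes> inv h)) (at e0)"

lemma Adj_has_derivative: "((\<lambda>x. phi (h \<otimes> E x \<otimes> inv h)) has_derivative Adj h) (at e0)"
  unfolding Adj_def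
  by (rule smooth_into_phi_derivative[OF _ open_W e0_W]) (auto intro!: smooth_into_mult smooth_into_const smooth_into_E)

lemma Adj_bounded_linear: "bounded_linear (Adj h)"
  using Adj_has_derivative by (rule has_derivative_bounded_linear)

lemma vel1_conj:
  assumes "vel1 k C t I" shows "vel1 (\<lambda>s. h \<otimes> k s \<otimes> inv h) (Adj h C) t I"
  by (rule vel1_compose_phi[OF assms _ _ Adj_has_derivative])
    (auto intro!: isCont_of_continuous_on_UNIV continuous_intros continuous_on_id)

lemma Adj_one: "Adj \<one> C = C"
  using vel1_conj[OF vel1_line[of C], of \<one>] vel1_line[of C] vel1_unique by fastforce

lemma Adj_mult: "Adj (h \<otimes> k) C = Adj h (Adj k C)"
proof -
  have "h \<otimes> k \<otimes> x \<otimes> inv (h \<otimes> k) = h \<otimes> (k \<otimes> x \<otimes> inv k) \<otimes> inv h" for x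
    by (simp add: inv_mult_group m_assoc)
  then show ?thesis
    using vel1_conj[OF vel1_line[of C], of "h \<otimes> k"] vel1_conj[OF vel1_conj[OF vel1_line[of C], of k], of h] vel1_unique
    by fastforce
qed

end

context lie_group
begin

section \<open>Curves with the same logarithmic derivative\<close>

text \<open>C is the left logarithmic derivative \<open>c(t)^-1 c'(t)\<close>, whereas
  \<open>right_log_solution\<close> prescribes the right one.\<close>

definition lvel :: "(real \<Rightarrow> 'g) \<Rightarrow> 'e \<Rightarrow> real \<Rightarrow> real set \<Rightarrow> bool" where
  "lvel c C t I \<longleftrightarrow> vel1 (\<lambda>s. inv (c t) \<otimes> c s) C t I"

lemma vel1_subset: "vel1 k C t I \<Longrightarrow> t \<in> J \<Longrightarrow> J \<subseteq> I \<Longrightarrow> vel1 k C t J"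
  by (auto simp: vel1_iff intro: has_vector_derivative_within_subset continuous_within_subset)

lemma vel1_comp_affine:
  assumes "vel1 k C (a + b * t) UNIV" shows "vel1 (\<lambda>s. k (a + b * s)) (b *\<^sub>R C) t UNIV"
proof -
  have *: "((\<lambda>s. a + b * s) has_vector_derivative b) (at t)"
    by (auto intro!: derivative_eq_intros simp: has_real_derivative_iff_has_vector_derivative[symmetric])
  have "continuous (at t) (\<lambda>s. a + b * s)" by (intro continuous_intros)
  then have "continuous (at t) (\<lambda>s. k (a + b * s))"
    using assms continuous_at_compose[of t "\<lambda>s. a + b * s" k] by (simp add: vel1_iff o_def)
  then show ?thesis using assms vector_diff_chain_at[OF *] by (auto simp: vel1_iff o_def)
qed

lemma smooth_into_chart_derivative:
  assumes "smooth_into G D f" "open D" "x \<in> D" "(U, \<rho>) \<in> charts G" "f x \<in> U"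
  shows "((\<lambda>x. \<rho> (f x)) has_derivative frechet_derivative (\<lambda>x. \<rho> (f x)) (at x)) (at x)"
proof -
  obtain N where "open N" "x \<in> N" "smooth_on (D \<inter> N) (\<lambda>x. \<rho> (f x))"
    using smooth_into_chart_nbhd[OF assms(1,3,4,5)] by metis
  then show ?thesis using assms(2,3) by (intro smooth_on_derivative[of "D \<inter> N"]) auto
qed

text \<open>Writing \<open>k s\<close> as \<open>k t\<close> times a curve through the identity
  expresses the velocity in an arbitrary chart as a linear image of C.\<close>

lemma lvel_chart:
  assumes "lvel k C t I" "(U, \<rho>) \<in> charts G" "k t \<in> U"
  obtains D where "((\<lambda>x. \<rho> (k t \<otimes> E x)) has_derivative D) (at e0)"
    "((\<lambda>s. \<rho> (k s)) has_vector_derivative D C) (at t within I)"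
proof -
  have "((\<lambda>x. \<rho> (k t \<otimes> E x)) has_derivative frechet_derivative (\<lambda>x. \<rho> (k t \<otimes> E x)) (at e0)) (at e0)"
    by (rule smooth_into_chart_derivative[OF _ open_W e0_W assms(2)])
      (use assms(3) in \<open>auto intro!: smooth_into_mult smooth_into_const smooth_into_E\<close>)
  moreover from this have "((\<lambda>s. \<rho> (k t \<otimes> (inv (k t) \<otimes> k s))) has_vector_derivative
      frechet_derivative (\<lambda>x. \<rho> (k t \<otimes> E x)) (at e0) C) (at t within I)"
    using vel1_chain[OF assms(1)[unfolded lvel_def], of "\<lambda>h. \<rho> (k t \<otimes> h)"] by blast
  ultimately show thesis using that by (simp add: m_assoc[symmetric])
qed

lemma lvel_continuous:
  assumes "lvel k C t I" shows "continuous (at t within I) k"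
proof -
  have "continuous (at t within I) (\<lambda>s. k t \<otimes> (inv (k t) \<otimes> k s))"
    by (rule continuous_group_mult[OF continuous_const]) (use assms in \<open>simp add: lvel_def vel1_iff\<close>)
  then show ?thesis by (simp add: m_assoc[symmetric])
qed

text \<open>In a chart the derivative vanishes, so the curve is locally constant; connectedness of I
  makes it constant.\<close>

lemma lvel_zero_const:
  assumes I: "convex I" and v: "\<And>t. t \<in> I \<Longrightarrow> lvel k 0 t I" and st: "s \<in> I" "t \<in> I"
  shows "k s = k t"
proof -
  have "k constant_on I"
  proof (rule locally_constant_imp_constant)
    show "connected I" using I by (rule convex_connected)
    fix t assume t: "t \<in> I"
    obtain U \<rho> where U: "(U, \<rho>) \<in> charts G" "k t \<in> U" by (rule chartE)
    have "continuous_on I k" using lvel_continuous[OF v] by (simp add: continuous_on_eq_continuous_within)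
    then obtain N where N: "open N" "t \<in> N" "\<forall>s\<in>I. s \<in> N \<longrightarrow> k s \<in> U"
      using chart_open(1)[OF U(1)] U(2) t unfolding continuous_on_topological by meson
    then obtain r where r: "r > 0" "ball t r \<subseteq> N" using open_contains_ball by blast
    define J where "J = I \<inter> ball t r"
    have J: "convex J" using I by (simp add: J_def convex_Int)
    have "((\<lambda>s. \<rho> (k s)) has_vector_derivative 0) (at s within J)" if s: "s \<in> J" for s
    proof -
      have sI: "s \<in> I" "k s \<in> U" using s N r by (auto simp: J_def)
      obtain D where D: "((\<lambda>x. \<rho> (k s \<otimes> E x)) has_derivative D) (at e0)"
          "((\<lambda>s. \<rho> (k s)) has_vector_derivative D 0) (at s within I)"
        using lvel_chart[OF v[OF sI(1)] U(1) sI(2)] by blast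
      then have "((\<lambda>s. \<rho> (k s)) has_vector_derivative 0) (at s within I)"
        using linear_0[OF has_derivative_linear[OF D(1)]] by simp
      then show ?thesis by (rule has_vector_derivative_within_subset) (auto simp: J_def)
    qed
    then obtain c where c: "\<And>s. s \<in> J \<Longrightarrow> \<rho> (k s) = c"
      using has_vector_derivative_zero_constant[OF J] by metis
    have "k s = k t" if s: "s \<in> J" for s
    proof -
      have "t \<in> J" using t r by (simp add: J_def)
      then have "\<rho> (k s) = \<rho> (k t)" using c s by simp
      moreover have "k s \<in> U" using s N r by (auto simp: J_def)
      ultimately show ?thesis using chart_inv_into[OF U(1)] U(2) by metis
    qed
    moreover have "openin (top_of_set I) J" by (auto simp: J_def openin_open)
    moreover have "t \<in> J" using t r by (simp add: J_def)
    ultimately show "\<exists>T. openin (top_of_set I) T \<and> t \<in> T \<and> (\<forall>x\<in>T. k x = k t)" by blast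
  qed
  then show ?thesis using st by (auto simp: constant_on_def)
qed

text \<open>The quotient \<open>a b^-1\<close> has left logarithmic derivative
  \<open>Ad(b)(C - C) = 0\<close>.\<close>

lemma lvel_unique:
  assumes I: "convex I" and a: "\<And>t. t \<in> I \<Longrightarrow> lvel a (C t) t I" and b: "\<And>t. t \<in> I \<Longrightarrow> lvel b (C t) t I"
    and t0: "t0 \<in> I" "a t0 = b t0" and t: "t \<in> I"
  shows "a t = b t"
proof -
  define k where "k s = a s \<otimes> inv (b s)" for s
  have "lvel k 0 s I" if s: "s \<in> I" for s
  proof -
    have "vel1 (\<lambda>u. b s \<otimes> ((inv (a s) \<otimes> a u) \<otimes> inv (inv (b s) \<otimes> b u)) \<otimes> inv (b s)) (Adj (b s) (C s + - C s)) s I"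
      using a[OF s] b[OF s] unfolding lvel_def by (intro vel1_conj vel1_mult vel1_inv)
    moreover have "b s \<otimes> ((inv (a s) \<otimes> a u) \<otimes> inv (inv (b s) \<otimes> b u)) \<otimes> inv (b s) = inv (k s) \<otimes> k u" for u
      by (simp add: k_def inv_mult_group m_assoc)
    moreover have "Adj (b s) 0 = 0" using Adj_bounded_linear bounded_linear.linear linear_0 by blast
    ultimately show ?thesis by (simp add: lvel_def)
  qed
  then have "k t = k t0" using lvel_zero_const[OF I] t t0 by blast
  also have "\<dots> = \<one>" using t0 by (simp add: k_def)
  finally have "a t \<otimes> inv (b t) = \<one>" by (simp add: k_def)
  then show ?thesis by (metis in_carrier inv_closed inv_equality inv_inv)
qed

section \<open>The exponential map\<close>

text \<open>The curve is the integral curve through the identity of the left-invariant vector field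
  of C. Its homomorphism property is uniqueness of a curve with given left logarithmic derivative
  and initial value.\<close>

lemma local_one_parameter_group:
  obtains d c where "d > 0" "smooth_into G {-d<..<d} c" "c 0 = \<one>" "vel1 c C 0 UNIV"
    "\<And>s t. \<bar>s\<bar> < d \<Longrightarrow> \<bar>t\<bar> < d \<Longrightarrow> c (s + t) = c s \<otimes> c t"
proof -
  let ?f = "\<lambda>p. phi (E (fst p) \<otimes> E (snd p))"
  define N where "N = (W \<times> W) \<inter> (\<lambda>p. E (fst p) \<otimes> E (snd p)) -` dom1"
  have sm: "smooth_into G (W \<times> W) (\<lambda>p. E (fst p) \<otimes> E (snd p))"
    by (intro smooth_into_mult smooth_into_E_compose smooth_on_fst smooth_on_snd smooth_on_id) auto
  have oN: "open N" unfolding N_def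
    using smooth_into_continuous[OF sm] open_W open_dom1 by (intro continuous_open_preimage open_Times)
  have smN: "smooth_on N ?f"
    by (rule smooth_into_chart[OF smooth_into_subset[OF sm] chart1]) (auto simp: N_def)
  have inN: "(x, e0) \<in> N" if "x \<in> W" for x using that by (simp add: N_def)
  \<comment> \<open>\<open>P x\<close> is the differential at the identity of left translation by
    \<open>E x\<close>, in the chart; \<open>P x C\<close> is the left-invariant vector
    field.\<close>
  define P where "P x = frechet_derivative (\<lambda>z. phi (E x \<otimes> E z)) (at e0)" for x
  have P: "((\<lambda>z. phi (E x \<otimes> E z)) has_derivative P x) (at e0)" if "x \<in> W" for x
    using frechet_derivative_at[OF partial_derivative_at[OF oN smN inN[OF that]]]
      partial_derivative_at[OF oN smN inN[OF that]] by (simp add: P_def)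
  have "smooth_on W (\<lambda>x. P x C)"
    using smooth_on_partial_derivative[OF fin_dim_model fin_dim_model oN smN inN, of W C] by (simp add: P_def)
  from local_flow[OF fin_dim_model open_W e0_W this] obtain d y where d: "d > 0" "y 0 = e0"
    "\<And>t. \<bar>t\<bar> < d \<Longrightarrow> y t \<in> W" "\<And>t. \<bar>t\<bar> < d \<Longrightarrow> (y has_vector_derivative P (y t) C) (at t)" by blast
  define c where "c t = E (y t)" for t
  have "smooth_on {-d<..<d} y"
    by (rule integral_curve_smooth[OF fin_dim_model open_W \<open>smooth_on W (\<lambda>x. P x C)\<close>]) (use d in auto)
  then have smc: "smooth_into G {-d<..<d} c"
    unfolding c_def by (rule smooth_into_E_compose) (use d(3) in auto)
  have cc: "isCont c t" if "\<bar>t\<bar> < d" for t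
    using smooth_into_continuous[OF smc] that by (simp add: continuous_on_eq_continuous_at abs_less_iff)
  have lv: "lvel c C t UNIV" if t: "\<bar>t\<bar> < d" for t
  proof -
    let ?x = "y t"
    have x: "?x \<in> W" using d(3) t .
    let ?g = "\<lambda>x. phi (inv (E ?x) \<otimes> E x)"
    have "smooth_into G W (\<lambda>x. inv (E ?x) \<otimes> E x)"
      by (intro smooth_into_mult smooth_into_const smooth_into_E)
    from smooth_into_phi_derivative[OF this open_W x] obtain Q where Q: "(?g has_derivative Q) (at ?x)" by auto
    \<comment> \<open>Q differentiates the translation by the inverse, so composing it with P gives
      the derivative of the identity map.\<close>
    have "Q (P ?x C) = C"
    proof -
      have px: "phi (E ?x \<otimes> E e0) = ?x" using x by simp
      then have "(?g has_derivative Q) (at (phi (E ?x \<otimes> E e0)))" using Q by simp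
      from diff_chain_at[OF P[OF x] this]
      have "((\<lambda>z. phi (inv (E ?x) \<otimes> E (phi (E ?x \<otimes> E z)))) has_derivative (\<lambda>v. Q (P ?x v))) (at e0)"
        by (simp add: o_def)
      moreover have "\<forall>\<^sub>F z in at e0. phi (inv (E ?x) \<otimes> E (phi (E ?x \<otimes> E z))) = z"
      proof -
        have "isCont (\<lambda>z. E ?x \<otimes> E z) e0"
          using continuous_E open_W e0_W
          by (intro continuous_group_mult continuous_const) (simp add: continuous_on_eq_continuous_at)
        then have "\<forall>\<^sub>F z in at e0. E ?x \<otimes> E z \<in> dom1"
          using x open_dom1 unfolding isCont_def by (intro topological_tendstoD) auto
        moreover have "\<forall>\<^sub>F z in at e0. z \<in> W" using open_W by (simp add: eventually_at_in_open')
        ultimately show ?thesis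
          by eventually_elim (simp add: m_assoc[symmetric])
      qed
      ultimately have "((\<lambda>z. z) has_derivative (\<lambda>v. Q (P ?x v))) (at e0)"
        by (rule has_derivative_transform_eventually) (use px x in \<open>auto simp: e0_def\<close>)
      then show ?thesis using has_derivative_unique[OF has_derivative_ident] by metis
    qed
    moreover have "((\<lambda>s. phi (inv (c t) \<otimes> c s)) has_vector_derivative Q (P ?x C)) (at t)"
    proof -
      have "((\<lambda>s. ?g (y s)) has_derivative (\<lambda>h. Q (h *\<^sub>R P ?x C))) (at t)"
        using diff_chain_at[OF d(4)[OF t, unfolded has_vector_derivative_def] Q] by (simp add: o_def)
      then show ?thesis
        by (simp add: c_def has_vector_derivative_def linear_scale[OF has_derivative_linear[OF Q]])
    qed
    moreover have "isCont (\<lambda>s. inv (c t) \<otimes> c s) t"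
      by (intro continuous_group_mult continuous_const cc t)
    ultimately show ?thesis by (simp add: lvel_def vel1_iff)
  qed
  \<comment> \<open>As functions of t, both sides have left logarithmic derivative C and agree at 0.
    Halving the interval keeps \<open>s + t\<close> in the domain of the flow.\<close>
  have hom: "c (s + t) = c s \<otimes> c t" if st: "\<bar>s\<bar> < d / 2" "\<bar>t\<bar> < d / 2" for s t
  proof (rule lvel_unique[of "{-d/2<..<d/2}" "\<lambda>t. c (s + t)" "\<lambda>_. C" "\<lambda>t. c s \<otimes> c t" 0])
    fix t assume t: "t \<in> {-d/2<..<d/2}"
    have "lvel c C (s + 1 * t) UNIV" using lv[of "s + t"] t st by auto
    then have "vel1 (\<lambda>u. inv (c (s + 1 * t)) \<otimes> c (s + 1 * u)) (1 *\<^sub>R C) t UNIV"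
      unfolding lvel_def by (rule vel1_comp_affine)
    then have "lvel (\<lambda>t. c (s + t)) C t UNIV" by (simp add: lvel_def)
    then show "lvel (\<lambda>t. c (s + t)) C t {-d/2<..<d/2}" using t vel1_subset by (simp add: lvel_def)
    have "\<bar>t\<bar> < d" using t by auto
    then have "vel1 (\<lambda>u. inv (c t) \<otimes> c u) C t UNIV" using lv by (simp add: lvel_def)
    moreover have "inv (c s \<otimes> c t) \<otimes> (c s \<otimes> c u) = inv (c t) \<otimes> c u" for u
      by (metis (no_types, lifting) in_carrier inv_closed inv_mult_group m_assoc m_closed l_inv r_one l_one)
    ultimately show "lvel (\<lambda>t. c s \<otimes> c t) C t {-d/2<..<d/2}" using t vel1_subset by (simp add: lvel_def)
  qed (use st d in \<open>auto simp: c_def\<close>)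
  have c0: "c 0 = \<one>" using d(2) by (simp add: c_def)
  moreover have "vel1 c C 0 UNIV" using lv[of 0] d(1) c0 by (simp add: lvel_def)
  moreover have "smooth_into G {-(d/2)<..<d/2} c" by (rule smooth_into_subset[OF smc]) (use d(1) in auto)
  ultimately show thesis using that[of "d / 2" c] d(1) hom by simp
qed

text \<open>The local group is extended by \<open>c (t / n)^n\<close> with n so large that
  \<open>t / n\<close> lies in the small interval.\<close>

lemma one_parameter_subgroup_exists: "\<exists>c. one_parameter_subgroup G C c"
proof -
  obtain d c where d: "d > 0" and sm: "smooth_into G {-d<..<d} c" and c0: "c 0 = \<one>" and v: "vel1 c C 0 UNIV"
    and hom: "\<And>s t. \<bar>s\<bar> < d \<Longrightarrow> \<bar>t\<bar> < d \<Longrightarrow> c (s + t) = c s \<otimes> c t"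
    using local_one_parameter_group by metis
  have pow: "c (real m * x) = c x [^] m" if "real m * \<bar>x\<bar> < d" for m x
    using that
  proof (induction m)
    case (Suc m)
    have "real m * \<bar>x\<bar> < d" "\<bar>x\<bar> < d"
    proof -
      have "0 \<le> real m * \<bar>x\<bar>" by simp
      moreover have "real m * \<bar>x\<bar> + \<bar>x\<bar> < d" using Suc.prems by (simp add: algebra_simps)
      ultimately show "real m * \<bar>x\<bar> < d" "\<bar>x\<bar> < d" by linarith+
    qed
    then have "c (real m * x + x) = c (real m * x) \<otimes> c x" by (intro hom) (simp_all add: abs_mult)
    then show ?case using Suc.IH \<open>real m * \<bar>x\<bar> < d\<close> by (simp add: algebra_simps)
  qed (simp add: c0)
  \<comment> \<open>Two admissible exponents n and m are compared through the common refinement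
    \<open>t / (n m)\<close>.\<close>
  have indep: "c (t / n) [^] n = c (t / m) [^] m"
    if "(0::nat) < n" "(0::nat) < m" "\<bar>t\<bar> < d * real n" "\<bar>t\<bar> < d * real m" for n m :: nat and t
  proof -
    have *: "c (t / n) = c (t / (real n * real m)) [^] m" if "(0::nat) < n" "(0::nat) < m" "\<bar>t\<bar> < d * real n" for n m :: nat
    proof -
      have "real m * \<bar>t / (real n * real m)\<bar> = \<bar>t\<bar> / n" using that by (simp add: abs_mult)
      also have "\<dots> < d" using that by (simp add: pos_divide_less_eq)
      finally have "c (real m * (t / (real n * real m))) = c (t / (real n * real m)) [^] m" by (rule pow)
      then show ?thesis using that by simp
    qed
    show ?thesis using *[of n m] *[of m n] that by (simp add: nat_pow_pow mult.commute)
  qed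
  have ex: "\<exists>n::nat. (0::nat) < n \<and> a < d * real n" for a
  proof -
    obtain n :: nat where "a / d < n" using reals_Archimedean2 by blast
    then have "a < d * (Suc n)" using d by (simp add: pos_divide_less_eq mult.commute algebra_simps)
    then show ?thesis by (intro exI[of _ "Suc n"]) simp
  qed
  define N where "N t = (SOME n::nat. (0::nat) < n \<and> \<bar>t\<bar> < d * real n)" for t
  have N: "(0::nat) < N t" "\<bar>t\<bar> < d * real (N t)" for t using someI_ex[OF ex[of "\<bar>t\<bar>"]] by (auto simp: N_def)
  define e where "e t = c (t / N t) [^] N t" for t
  have e: "e t = c (t / n) [^] n" if "(0::nat) < n" "\<bar>t\<bar> < d * real n" for n :: nat and t
    unfolding e_def by (rule indep) (use that N in auto)
  have ec: "e t = c t" if "\<bar>t\<bar> < d" for t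
    using e[of 1 t, OF zero_less_one] that by simp
  have add: "e (s + t) = e s \<otimes> e t" for s t
  proof -
    obtain n :: nat where n: "(0::nat) < n" "\<bar>s\<bar> + \<bar>t\<bar> < d * real n" using ex by metis
    have st: "\<bar>s\<bar> < d * n" "\<bar>t\<bar> < d * n" "\<bar>s + t\<bar> < d * n" using n by auto
    then have lt: "\<bar>s / n\<bar> < d" "\<bar>t / n\<bar> < d" using n(1) by (auto simp: abs_divide pos_divide_less_eq)
    have "e (s + t) = c (s / n + t / n) [^] n" unfolding e[OF n(1) st(3)] by (simp add: add_divide_distrib)
    also have "c (s / n + t / n) = c (s / n) \<otimes> c (t / n)" by (rule hom[OF lt])
    \<comment> \<open>Powers distribute because the two factors commute: both orders give the value
      of c at the sum.\<close>
    also have "(c (s / n) \<otimes> c (t / n)) [^] n = c (s / n) [^] n \<otimes> c (t / n) [^] n"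
      by (rule pow_mult_distrib) (use hom[OF lt] hom[OF lt(2,1)] in \<open>auto simp: add.commute\<close>)
    also have "\<dots> = e s \<otimes> e t" unfolding e[OF n(1) st(1)] e[OF n(1) st(2)] ..
    finally show ?thesis .
  qed
  \<comment> \<open>Around \<open>t0\<close> the extension is the left translate by
    \<open>e t0\<close> of the local group.\<close>
  have "smooth_into G UNIV e"
  proof (rule smooth_into_local)
    fix t0 :: real
    have "smooth_into G {t0-d<..<t0+d} (\<lambda>t. e t0 \<otimes> c (t - t0))"
    proof (intro smooth_into_mult smooth_into_const)
      have "smooth_on {t0-d<..<t0+d} (\<lambda>t. t - t0)"
        using smooth_on_add[OF smooth_on_id smooth_on_const[of _ "- t0"]] by simp
      then show "smooth_into G {t0-d<..<t0+d} (\<lambda>t. c (t - t0))"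
        by (rule smooth_into_compose[OF fin_dim_euclidean sm]) auto
    qed
    then have "smooth_into G {t0-d<..<t0+d} e"
    proof (rule smooth_into_cong)
      fix t assume "t \<in> {t0-d<..<t0+d}"
      then have "c (t - t0) = e (t - t0)" using ec by auto
      then show "e t0 \<otimes> c (t - t0) = e t" using add[of t0 "t - t0"] by simp
    qed
    then show "\<exists>M. open M \<and> t0 \<in> M \<and> smooth_into G (UNIV \<inter> M) e"
      using d by (intro exI[of _ "{t0-d<..<t0+d}"]) auto
  qed
  moreover have "has_velocity_one G e C 0 UNIV"
  proof -
    have "((\<lambda>s. phi (c s)) has_vector_derivative C) (at 0)" using v by (simp add: vel1_iff)
    then have "((\<lambda>s. phi (e s)) has_vector_derivative C) (at 0)"
      by (rule has_vector_derivative_transform_within_open[of _ _ _ "{-d<..<d}"]) (use d ec in auto)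
    then show ?thesis using ec[of 0] d c0 by (simp add: has_velocity_one_def phi_def)
  qed
  ultimately show ?thesis unfolding one_parameter_subgroup_def using add by blast
qed

lemma one_parameter_subgroup_vel1: "one_parameter_subgroup G C c \<Longrightarrow> vel1 c C 0 UNIV"
  using smooth_into_continuous[of UNIV c]
  by (auto simp: one_parameter_subgroup_def vel1_def continuous_on_eq_continuous_at)

lemma one_parameter_subgroup_lvel:
  assumes "one_parameter_subgroup G C c" shows "lvel c C t UNIV"
proof -
  have add: "c (s + t) = c s \<otimes> c t" for s t using assms by (simp add: one_parameter_subgroup_def)
  have "inv (c t) \<otimes> c s = c (- t + 1 * s)" for s
  proof -
    have "c t \<otimes> c (- t + s) = c s" using add[of t "- t + s"] by simp
    then show ?thesis by (metis in_carrier inv_solve_left mult_1)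
  qed
  moreover have "vel1 (\<lambda>s. c (- t + 1 * s)) (1 *\<^sub>R C) t UNIV"
    by (rule vel1_comp_affine) (use one_parameter_subgroup_vel1[OF assms] in simp)
  ultimately show ?thesis by (simp add: lvel_def)
qed

lemma one_parameter_subgroup_unique:
  assumes "one_parameter_subgroup G C c" "one_parameter_subgroup G C c'" shows "c = c'"
proof
  fix t
  have c0: "c 0 = c' 0" using assms by (simp add: one_parameter_subgroup_def has_velocity_one_def)
  show "c t = c' t"
    by (rule lvel_unique[of UNIV c "\<lambda>_. C" c' 0]) (use c0 assms one_parameter_subgroup_lvel in auto)
qed

definition expc :: "'e \<Rightarrow> real \<Rightarrow> 'g" where
  "expc C = (THE c. one_parameter_subgroup G C c)"

lemma one_parameter_subgroup_expc: "one_parameter_subgroup G C (expc C)"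
proof -
  have "\<exists>!c. one_parameter_subgroup G C c"
    using one_parameter_subgroup_exists one_parameter_subgroup_unique by blast
  then show ?thesis unfolding expc_def by (rule theI')
qed

lemma smooth_into_expc: "smooth_into G S (expc C)"
  using one_parameter_subgroup_expc smooth_into_subset by (metis one_parameter_subgroup_def subset_UNIV)

lemma expc_add: "expc C (s + t) = expc C s \<otimes> expc C t"
  using one_parameter_subgroup_expc by (simp add: one_parameter_subgroup_def)

lemma expc_vel1: "vel1 (expc C) C 0 UNIV"
  by (rule one_parameter_subgroup_vel1[OF one_parameter_subgroup_expc])

lemma expc_0 [simp]: "expc C 0 = \<one>"
  using expc_vel1 by (simp add: vel1_iff)

text \<open>Rescaling time in the one-parameter subgroup of C gives that of \<open>u C\<close>.
  \<open>Ad\<close> and \<open>fund_field\<close> see \<open>lie_exp\<close> only along such rays,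
  so they become derivatives along \<open>expc C\<close>.\<close>

lemma lie_exp_scaleR: "lie_exp G (u *\<^sub>R C) = expc C u"
proof -
  have "one_parameter_subgroup G (u *\<^sub>R C) (\<lambda>t. expc C (u * t))"
    unfolding one_parameter_subgroup_def
  proof (intro conjI allI)
    show "smooth_into G UNIV (\<lambda>t. expc C (u * t))"
      by (rule smooth_into_compose[OF fin_dim_euclidean smooth_into_expc[of UNIV]
            smooth_on_bounded_linear[OF bounded_linear_mult_right]]) simp
    show "expc C (u * (s + t)) = expc C (u * s) \<otimes> expc C (u * t)" for s t
      by (simp add: distrib_left expc_add)
    show "has_velocity_one G (\<lambda>t. expc C (u * t)) (u *\<^sub>R C) 0 UNIV"
      using vel1_comp_affine[of "expc C" C 0 u 0] expc_vel1 by (simp add: vel1_def)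
  qed
  then have "expc (u *\<^sub>R C) = (\<lambda>t. expc C (u * t))"
    using one_parameter_subgroup_unique[OF one_parameter_subgroup_expc] by blast
  then show ?thesis by (simp add: lie_exp_def expc_def[symmetric])
qed

section \<open>The adjoint and coadjoint actions\<close>

lemma Ad_eq_Adj: "Ad G h C = Adj h C"
proof -
  have "vel1 (\<lambda>u. h \<otimes> lie_exp G (u *\<^sub>R C) \<otimes> inv h) (Adj h C) 0 UNIV"
    unfolding lie_exp_scaleR by (rule vel1_conj[OF expc_vel1])
  then show ?thesis
    unfolding Ad_def by (intro vector_derivative_at) (auto simp: vel1_iff phi_def)
qed

text \<open>\<open>Blinfun\<close> is meaningful on bounded linear maps; boundedness of the adjoint
  map is what opens up the definition of \<open>coadj\<close>.\<close>

lemma coadj_apply: "blinfun_apply (coadj G h \<nu>) C = \<nu> (Adj (inv h) C)"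
  unfolding coadj_def Ad_eq_Adj
  by (simp add: bounded_linear_Blinfun_apply bounded_linear_compose[OF blinfun.bounded_linear_right Adj_bounded_linear])

lemma coadj_mult: "coadj G (h \<otimes> k) \<nu> = coadj G h (coadj G k \<nu>)"
  by (rule blinfun_eqI) (simp add: coadj_apply inv_mult_group Adj_mult)

lemma coadj_one [simp]: "coadj G \<one> \<nu> = \<nu>"
  by (rule blinfun_eqI) (simp add: coadj_apply Adj_one)

lemma coadj_inv_cancel: "coadj G (inv h) (coadj G h \<nu>) = \<nu>"
  by (simp add: coadj_mult[symmetric])

text \<open>Conjugation by \<open>k x\<close> is jointly smooth in x and the conjugated element; the
  adjoint action is its partial derivative at the identity.\<close>

lemma smooth_on_Adj:
  fixes k :: "'a::real_normed_vector \<Rightarrow> 'g"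
  assumes fd: "fin_dim TYPE('a)" and "open D" and k: "smooth_into G D k"
  shows "smooth_on D (\<lambda>x. Adj (k x) B)"
proof -
  let ?f = "\<lambda>p. k (fst p) \<otimes> E (snd p) \<otimes> inv (k (fst p))"
  have k1: "smooth_into G (D \<times> W) (\<lambda>p. k (fst p))"
    by (rule smooth_into_compose[OF fd k smooth_on_fst[OF smooth_on_id]]) auto
  have sm: "smooth_into G (D \<times> W) ?f"
    by (intro smooth_into_mult smooth_into_inv k1 smooth_into_E_compose smooth_on_snd smooth_on_id) auto
  define N where "N = (D \<times> W) \<inter> ?f -` dom1"
  have oN: "open N" unfolding N_def
    using smooth_into_continuous[OF sm] open_W open_dom1 assms(2) by (intro continuous_open_preimage open_Times)
  have smN: "smooth_on N (\<lambda>p. phi (?f p))"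
    by (rule smooth_into_chart[OF smooth_into_subset[OF sm] chart1]) (auto simp: N_def)
  have "smooth_on D (\<lambda>x. frechet_derivative (\<lambda>z. phi (?f (x, z))) (at e0) B)"
    by (rule smooth_on_partial_derivative[OF fd fin_dim_model oN smN]) (auto simp: N_def)
  then show ?thesis by (simp add: Adj_def)
qed

lemma continuous_Adj: "continuous_on UNIV (\<lambda>h. Adj h B)"
  unfolding continuous_on_eq_continuous_within
proof
  fix h :: 'g
  obtain U \<rho> where U: "(U, \<rho>) \<in> charts G" "h \<in> U" by (rule chartE)
  have "smooth_on (\<rho> ` U) (\<lambda>x. Adj (inv_into U \<rho> x) B)"
    by (rule smooth_on_Adj[OF fin_dim_model chart_open(2)[OF U(1)] smooth_into_chart_inv[OF U(1)]])
  then have "continuous_on U (\<lambda>h. Adj (inv_into U \<rho> (\<rho> h)) B)"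
    by (intro continuous_on_compose2[OF smooth_on_continuous chart_continuous(1)[OF U(1)]]) auto
  then have "continuous_on U (\<lambda>h. Adj h B)"
    by (rule continuous_on_cong[THEN iffD1, rotated -1]) (use U in auto)
  then show "isCont (\<lambda>h. Adj h B) h" using U chart_open(1) continuous_on_eq_continuous_at by blast
qed

text \<open>\<open>ad C B\<close> is the Lie bracket of \<open>C\<close> and \<open>B\<close>.\<close>

definition ad :: "'e \<Rightarrow> 'e \<Rightarrow> 'e" where
  "ad C B = frechet_derivative (\<lambda>x. Adj (E x) B) (at e0) C"

lemma ad_has_derivative: "((\<lambda>x. Adj (E x) B) has_derivative (\<lambda>C. ad C B)) (at e0)"
  using smooth_on_derivative[OF open_W smooth_on_Adj[OF fin_dim_model open_W smooth_into_E] e0_W]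
  by (simp add: ad_def[abs_def])

lemma ad_linear: "linear (\<lambda>C. ad C B)"
  by (rule has_derivative_linear[OF ad_has_derivative])

lemma vel1_Adj:
  assumes "vel1 k C t I" shows "((\<lambda>u. Adj (k u) B) has_vector_derivative ad C B) (at t within I)"
  by (rule vel1_chain[OF assms ad_has_derivative])

lemma coadj_vel1:
  assumes "vel1 k C t I"
  shows "((\<lambda>u. coadj G (k u) \<nu> B) has_vector_derivative - \<nu> (ad C B)) (at t within I)"
  using bounded_linear.has_vector_derivative[OF blinfun.bounded_linear_right vel1_Adj[OF vel1_inv[OF assms]]]
  by (simp add: coadj_apply linear_neg[OF ad_linear] blinfun.minus_right)

text \<open>The derivative of the coadjoint action depends on the velocity of the curve alone, so
  \<open>exp(uC)\<close> may be replaced by any curve with velocity C. The second formula reads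
  \<open>X_C(\<nu>)(B) = - \<nu>([C, B])\<close>.\<close>

lemma coadj_vel1_fund_field:
  assumes "vel1 k C 0 UNIV"
  shows "((\<lambda>u. coadj G (k u) \<nu>) has_vector_derivative fund_field G C \<nu>) (at 0)"
    and "fund_field G C \<nu> B = - \<nu> (ad C B)"
proof -
  have *: "\<exists>D. ((\<lambda>u. coadj G (k u) \<nu>) has_vector_derivative D) (at 0) \<and> (\<forall>B. D B = - \<nu> (ad C B))"
    if "vel1 k C 0 UNIV" for k
    by (rule blinfun_has_vector_derivative_pointwise[OF fin_dim_model coadj_vel1[OF that]])
  obtain D where D: "((\<lambda>u. coadj G (expc C u) \<nu>) has_vector_derivative D) (at 0)" "\<And>B. D B = - \<nu> (ad C B)"
    using *[OF expc_vel1] by blast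
  have fD: "fund_field G C \<nu> = D"
    unfolding fund_field_def lie_exp_scaleR by (rule vector_derivative_at[OF D(1)])
  then show "fund_field G C \<nu> B = - \<nu> (ad C B)" using D by simp
  obtain D' where "((\<lambda>u. coadj G (k u) \<nu>) has_vector_derivative D') (at 0)" "\<And>B. D' B = - \<nu> (ad C B)"
    using *[OF assms] by blast
  moreover from this have "D' = D" by (intro blinfun_eqI) (simp add: D(2))
  ultimately show "((\<lambda>u. coadj G (k u) \<nu>) has_vector_derivative fund_field G C \<nu>) (at 0)" using fD by simp
qed

lemmas fund_field_apply = coadj_vel1_fund_field(2)[OF expc_vel1]

end

context lie_group
begin

section \<open>The isotopy as the coadjoint action of the group curve\<close>

lemma right_log_solution_vel1:
  assumes "right_log_solution G A g" "t \<in> {0..1}"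
  shows "vel1 (\<lambda>s. g s \<otimes> inv (g t)) (A t) t {0..1}"
proof -
  have "continuous_on {0..1} g"
    using assms(1) by (intro smooth_into_continuous) (simp add: right_log_solution_def)
  then have "continuous (at t within {0..1}) (\<lambda>s. g s \<otimes> inv (g t))"
    using assms(2) by (intro continuous_group_mult continuous_const) (simp add: continuous_on_eq_continuous_within)
  then show ?thesis using assms by (simp add: right_log_solution_def vel1_def)
qed

text \<open>Instead of a uniqueness theorem on the orbit, the pairing of \<open>\<psi> t q\<close>
  with \<open>Ad(g_t) B\<close> is differentiated: the two terms of the product rule are opposite
  values of the bracket of \<open>A t\<close> and \<open>Ad(g_t) B\<close>. Hence the pairing keeps
  its initial value \<open>q B\<close>.\<close>

lemma isotopy_eq_coadj:
  assumes "closed_isotopy G \<eta> A \<psi>" "right_log_solution G A g" "q \<in> coadjoint_orbit G \<eta>" "t \<in> {0..1}"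
  shows "\<psi> t q = coadj G (g t) q"
proof -
  have \<psi>: "((\<lambda>s. \<psi> s q) has_vector_derivative fund_field G (A t) (\<psi> t q)) (at t within {0..1})"
    if "t \<in> {0..1}" for t
    using assms(1,3) that by (simp add: closed_isotopy_def)
  have "\<psi> 0 q = q" using assms(1,3) by (simp add: closed_isotopy_def)
  have "g 0 = \<one>" using assms(2) by (simp add: right_log_solution_def)
  have "\<psi> t q (Adj (g t) B) = q B" for B
  proof -
    have der: "((\<lambda>s. \<psi> s q (Adj (g s) B)) has_vector_derivative 0) (at t within {0..1})" if t: "t \<in> {0..1}" for t
    proof -
      let ?B = "Adj (g t) B"
      \<comment> \<open>Factoring out \<open>g t\<close> leaves a curve through the identity at time
        t, with velocity \<open>A t\<close>.\<close>
      have eq: "(\<lambda>s. Adj (g s) B) = (\<lambda>s. Adj (g s \<otimes> inv (g t)) ?B)"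
        by (simp add: Adj_mult[symmetric] m_assoc)
      have "((\<lambda>s. Adj (g s) B) has_vector_derivative ad (A t) ?B) (at t within {0..1})"
        unfolding eq by (rule vel1_Adj[OF right_log_solution_vel1[OF assms(2) t]])
      from bounded_bilinear.has_vector_derivative[OF bounded_bilinear_blinfun_apply \<psi>[OF t] this]
      show ?thesis by (simp add: fund_field_apply)
    qed
    obtain c where "\<And>s. s \<in> {0..1} \<Longrightarrow> \<psi> s q (Adj (g s) B) = c"
      using has_vector_derivative_zero_constant[OF convex_real_interval(5) der] by metis
    then have "\<psi> t q (Adj (g t) B) = \<psi> 0 q (Adj (g 0) B)" using assms(4) by simp
    then show ?thesis using \<open>g 0 = \<one>\<close> \<open>\<psi> 0 q = q\<close> by (simp add: Adj_one)
  qed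
  then have "coadj G (inv (g t)) (\<psi> t q) = q" by (intro blinfun_eqI) (simp add: coadj_apply)
  then show ?thesis by (metis coadj_inv_cancel in_carrier inv_inv)
qed

lemma closed_isotopy_fixes:
  assumes "closed_isotopy G \<eta> A \<psi>" "right_log_solution G A g"
  shows "coadj G (g 1) (coadj G h \<eta>) = coadj G h \<eta>"
proof -
  have "coadj G h \<eta> \<in> coadjoint_orbit G \<eta>" by (simp add: coadjoint_orbit_def)
  then show ?thesis
    using isotopy_eq_coadj[OF assms, of "coadj G h \<eta>" 1] assms(1) by (simp add: closed_isotopy_def)
qed

section \<open>Smooth functions on the group and their left derivatives\<close>

definition smooth_fun :: "('g \<Rightarrow> 'v::real_normed_vector) \<Rightarrow> bool" where
  "smooth_fun f \<longleftrightarrow> (\<forall>(U, \<rho>)\<in>charts G. smooth_on (\<rho> ` U) (\<lambda>x. f (inv_into U \<rho> x)))"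

lemma smooth_funD:
  assumes "smooth_fun f" "(U, \<rho>) \<in> charts G" shows "smooth_on (\<rho> ` U) (\<lambda>x. f (inv_into U \<rho> x))"
  using bspec[OF assms(1)[unfolded smooth_fun_def] assms(2)] by simp

lemma smooth_fun_compose:
  fixes f :: "'g \<Rightarrow> 'v::real_normed_vector" and k :: "'a::real_normed_vector \<Rightarrow> 'g"
  assumes f: "smooth_fun f" and k: "smooth_into G D k"
  shows "smooth_on D (\<lambda>x. f (k x))"
proof (rule smooth_on_local)
  fix x assume x: "x \<in> D"
  obtain U \<rho> where U: "(U, \<rho>) \<in> charts G" "k x \<in> U" by (rule chartE)
  obtain N where N: "open N" "x \<in> N" "k ` (D \<inter> N) \<subseteq> U" "smooth_on (D \<inter> N) (\<lambda>x. \<rho> (k x))"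
    using smooth_into_chart_nbhd[OF k x U] by metis
  have "smooth_on (D \<inter> N) (\<lambda>x. f (inv_into U \<rho> (\<rho> (k x))))"
    by (rule smooth_on_compose[OF fin_dim_model smooth_funD[OF f U(1)] N(4)]) (use N(3) in blast)
  then have "smooth_on (D \<inter> N) (\<lambda>x. f (k x))"
    by (rule smooth_on_cong) (use N(3) chart_inv_into[OF U(1)] in \<open>simp add: image_subset_iff\<close>)
  then show "\<exists>N. open N \<and> x \<in> N \<and> smooth_on (D \<inter> N) (\<lambda>x. f (k x))" using N by blast
qed

text \<open>The differential of f at h in the left trivialization: \<open>ld f h Z\<close> is the
  derivative of f along the left-invariant vector field of Z.\<close>

definition ld :: "('g \<Rightarrow> 'v::real_normed_vector) \<Rightarrow> 'g \<Rightarrow> 'e \<Rightarrow> 'v" where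
  "ld f h = frechet_derivative (\<lambda>x. f (h \<otimes> E x)) (at e0)"

lemma ld_has_derivative:
  assumes "smooth_fun f" shows "((\<lambda>x. f (h \<otimes> E x)) has_derivative ld f h) (at e0)"
  unfolding ld_def
  by (rule smooth_on_derivative[OF open_W smooth_fun_compose[OF assms] e0_W])
    (intro smooth_into_mult smooth_into_const smooth_into_E)

lemma ld_vel1:
  assumes "smooth_fun f" "vel1 k C t I"
  shows "((\<lambda>s. f (h \<otimes> k s)) has_vector_derivative ld f h C) (at t within I)"
  by (rule vel1_chain[OF assms(2) ld_has_derivative[OF assms(1)]])

lemma ld_linear: "smooth_fun f \<Longrightarrow> linear (ld f h)"
  by (rule has_derivative_linear[OF ld_has_derivative])

text \<open>At each time s the derivative of the orbit curve, tested on B, is the fundamental field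
  at \<nu> tested on a transported vector, hence zero. This supplies smooth curves inside the
  isotropy subgroup, on which the derivative of \<Lambda> can be evaluated.\<close>

lemma fund_field_zero_expc:
  assumes "fund_field G C \<nu> = 0" shows "coadj G (expc C u) \<nu> = \<nu>"
proof (rule blinfun_eqI)
  fix B
  have z: "\<nu> (ad C B) = 0" for B using fund_field_apply[of C \<nu> B] assms by simp
  have der: "((\<lambda>u. coadj G (expc C u) \<nu> B) has_vector_derivative 0) (at s within UNIV)" for s
  proof -
    have "coadj G (expc C u) \<nu> B = \<nu> (Adj (inv (inv (expc C s) \<otimes> expc C u)) (Adj (inv (expc C s)) B))" for u
      by (simp add: coadj_apply Adj_mult[symmetric] inv_mult_group m_assoc)
    moreover have "((\<lambda>u. \<nu> (Adj (inv (inv (expc C s) \<otimes> expc C u)) (Adj (inv (expc C s)) B)))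
        has_vector_derivative \<nu> (ad (- C) (Adj (inv (expc C s)) B))) (at s within UNIV)"
      by (intro bounded_linear.has_vector_derivative[OF blinfun.bounded_linear_right] vel1_Adj vel1_inv)
        (use one_parameter_subgroup_lvel[OF one_parameter_subgroup_expc] in \<open>simp add: lvel_def\<close>)
    ultimately show ?thesis by (simp add: linear_neg[OF ad_linear] blinfun.minus_right z)
  qed
  obtain c where c: "\<And>u. coadj G (expc C u) \<nu> B = c"
    using has_vector_derivative_zero_constant[OF convex_UNIV der] by (metis UNIV_I)
  show "coadj G (expc C u) \<nu> B = \<nu> B" using c[of u] c[of 0] by simp
qed

end

section \<open>The prequantum bundle\<close>

locale prequantum = lie_group G
  for G :: "('g::{t2_space,second_countable_topology}, 'e::banach) lie_struct" (structure) +
  fixes \<eta> :: "'e \<Rightarrow>\<^sub>L real" and \<Lambda> :: "'g \<Rightarrow> complex"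
  assumes character: "isotropy_character G \<eta> \<Lambda>"
begin

abbreviation H :: "'g set" where "H \<equiv> isotropy G \<eta>"
abbreviation cls :: "'g \<Rightarrow> complex \<Rightarrow> ('g \<times> complex) set" where "cls \<equiv> bundle_class G \<eta> \<Lambda>"

lemma H_iff: "b \<in> H \<longleftrightarrow> coadj G b \<eta> = \<eta>"
  by (simp add: isotropy_def)

lemma one_H [simp]: "\<one> \<in> H" by (simp add: H_iff)

lemma mult_H [simp]: "b \<in> H \<Longrightarrow> b' \<in> H \<Longrightarrow> b \<otimes> b' \<in> H" by (simp add: H_iff coadj_mult)

lemma inv_H [simp]: "b \<in> H \<Longrightarrow> inv b \<in> H" unfolding H_iff by (metis coadj_inv_cancel)

lemma coadj_eq_iff: "coadj G h \<eta> = coadj G k \<eta> \<longleftrightarrow> inv h \<otimes> k \<in> H"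
  unfolding H_iff coadj_mult by (metis coadj_inv_cancel in_carrier inv_inv)

lemma eta_Adj_H: "b \<in> H \<Longrightarrow> \<eta> (Adj b C) = \<eta> C"
  using inv_H[of b] coadj_apply[of "inv b" \<eta> C] by (simp add: H_iff)

lemma Lam_mult: "b \<in> H \<Longrightarrow> b' \<in> H \<Longrightarrow> \<Lambda> (b \<otimes> b') = \<Lambda> b * \<Lambda> b'"
  and Lam_norm: "b \<in> H \<Longrightarrow> norm (\<Lambda> b) = 1"
  and Lam_continuous: "continuous_on H \<Lambda>"
  using character by (auto simp: isotropy_character_def)

lemma Lam_derivative:
  assumes "open I" "0 \<in> I" "smooth_into G I c" "c ` I \<subseteq> H" "vel1 c C 0 UNIV"
  shows "((\<lambda>u. \<Lambda> (c u)) has_vector_derivative 2 * of_real pi * \<i> * of_real (\<eta> C)) (at 0)"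
proof -
  have "\<forall>I c C. open I \<and> 0 \<in> I \<and> smooth_into G I c \<and> c ` I \<subseteq> H \<and> has_velocity_one G c C 0 UNIV \<longrightarrow>
        ((\<lambda>u. \<Lambda> (c u)) has_vector_derivative 2 * of_real pi * \<i> * of_real (blinfun_apply \<eta> C)) (at 0)"
    using character unfolding isotropy_character_def by (elim conjE)
  from this[rule_format, of I c C] show ?thesis using assms by (simp add: vel1_def)
qed

lemma Lam_nonzero [simp]: "b \<in> H \<Longrightarrow> \<Lambda> b \<noteq> 0" using Lam_norm by fastforce

lemma Lam_one [simp]: "\<Lambda> \<one> = 1" using Lam_mult[of \<one> \<one>] Lam_nonzero[of \<one>] by simp

lemma Lam_inv: "b \<in> H \<Longrightarrow> \<Lambda> (inv b) = inverse (\<Lambda> b)"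
  using Lam_mult[of b "inv b"] by (simp add: field_simps)

text \<open>The element b that relates \<open>(h, z)\<close> to \<open>(k, w)\<close> can only be
  \<open>k^-1 h\<close>, so membership in a class becomes an explicit condition.\<close>

lemma mem_cls: "(k, w) \<in> cls h z \<longleftrightarrow> inv k \<otimes> h \<in> H \<and> w = \<Lambda> (inv k \<otimes> h) * z"
proof
  assume "(k, w) \<in> cls h z"
  then obtain b where b: "b \<in> H" "k = h \<otimes> inv b" "w = \<Lambda> b * z"
    by (auto simp: bundle_class_def prequantum_rel_def)
  then have "inv k \<otimes> h = b" by (simp add: inv_mult_group m_assoc)
  then show "inv k \<otimes> h \<in> H \<and> w = \<Lambda> (inv k \<otimes> h) * z" using b by simp
next
  assume *: "inv k \<otimes> h \<in> H \<and> w = \<Lambda> (inv k \<otimes> h) * z"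
  moreover have "k = h \<otimes> inv (inv k \<otimes> h)" by (simp add: inv_mult_group m_assoc[symmetric])
  ultimately show "(k, w) \<in> cls h z"
    unfolding bundle_class_def prequantum_rel_def by auto
qed

lemma cls_eq_iff [simp]: "cls h z = cls h w \<longleftrightarrow> z = w"
  using mem_cls[of h z h z] mem_cls[of h z h w] by auto

lemma cls_mult:
  assumes "b \<in> H" shows "cls (h \<otimes> b) z = cls h (\<Lambda> b * z)"
proof -
  have "(k, w) \<in> cls (h \<otimes> b) z \<longleftrightarrow> (k, w) \<in> cls h (\<Lambda> b * z)" for k w
  proof -
    have e: "inv k \<otimes> (h \<otimes> b) = (inv k \<otimes> h) \<otimes> b" by (simp add: m_assoc)
    have "(inv k \<otimes> h) \<otimes> b \<in> H \<longleftrightarrow> inv k \<otimes> h \<in> H"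
    proof
      assume "(inv k \<otimes> h) \<otimes> b \<in> H"
      then have "((inv k \<otimes> h) \<otimes> b) \<otimes> inv b \<in> H" using assms by simp
      then show "inv k \<otimes> h \<in> H" by (simp add: m_assoc)
    qed (use assms in simp)
    then show ?thesis unfolding mem_cls e using assms Lam_mult by auto
  qed
  then show ?thesis by auto
qed

lemma fibre_scale_cls: "fibre_scale a (cls h z) = cls h (a * z)"
proof -
  have "(k, w) \<in> fibre_scale a (cls h z) \<longleftrightarrow> (k, w) \<in> cls h (a * z)" for k w
    by (auto simp: fibre_scale_def mem_cls)
  then show ?thesis by auto
qed

lemma fibre_add_cls: "fibre_add (cls h z) (cls h w) = cls h (z + w)"
proof -
  have "(k, v) \<in> fibre_add (cls h z) (cls h w) \<longleftrightarrow> (k, v) \<in> cls h (z + w)" for k v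
    by (auto simp: fibre_add_def mem_cls distrib_left)
  then show ?thesis by auto
qed

lemma bundle_proj_cls [simp]: "bundle_proj G \<eta> (cls h z) = coadj G h \<eta>"
  unfolding bundle_proj_def
proof (rule the_equality)
  show "\<exists>(g, z)\<in>cls h z. coadj G h \<eta> = coadj G g \<eta>"
    by (rule bexI[of _ "(h, z)"]) (auto simp: mem_cls)
  show "\<nu> = coadj G h \<eta>" if "\<exists>(g, z)\<in>cls h z. \<nu> = coadj G g \<eta>" for \<nu>
    using that by (auto simp: mem_cls coadj_eq_iff)
qed

lemma cls_over:
  assumes "coadj G k \<eta> = coadj G h \<eta>"
  shows "cls k z = cls h (\<Lambda> (inv h \<otimes> k) * z)" "inv h \<otimes> k \<in> H"
proof -
  show b: "inv h \<otimes> k \<in> H" using assms coadj_eq_iff by metis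
  show "cls k z = cls h (\<Lambda> (inv h \<otimes> k) * z)"
    using cls_mult[OF b, of h z] by (simp add: m_assoc[symmetric])
qed

lemma bundle_section_iff: "bundle_section G \<eta> \<Lambda> \<sigma> \<longleftrightarrow> (\<forall>h. \<exists>z. \<sigma> (coadj G h \<eta>) = cls h z)"
proof
  assume s: "bundle_section G \<eta> \<Lambda> \<sigma>"
  show "\<forall>h. \<exists>z. \<sigma> (coadj G h \<eta>) = cls h z"
  proof
    fix h
    have "coadj G h \<eta> \<in> coadjoint_orbit G \<eta>" by (simp add: coadjoint_orbit_def)
    then have *: "\<sigma> (coadj G h \<eta>) \<in> prequantum_bundle G \<eta> \<Lambda>" "bundle_proj G \<eta> (\<sigma> (coadj G h \<eta>)) = coadj G h \<eta>"
      using s by (auto simp: bundle_section_def)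
    obtain k z where kz: "\<sigma> (coadj G h \<eta>) = cls k z"
      using *(1) unfolding prequantum_bundle_def quotient_def bundle_class_def by auto
    then show "\<exists>z. \<sigma> (coadj G h \<eta>) = cls h z" using *(2) cls_over(1)[of k h z] by auto
  qed
next
  assume s: "\<forall>h. \<exists>z. \<sigma> (coadj G h \<eta>) = cls h z"
  show "bundle_section G \<eta> \<Lambda> \<sigma>"
    unfolding bundle_section_def
  proof
    fix \<nu> assume "\<nu> \<in> coadjoint_orbit G \<eta>"
    then obtain h where h: "\<nu> = coadj G h \<eta>" by (auto simp: coadjoint_orbit_def)
    then obtain z where z: "\<sigma> \<nu> = cls h z" using s by auto
    have "cls h z \<in> prequantum_bundle G \<eta> \<Lambda>"
      unfolding prequantum_bundle_def bundle_class_def by (intro quotientI) simp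
    then show "\<sigma> \<nu> \<in> prequantum_bundle G \<eta> \<Lambda> \<and> bundle_proj G \<eta> (\<sigma> \<nu>) = \<nu>" using h z by simp
  qed
qed

text \<open>The equivariant function on the group that represents a section: its fibre coordinate at
  \<open>h \<eta>\<close> with respect to the vector \<open>[h, 1]\<close>.\<close>

definition coef :: "(('e \<Rightarrow>\<^sub>L real) \<Rightarrow> ('g \<times> complex) set) \<Rightarrow> 'g \<Rightarrow> complex" where
  "coef \<sigma> h = sharp G \<eta> \<sigma> (cls h 1)"

lemma sharp_cls:
  assumes "\<sigma> (coadj G h \<eta>) = cls h w" "z \<noteq> 0" shows "sharp G \<eta> \<sigma> (cls h z) = w / z"
  unfolding sharp_def by (rule the_equality) (use assms in \<open>auto simp: fibre_scale_cls\<close>)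

lemma coef_eq: "\<sigma> (coadj G h \<eta>) = cls h w \<Longrightarrow> coef \<sigma> h = w"
  using sharp_cls[of \<sigma> h w 1] by (simp add: coef_def)

lemma section_eq_cls:
  assumes "bundle_section G \<eta> \<Lambda> \<sigma>" shows "\<sigma> (coadj G h \<eta>) = cls h (coef \<sigma> h)"
  using assms coef_eq unfolding bundle_section_iff by metis

lemma sharp_eq_coef:
  assumes "bundle_section G \<eta> \<Lambda> \<sigma>" "z \<noteq> 0" shows "sharp G \<eta> \<sigma> (cls h z) = coef \<sigma> h / z"
  by (rule sharp_cls[of \<sigma> h, OF section_eq_cls[OF assms(1)] assms(2)])

lemma coef_mult:
  assumes "bundle_section G \<eta> \<Lambda> \<sigma>" "b \<in> H" shows "coef \<sigma> (h \<otimes> b) = coef \<sigma> h / \<Lambda> b"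
proof -
  have "coadj G (h \<otimes> b) \<eta> = coadj G h \<eta>" using assms(2) by (simp add: coadj_mult H_iff)
  then have "cls h (coef \<sigma> h) = cls h (\<Lambda> b * coef \<sigma> (h \<otimes> b))"
    using section_eq_cls[OF assms(1), of h] section_eq_cls[OF assms(1), of "h \<otimes> b"] cls_mult[OF assms(2)] by simp
  then show ?thesis using assms(2) by (simp add: field_simps)
qed

section \<open>The prequantum operator on equivariant functions\<close>

text \<open>Up to the factor \<open>1/z\<close>, the derivative of \<open>[h, z] \<mapsto> f h / z\<close> along the horizontal lift of the
  left velocity \<open>Z\<close>.\<close>

definition hor :: "('g \<Rightarrow> complex) \<Rightarrow> 'g \<Rightarrow> 'e \<Rightarrow> complex" where
  "hor f h Z = ld f h Z + 2 * of_real pi * \<i> * of_real (\<eta> Z) * f h"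

lemma hor_add: "smooth_fun f \<Longrightarrow> hor f h (Z + Z') = hor f h Z + hor f h Z'"
  by (simp add: hor_def linear_add[OF ld_linear] blinfun.add_right algebra_simps)

text \<open>In a direction Z tangent to the stabilizer, equivariance and the derivative of \<Lambda>
  give \<open>ld f h Z = - 2 pi i \<eta>(Z) f h\<close>, which is exactly cancelled in
  \<open>hor\<close>. This makes the horizontal derivative depend only on the projected
  velocity.\<close>

lemma hor_isotropy:
  assumes f: "smooth_fun f" "\<And>h b. b \<in> H \<Longrightarrow> f (h \<otimes> b) = f h / \<Lambda> b" and X: "fund_field G X (coadj G h \<eta>) = 0"
  shows "hor f h (Adj (inv h) X) = 0"
proof -
  \<comment> \<open>The one-parameter group of X fixes \<open>h \<eta>\<close>; conjugation by
    \<open>h^-1\<close> carries it into the stabilizer of \<eta>, where \<Lambda> is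
    defined.\<close>
  define c where "c u = inv h \<otimes> expc X u \<otimes> inv (inv h)" for u
  have c: "c u \<in> H" for u
    using fund_field_zero_expc[OF X, of u] coadj_inv_cancel[of h \<eta>]
    by (simp add: c_def H_iff coadj_mult)
  have v: "vel1 c (Adj (inv h) X) 0 UNIV"
    unfolding c_def by (rule vel1_conj[OF expc_vel1])
  let ?l = "2 * of_real pi * \<i> * of_real (\<eta> (Adj (inv h) X)) :: complex"
  have sm: "smooth_into G UNIV c"
    unfolding c_def by (intro smooth_into_mult smooth_into_const smooth_into_expc)
  have L: "((\<lambda>u. \<Lambda> (c u)) has_vector_derivative ?l) (at 0)"
    by (rule Lam_derivative[of UNIV]) (use c v sm in auto)
  have "((\<lambda>u. f h * inverse (\<Lambda> (c u))) has_vector_derivative - (f h * ?l)) (at 0)"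
  proof -
    have "c 0 = \<one>" using v by (simp add: vel1_iff)
    then have "((\<lambda>u. inverse (\<Lambda> (c u))) has_derivative (\<lambda>t. - (inverse (\<Lambda> (c 0)) * (t *\<^sub>R ?l) * inverse (\<Lambda> (c 0))))) (at 0)"
      by (intro Deriv.has_derivative_inverse L[unfolded has_vector_derivative_def]) simp
    then have "((\<lambda>u. inverse (\<Lambda> (c u))) has_vector_derivative - ?l) (at 0)"
      unfolding has_vector_derivative_def using \<open>c 0 = \<one>\<close> by simp
    from has_vector_derivative_mult_right[OF this, of "f h"] show ?thesis by simp
  qed
  moreover have "f h * inverse (\<Lambda> (c u)) = f (h \<otimes> c u)" for u using f(2)[OF c] by (simp add: field_simps)
  ultimately have "((\<lambda>u. f (h \<otimes> c u)) has_vector_derivative - (f h * ?l)) (at 0)" by simp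
  moreover have "((\<lambda>u. f (h \<otimes> c u)) has_vector_derivative ld f h (Adj (inv h) X)) (at 0)"
    by (rule ld_vel1[OF f(1) v])
  ultimately have "ld f h (Adj (inv h) X) = - (f h * ?l)" using vector_derivative_unique_at by blast
  then show ?thesis by (simp add: hor_def)
qed

text \<open>Independence of the representative: moving from h to \<open>h b\<close> rotates the
  direction by \<open>Ad b\<close>, which preserves \<eta> on vectors, and divides by the same
  factor as f itself.\<close>

lemma hor_translate:
  assumes f: "smooth_fun f" "\<And>h b. b \<in> H \<Longrightarrow> f (h \<otimes> b) = f h / \<Lambda> b" and b: "b \<in> H"
  shows "hor f (h \<otimes> b) Z = hor f h (Adj b Z) / \<Lambda> b"
proof -
  let ?k = "\<lambda>s. E (e0 + s *\<^sub>R Z)"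
  have "((\<lambda>s. f (h \<otimes> (b \<otimes> ?k s \<otimes> inv b)) / \<Lambda> b) has_vector_derivative ld f h (Adj b Z) / \<Lambda> b) (at 0)"
    by (intro has_vector_derivative_divide ld_vel1[OF f(1) vel1_conj[OF vel1_line]])
  moreover have "f (h \<otimes> (b \<otimes> ?k s \<otimes> inv b)) / \<Lambda> b = f ((h \<otimes> b) \<otimes> ?k s)" for s
    using f(2)[OF b, of "h \<otimes> (b \<otimes> ?k s \<otimes> inv b)"] by (simp add: m_assoc)
  ultimately have "((\<lambda>s. f ((h \<otimes> b) \<otimes> ?k s)) has_vector_derivative ld f h (Adj b Z) / \<Lambda> b) (at 0)" by simp
  moreover have "((\<lambda>s. f ((h \<otimes> b) \<otimes> ?k s)) has_vector_derivative ld f (h \<otimes> b) Z) (at 0)"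
    by (rule ld_vel1[OF f(1) vel1_line])
  ultimately have "ld f (h \<otimes> b) Z = ld f h (Adj b Z) / \<Lambda> b" using vector_derivative_unique_at by blast
  then show ?thesis using b by (simp add: hor_def f(2) eta_Adj_H add_divide_distrib)
qed

lemma smooth_curve_vel1:
  assumes "smooth_curve_at_0 G c"
  obtains Z where "vel1 (\<lambda>u. inv (c 0) \<otimes> c u) Z 0 UNIV"
    "theta G \<eta> c = \<eta> Z"
proof -
  obtain I where I: "open I" "0 \<in> I" "smooth_into G I c" using assms by (auto simp: smooth_curve_at_0_def)
  have sm: "smooth_into G I (\<lambda>u. inv (c 0) \<otimes> c u)" by (intro smooth_into_mult smooth_into_const I)
  have "(\<lambda>u. phi (inv (c 0) \<otimes> c u)) differentiable (at 0)"
    using smooth_into_phi_derivative[OF sm I(1,2)] by (auto intro: differentiableI)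
  then have "((\<lambda>u. phi (inv (c 0) \<otimes> c u)) has_vector_derivative
      vector_derivative (\<lambda>u. phi (inv (c 0) \<otimes> c u)) (at 0)) (at 0)"
    by (simp add: vector_derivative_works)
  moreover have "isCont (\<lambda>u. inv (c 0) \<otimes> c u) 0"
    using smooth_into_continuous[OF sm] I by (simp add: continuous_on_eq_continuous_at)
  ultimately show thesis using that by (simp add: vel1_iff theta_def phi_def)
qed

text \<open>The description ranges over all curves, fibre coordinates and lifts. The curve
  \<open>exp(uC) h\<close> shows existence; for uniqueness, a competing choice differs by an element
  of the isotropy subgroup and by a direction on which \<open>hor\<close> vanishes.\<close>

lemma lift_derivative_eq:
  assumes f: "smooth_fun f" "\<And>h b. b \<in> H \<Longrightarrow> f (h \<otimes> b) = f h / \<Lambda> b"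
    and F: "\<And>h z. z \<noteq> 0 \<Longrightarrow> F (cls h z) = f h / z" and z: "z \<noteq> 0"
  shows "lift_derivative G \<eta> \<Lambda> (fund_field G C) F (cls h z) = hor f h (Adj (inv h) C) / z"
proof -
  let ?tpi = "2 * of_real pi * \<i> :: complex"
  have der: "((\<lambda>u. F (cls (c u) (z * exp (of_real u * x)))) has_vector_derivative hor f (c 0) Z / z) (at 0)"
    if z: "z \<noteq> 0" and Z: "vel1 (\<lambda>u. inv (c 0) \<otimes> c u) Z 0 UNIV" and x: "of_real (\<eta> Z) + x / ?tpi = 0" for c z x Z
  proof -
    \<comment> \<open>Horizontality determines x. The derivative of \<open>exp(-u x)\<close> then
      contributes precisely the zeroth order term of \<open>hor\<close>.\<close>
    have x': "- x = ?tpi * of_real (\<eta> Z)"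
      using x by (simp add: field_simps add_eq_0_iff2)
    have 1: "((\<lambda>u. f (c 0 \<otimes> (inv (c 0) \<otimes> c u))) has_vector_derivative ld f (c 0) Z) (at 0)"
      by (rule ld_vel1[OF f(1) Z])
    have "((\<lambda>w. exp (- (w * x))) has_field_derivative - x) (at (of_real 0))"
      by (auto intro!: derivative_eq_intros)
    from has_vector_derivative_real_field[OF this]
    have 2: "((\<lambda>u. exp (- (of_real u * x))) has_vector_derivative - x) (at 0)" by simp
    have "((\<lambda>u. f (c 0 \<otimes> (inv (c 0) \<otimes> c u)) * exp (- (of_real u * x)) / z) has_vector_derivative
        (f (c 0) * (- x) + ld f (c 0) Z * 1) / z) (at 0)"
      using has_vector_derivative_divide[OF has_vector_derivative_mult[OF 1 2], of z] by (simp add: m_assoc[symmetric])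
    moreover have "(f (c 0) * (- x) + ld f (c 0) Z * 1) / z = hor f (c 0) Z / z"
      unfolding x' hor_def by (simp add: algebra_simps)
    moreover have "f (c 0 \<otimes> (inv (c 0) \<otimes> c u)) * exp (- (of_real u * x)) / z = F (cls (c u) (z * exp (of_real u * x)))" for u
      using z by (simp add: F m_assoc[symmetric] exp_minus field_simps)
    ultimately show ?thesis by (simp only:)
  qed
  show ?thesis
    unfolding lift_derivative_def
  proof (rule the_equality)
    \<comment> \<open>This curve has left velocity \<open>Ad(h^-1) C\<close>, and \<open>?x\<close>
      is the vertical component that makes its lift horizontal.\<close>
    let ?c = "\<lambda>u. expc C u \<otimes> h"
    let ?Z = "Adj (inv h) C"
    let ?x = "- (?tpi * of_real (\<eta> ?Z))"
    have sc: "smooth_curve_at_0 G ?c"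
      unfolding smooth_curve_at_0_def
      by (rule exI[of _ UNIV]) (auto intro!: smooth_into_mult smooth_into_const smooth_into_expc)
    have "vel1 (\<lambda>u. inv h \<otimes> expc C u \<otimes> inv (inv h)) ?Z 0 UNIV" by (rule vel1_conj[OF expc_vel1])
    then have v: "vel1 (\<lambda>u. inv (?c 0) \<otimes> ?c u) ?Z 0 UNIV" by (simp add: m_assoc)
    obtain Z' where "vel1 (\<lambda>u. inv (?c 0) \<otimes> ?c u) Z' 0 UNIV" "theta G \<eta> ?c = \<eta> Z'"
      using smooth_curve_vel1[OF sc] by blast
    then have th: "theta G \<eta> ?c = \<eta> ?Z" using vel1_unique[OF v] by auto
    have "((\<lambda>u. coadj G (expc C u) (coadj G h \<eta>)) has_vector_derivative fund_field G C (coadj G h \<eta>)) (at 0)"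
      by (rule coadj_vel1_fund_field(1)[OF expc_vel1])
    moreover have "((\<lambda>u. F (cls (?c u) (z * exp (of_real u * ?x)))) has_vector_derivative hor f (?c 0) ?Z / z) (at 0)"
      by (rule der[OF z v]) simp
    ultimately show "\<exists>c z' x. smooth_curve_at_0 G c \<and> z' \<noteq> 0 \<and> cls h z = cls (c 0) z' \<and>
       ((\<lambda>u. coadj G (c u) \<eta>) has_vector_derivative fund_field G C (bundle_proj G \<eta> (cls h z))) (at 0) \<and>
       connection_form G \<eta> c x = 0 \<and>
       ((\<lambda>u. F (cls (c u) (z' * exp (of_real u * x)))) has_vector_derivative hor f h (Adj (inv h) C) / z) (at 0)"
      using sc z th by (intro exI[of _ ?c] exI[of _ z] exI[of _ ?x]) (simp add: coadj_mult connection_form_def)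
  next
    fix d
    assume "\<exists>c z' x. smooth_curve_at_0 G c \<and> z' \<noteq> 0 \<and> cls h z = cls (c 0) z' \<and>
       ((\<lambda>u. coadj G (c u) \<eta>) has_vector_derivative fund_field G C (bundle_proj G \<eta> (cls h z))) (at 0) \<and>
       connection_form G \<eta> c x = 0 \<and>
       ((\<lambda>u. F (cls (c u) (z' * exp (of_real u * x)))) has_vector_derivative d) (at 0)"
    then obtain c z' x where c: "smooth_curve_at_0 G c" and z': "z' \<noteq> 0" and y: "cls h z = cls (c 0) z'"
      and pr: "((\<lambda>u. coadj G (c u) \<eta>) has_vector_derivative fund_field G C (coadj G h \<eta>)) (at 0)"
      and con: "connection_form G \<eta> c x = 0"
      and d: "((\<lambda>u. F (cls (c u) (z' * exp (of_real u * x)))) has_vector_derivative d) (at 0)" by auto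
    obtain Z where Z: "vel1 (\<lambda>u. inv (c 0) \<otimes> c u) Z 0 UNIV" "theta G \<eta> c = \<eta> Z"
      using smooth_curve_vel1[OF c] by blast
    have proj: "coadj G (c 0) \<eta> = coadj G h \<eta>" using y bundle_proj_cls by metis
    \<comment> \<open>A competing curve starts at \<open>h b\<close> with b in the isotropy
      subgroup; the fibre coordinates then differ by the factor \<open>\<Lambda> b\<close>.\<close>
    define b where "b = inv h \<otimes> c 0"
    have b: "b \<in> H" "c 0 = h \<otimes> b" and zz: "z = \<Lambda> b * z'"
      using cls_over[OF proj] y by (auto simp: b_def m_assoc[symmetric])
    have "d = hor f (c 0) Z / z'"
      using vector_derivative_unique_at[OF d der[OF z' Z(1)]] con Z(2) by (simp add: connection_form_def)
    also have "\<dots> = hor f h (Adj b Z) / z" using hor_translate[OF f b(1)] b(2) zz by simp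
    also have "hor f h (Adj b Z) = hor f h (Adj (inv h) C)"
    proof -
      \<comment> \<open>The two curves have the same projected velocity, so the fundamental field of
        \<open>?X\<close> vanishes at the base point and \<open>hor_isotropy\<close> removes the
        difference.\<close>
      let ?X = "Adj (c 0) Z - C"
      have "((\<lambda>u. coadj G (c 0 \<otimes> (inv (c 0) \<otimes> c u) \<otimes> inv (c 0)) (coadj G h \<eta>))
          has_vector_derivative fund_field G (Adj (c 0) Z) (coadj G h \<eta>)) (at 0)"
        by (rule coadj_vel1_fund_field(1)[OF vel1_conj[OF Z(1)]])
      moreover have "coadj G (c 0 \<otimes> (inv (c 0) \<otimes> c u) \<otimes> inv (c 0)) (coadj G h \<eta>) = coadj G (c u) \<eta>" for u
        unfolding proj[symmetric] coadj_mult[symmetric] by (simp add: m_assoc) (simp add: m_assoc[symmetric])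
      ultimately have "fund_field G (Adj (c 0) Z) (coadj G h \<eta>) = fund_field G C (coadj G h \<eta>)"
        using pr vector_derivative_unique_at by simp blast
      then have "fund_field G ?X (coadj G h \<eta>) B = 0" for B
        using fund_field_apply[of "Adj (c 0) Z" "coadj G h \<eta>" B] fund_field_apply[of C "coadj G h \<eta>" B]
        by (simp add: fund_field_apply linear_diff[OF ad_linear] blinfun.diff_right)
      then have "hor f h (Adj (inv h) ?X) = 0"
        by (intro hor_isotropy[OF f]) (auto intro: blinfun_eqI)
      moreover have "Adj b Z = Adj (inv h) C + Adj (inv h) ?X"
        by (simp add: b_def Adj_mult linear_diff[OF bounded_linear.linear[OF Adj_bounded_linear]])
      ultimately show ?thesis by (simp add: hor_add[OF f(1)])
    qed
    finally show "d = hor f h (Adj (inv h) C) / z" .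
  qed
qed

text \<open>The cancellation uses that the Hamiltonian term involves
  \<open>(h \<eta>)(C) = \<eta>(Ad(h^-1) C)\<close>, the value of \<theta> that enters
  \<open>hor\<close>. The description of the covariant derivative is evaluated on all vectors
  \<open>[h, z]\<close> with z nonzero, and \<open>[h, 1]\<close> settles uniqueness.\<close>

lemma prequantum_op_eq:
  assumes s: "bundle_section G \<eta> \<Lambda> \<sigma>" "smooth_fun (coef \<sigma>)"
  shows "prequantum_op G \<eta> \<Lambda> C \<sigma> (coadj G h \<eta>) = cls h (- ld (coef \<sigma>) h (Adj (inv h) C))"
proof -
  let ?d = "hor (coef \<sigma>) h (Adj (inv h) C)"
  have lift: "lift_derivative G \<eta> \<Lambda> (fund_field G C) (sharp G \<eta> \<sigma>) (cls h z) = ?d / z" if "z \<noteq> 0" for z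
    by (rule lift_derivative_eq[OF s(2) coef_mult[OF s(1)] sharp_eq_coef[OF s(1)] that])
  have "covariant_derivative G \<eta> \<Lambda> (fund_field G C) \<sigma> (coadj G h \<eta>) = cls h ?d"
    unfolding covariant_derivative_def
  proof (rule the_equality)
    show "\<forall>y\<in>bundle_nonzero G \<eta> \<Lambda>. bundle_proj G \<eta> y = coadj G h \<eta> \<longrightarrow>
        cls h ?d = fibre_scale (lift_derivative G \<eta> \<Lambda> (fund_field G C) (sharp G \<eta> \<sigma>) y) y"
    proof (intro ballI impI)
      fix y assume "y \<in> bundle_nonzero G \<eta> \<Lambda>" "bundle_proj G \<eta> y = coadj G h \<eta>"
      then obtain k w where kw: "y = cls k w" "w \<noteq> 0" "coadj G k \<eta> = coadj G h \<eta>"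
        by (auto simp: bundle_nonzero_def)
      then obtain z where "y = cls h z" "z \<noteq> 0" using cls_over[OF kw(3)] kw(1,2) by simp
      then show "cls h ?d = fibre_scale (lift_derivative G \<eta> \<Lambda> (fund_field G C) (sharp G \<eta> \<sigma>) y) y"
        using lift by (simp add: fibre_scale_cls)
    qed
  next
    fix p assume *: "\<forall>y\<in>bundle_nonzero G \<eta> \<Lambda>. bundle_proj G \<eta> y = coadj G h \<eta> \<longrightarrow>
        p = fibre_scale (lift_derivative G \<eta> \<Lambda> (fund_field G C) (sharp G \<eta> \<sigma>) y) y"
    have "cls h 1 \<in> bundle_nonzero G \<eta> \<Lambda>" unfolding bundle_nonzero_def by force
    then show "p = cls h ?d" using bspec[OF *, of "cls h 1"] lift[of 1] by (simp add: fibre_scale_cls)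
  qed
  then show ?thesis
    by (simp add: prequantum_op_def section_eq_cls[OF s(1)] fibre_scale_cls fibre_add_cls hamiltonian_fun_def
        hor_def coadj_apply)
qed

end

context prequantum
begin

section \<open>Evolution along the group curve\<close>

lemma family_coef:
  assumes "smooth_section_family G \<eta> \<Lambda> \<sigma>"
  shows "t \<in> {0..1} \<Longrightarrow> bundle_section G \<eta> \<Lambda> (\<sigma> t)"
    and "(U, \<rho>) \<in> charts G \<Longrightarrow> smooth_on ({0..1} \<times> \<rho> ` U) (\<lambda>p. coef (\<sigma> (fst p)) (inv_into U \<rho> (snd p)))"
    and "t \<in> {0..1} \<Longrightarrow> smooth_fun (coef (\<sigma> t))"
proof -
  show "bundle_section G \<eta> \<Lambda> (\<sigma> t)" if "t \<in> {0..1}" for t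
    using assms that by (simp add: smooth_section_family_def)
  show *: "smooth_on ({0..1} \<times> \<rho> ` U) (\<lambda>p. coef (\<sigma> (fst p)) (inv_into U \<rho> (snd p)))"
    if c: "(U, \<rho>) \<in> charts G" for U \<rho>
  proof -
    have "\<forall>(U, \<phi>)\<in>charts G. smooth_on ({0..1} \<times> \<phi> ` U \<times> (- {0}))
        (\<lambda>(t, x, z). sharp G \<eta> (\<sigma> t) (cls (inv_into U \<phi> x) z))"
      using assms by (simp add: smooth_section_family_def)
    from bspec[OF this c]
    have *: "smooth_on ({0..1} \<times> \<rho> ` U \<times> (- {0})) (\<lambda>(t, x, z). sharp G \<eta> (\<sigma> t) (cls (inv_into U \<rho> x) z))"
      by simp
    have "smooth_on ({0..1} \<times> \<rho> ` U)
        (\<lambda>p. (\<lambda>(t, x, z). sharp G \<eta> (\<sigma> t) (cls (inv_into U \<rho> x) z)) (fst p, snd p, 1))"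
      by (rule smooth_on_compose[OF fin_dim_prod[OF fin_dim_euclidean fin_dim_prod[OF fin_dim_model fin_dim_euclidean]] *])
        (auto intro!: smooth_on_Pair smooth_on_fst smooth_on_snd smooth_on_id smooth_on_const)
    then show ?thesis by (simp add: coef_def)
  qed
  show "smooth_fun (coef (\<sigma> t))" if t: "t \<in> {0..1}" for t
  proof -
    have "smooth_on (\<rho> ` U) (\<lambda>x. coef (\<sigma> t) (inv_into U \<rho> x))" if c: "(U, \<rho>) \<in> charts G" for U \<rho>
    proof -
      have "smooth_on (\<rho> ` U) (\<lambda>x. (\<lambda>p. coef (\<sigma> (fst p)) (inv_into U \<rho> (snd p))) (t, x))"
        by (rule smooth_on_compose[OF fin_dim_prod[OF fin_dim_euclidean fin_dim_model] *[OF c]])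
          (use t in \<open>auto intro!: smooth_on_Pair smooth_on_id smooth_on_const\<close>)
      then show ?thesis by simp
    qed
    then show ?thesis unfolding smooth_fun_def by auto
  qed
qed

text \<open>In terms of \<open>coef\<close> the fibre equation becomes a transport equation on the
  group. A coordinate vector \<open>[h, z]\<close> only divides both sides by z, so it suffices to
  take \<open>z = 1\<close>.\<close>

lemma evolution_iff:
  assumes fam: "smooth_section_family G \<eta> \<Lambda> \<sigma>"
  shows "evolution G \<eta> \<Lambda> A \<sigma> \<longleftrightarrow> (\<forall>t\<in>{0..1}. \<forall>h.
    ((\<lambda>s. coef (\<sigma> s) h) has_vector_derivative - ld (coef (\<sigma> t)) h (Adj (inv h) (A t))) (at t within {0..1}))"
    (is "_ \<longleftrightarrow> (\<forall>t\<in>_. \<forall>h. ?R t h)")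
proof -
  have op: "sharp G \<eta> (prequantum_op G \<eta> \<Lambda> (A t) (\<sigma> t)) (cls h z) = - ld (coef (\<sigma> t)) h (Adj (inv h) (A t)) / z"
    if "t \<in> {0..1}" "z \<noteq> 0" for t h z
    by (rule sharp_cls[where \<sigma> = "prequantum_op G \<eta> \<Lambda> (A t) (\<sigma> t)" and h = h, OF prequantum_op_eq])
      (use family_coef[OF fam] that in auto)
  have "((\<lambda>s. sharp G \<eta> (\<sigma> s) (cls h z)) has_vector_derivative
      sharp G \<eta> (prequantum_op G \<eta> \<Lambda> (A t) (\<sigma> t)) (cls h z)) (at t within {0..1})"
    if R: "?R t h" and "t \<in> {0..1}" "z \<noteq> 0" for t h z
  proof -
    have "((\<lambda>s. coef (\<sigma> s) h / z) has_vector_derivative - ld (coef (\<sigma> t)) h (Adj (inv h) (A t)) / z) (at t within {0..1})"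
      by (rule has_vector_derivative_divide[OF R])
    then have "((\<lambda>s. sharp G \<eta> (\<sigma> s) (cls h z)) has_vector_derivative
        - ld (coef (\<sigma> t)) h (Adj (inv h) (A t)) / z) (at t within {0..1})"
      by (rule has_vector_derivative_transform[rotated 2])
        (use that family_coef(1)[OF fam] sharp_eq_coef in auto)
    then show ?thesis using op that by simp
  qed
  moreover have "?R t h"
    if "((\<lambda>s. sharp G \<eta> (\<sigma> s) (cls h 1)) has_vector_derivative
      sharp G \<eta> (prequantum_op G \<eta> \<Lambda> (A t) (\<sigma> t)) (cls h 1)) (at t within {0..1})" and "t \<in> {0..1}" for t h
    using that op[of t 1 h] by (simp add: coef_def)
  moreover have "cls h 1 \<in> bundle_nonzero G \<eta> \<Lambda>" for h unfolding bundle_nonzero_def by force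
  ultimately show ?thesis using fam unfolding evolution_def bundle_nonzero_def by auto
qed

text \<open>Conjugation converts the prescribed right logarithmic derivative into the left one,
  which is what \<open>ld\<close> takes as its argument.\<close>

lemma right_log_solution_lvel:
  assumes "right_log_solution G A g" "t \<in> {0..1}"
  shows "lvel (\<lambda>s. g s \<otimes> h) (Adj (inv (g t \<otimes> h)) (A t)) t {0..1}"
proof -
  have "vel1 (\<lambda>s. inv (g t \<otimes> h) \<otimes> (g s \<otimes> inv (g t)) \<otimes> inv (inv (g t \<otimes> h))) (Adj (inv (g t \<otimes> h)) (A t)) t {0..1}"
    by (rule vel1_conj[OF right_log_solution_vel1[OF assms]])
  then show ?thesis by (simp add: lvel_def m_assoc inv_mult_group inv_cancel)
qed

text \<open>A chain rule in time and group variable jointly, on a closed time interval. It is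
  carried out on a smooth local extension in a chart; its two partial derivatives are identified
  with the time derivative of the section and with \<open>ld\<close>.\<close>

lemma evolution_along_solution:
  assumes ev: "evolution G \<eta> \<Lambda> A \<sigma>" and g: "right_log_solution G A g"
  shows "coef (\<sigma> 1) (g 1 \<otimes> h) = coef (\<sigma> 0) h"
proof -
  have fam: "smooth_section_family G \<eta> \<Lambda> \<sigma>" using ev by (simp add: evolution_def)
  define f where "f t = coef (\<sigma> t)" for t
  have der: "((\<lambda>s. f s (g s \<otimes> h)) has_vector_derivative 0) (at t within {0..1})" if t: "t \<in> {0..1}" for t
  proof -
    let ?h = "g t \<otimes> h" and ?C = "Adj (inv (g t \<otimes> h)) (A t)"
    \<comment> \<open>Derivatives within the interval are unique because t is a limit point of it,
      also at the end points.\<close>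
    have nt: "at t within {0..1} \<noteq> bot" using t by (simp add: trivial_limit_within islimpt_Icc)
    obtain U \<rho> where U: "(U, \<rho>) \<in> charts G" "?h \<in> U" by (rule chartE)
    have x0: "(t, \<rho> ?h) \<in> {0..1} \<times> \<rho> ` U" using t U by simp
    \<comment> \<open>Q extends the family past the ends of the time interval, so one full
      derivative D is available at every t, including 0 and 1.\<close>
    obtain N Q where N: "open N" "(t, \<rho> ?h) \<in> N" "\<And>k. Ck_on k Q N"
      and Q: "\<And>p. p \<in> {0..1} \<times> \<rho> ` U \<Longrightarrow> p \<in> N \<Longrightarrow> Q p = f (fst p) (inv_into U \<rho> (snd p))"
      using smooth_onE[OF family_coef(2)[OF fam U(1)] x0] unfolding f_def by metis
    obtain D where D: "(Q has_derivative D) (at (t, \<rho> ?h))"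
      using Ck_on_SucD[OF N(3) N(2)] by blast
    have lin: "linear D" by (rule has_derivative_linear[OF D])
    obtain D1 where D1: "((\<lambda>x. \<rho> (?h \<otimes> E x)) has_derivative D1) (at e0)"
        "((\<lambda>s. \<rho> (g s \<otimes> h)) has_vector_derivative D1 ?C) (at t within {0..1})"
      using lvel_chart[OF right_log_solution_lvel[OF g t] U] by blast
    have near: "\<forall>\<^sub>F s in at t within {0..1}. Q (s, \<rho> (k s)) = f s (k s)"
      if k: "continuous (at t within {0..1}) k" "k t = ?h"
        "continuous (at t within {0..1}) (\<lambda>s. \<rho> (k s))" for k
    proof -
      have "((\<lambda>s. (s, \<rho> (k s))) \<longlongrightarrow> (t, \<rho> ?h)) (at t within {0..1})"
        using k by (intro tendsto_Pair) (auto simp: continuous_within)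
      then have "\<forall>\<^sub>F s in at t within {0..1}. (s, \<rho> (k s)) \<in> N" using N by (intro topological_tendstoD)
      moreover have "\<forall>\<^sub>F s in at t within {0..1}. k s \<in> U"
        using k U chart_open(1)[OF U(1)] by (intro topological_tendstoD[of k ?h]) (auto simp: continuous_within)
      moreover have "\<forall>\<^sub>F s in at t within {0..1}. s \<in> {0..1}" by (simp add: eventually_at_topological) blast
      ultimately show ?thesis by eventually_elim (simp add: Q U)
    qed
    have eq0: "Q (t, \<rho> ?h) = f t ?h" using Q[OF x0 N(2)] U by simp
    have chain: "((\<lambda>s. Q (s, q s)) has_vector_derivative D (1, q')) (at t within {0..1})"
      if "(q has_vector_derivative q') (at t within {0..1})" "q t = \<rho> ?h" for q q'
    proof -
      have "((\<lambda>s. (s, q s)) has_vector_derivative (1, q')) (at t within {0..1})"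
        by (intro has_vector_derivative_Pair has_vector_derivative_id that)
      moreover have "(Q has_derivative D) (at (t, q t) within (\<lambda>s. (s, q s)) ` {0..1})"
        using has_derivative_at_withinI[OF D] that(2) by simp
      ultimately have "((\<lambda>s. Q (s, q s)) has_derivative (\<lambda>u. D (u *\<^sub>R (1, q')))) (at t within {0..1})"
        using diff_chain_within[of "\<lambda>s. (s, q s)" _ t "{0..1}" Q D] unfolding has_vector_derivative_def by (simp add: o_def)
      then show ?thesis unfolding has_vector_derivative_def linear_scale[OF lin] .
    qed
    have 1: "D (1, 0) = - ld (f t) ?h ?C"
    proof -
      have "((\<lambda>s. Q (s, \<rho> ?h)) has_vector_derivative D (1, 0)) (at t within {0..1})"
        by (rule chain) (auto intro: has_vector_derivative_const)
      then have "((\<lambda>s. f s ?h) has_vector_derivative D (1, 0)) (at t within {0..1})"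
        by (rule has_vector_derivative_transform_eventually[OF _ near t]) (use eq0 in auto)
      moreover have "((\<lambda>s. f s ?h) has_vector_derivative - ld (f t) ?h ?C) (at t within {0..1})"
        using ev t unfolding evolution_iff[OF fam] f_def by blast
      ultimately show ?thesis using vector_derivative_unique_within[OF nt] by blast
    qed
    have 2: "D (0, D1 v) = ld (f t) ?h v" for v
    proof -
      have "((\<lambda>x. (t, \<rho> (?h \<otimes> E x))) has_derivative (\<lambda>v. (0, D1 v))) (at e0)"
        by (intro has_derivative_Pair has_derivative_const D1)
      moreover have "(Q has_derivative D) (at (t, \<rho> (?h \<otimes> E e0)))" using D by simp
      ultimately have "((\<lambda>x. Q (t, \<rho> (?h \<otimes> E x))) has_derivative (\<lambda>v. D (0, D1 v))) (at e0)"
        using diff_chain_at[of "\<lambda>x. (t, \<rho> (?h \<otimes> E x))" _ e0 Q D] by (simp add: o_def)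
      moreover have "\<forall>\<^sub>F x in at e0. Q (t, \<rho> (?h \<otimes> E x)) = f t (?h \<otimes> E x)"
      proof -
        have cE: "isCont (\<lambda>x. ?h \<otimes> E x) e0"
          by (rule continuous_group_mult[OF continuous_const])
            (use continuous_E open_W e0_W in \<open>simp add: continuous_on_eq_continuous_at\<close>)
        have "((\<lambda>x. (t, \<rho> (?h \<otimes> E x))) \<longlongrightarrow> (t, \<rho> (?h \<otimes> E e0))) (at e0)"
          using has_derivative_continuous[OF D1(1)] by (intro tendsto_Pair) (auto simp: continuous_at)
        then have "\<forall>\<^sub>F x in at e0. (t, \<rho> (?h \<otimes> E x)) \<in> N" using N by (intro topological_tendstoD) auto
        moreover have "\<forall>\<^sub>F x in at e0. ?h \<otimes> E x \<in> U"
          using cE U chart_open(1)[OF U(1)] by (intro topological_tendstoD[of _ ?h]) (auto simp: isCont_def)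
        ultimately show ?thesis by eventually_elim (use t in \<open>simp add: Q U\<close>)
      qed
      ultimately have "((\<lambda>x. f t (?h \<otimes> E x)) has_derivative (\<lambda>v. D (0, D1 v))) (at e0)"
        by (rule has_derivative_transform_eventually) (use eq0 in auto)
      moreover have "((\<lambda>x. f t (?h \<otimes> E x)) has_derivative ld (f t) ?h) (at e0)"
        using ld_has_derivative[OF family_coef(3)[OF fam t]] by (simp add: f_def)
      ultimately show ?thesis using has_derivative_unique by metis
    qed
    \<comment> \<open>The two partial contributions are \<open>- ld (f t) ?h ?C\<close> and
      \<open>ld (f t) ?h ?C\<close>.\<close>
    have "D (1, D1 ?C) = D (1, 0) + D (0, D1 ?C)" using linear_add[OF lin, of "(1, 0)" "(0, D1 ?C)"] by simp
    also have "\<dots> = 0" using 1 2 by simp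
    finally have "((\<lambda>s. Q (s, \<rho> (g s \<otimes> h))) has_vector_derivative 0) (at t within {0..1})"
      using chain[OF D1(2)] by simp
    then show ?thesis
      by (rule has_vector_derivative_transform_eventually[OF _ near t])
        (use eq0 lvel_continuous[OF right_log_solution_lvel[OF g t]] has_vector_derivative_continuous[OF D1(2)] in auto)
  qed
  obtain c where "\<And>s. s \<in> {0..1} \<Longrightarrow> f s (g s \<otimes> h) = c"
    using has_vector_derivative_zero_constant[OF convex_real_interval(5) der] by metis
  then have "f 1 (g 1 \<otimes> h) = f 0 (g 0 \<otimes> h)" by simp
  then show ?thesis using g by (simp add: f_def right_log_solution_def)
qed

section \<open>The character is constant along conjugates\<close>

text \<open>The neighbourhood is a translated chart ball, so each of its points is joined to h by a
  chart segment. Along it the derivative of the conjugate vanishes under \<eta> because \<eta> is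
  invariant under the adjoint action of the isotropy subgroup.\<close>

lemma Lam_conj_locally_const:
  assumes a: "\<And>h. inv h \<otimes> a \<otimes> h \<in> H"
  obtains N where "open N" "h \<in> N" "\<And>k. k \<in> N \<Longrightarrow> \<Lambda> (inv k \<otimes> a \<otimes> k) = \<Lambda> (inv h \<otimes> a \<otimes> h)"
proof -
  obtain r where r: "r > 0" "ball e0 r \<subseteq> W" using open_W e0_W open_contains_ball by blast
  define N where "N = (\<lambda>k. inv h \<otimes> k) -` (dom1 \<inter> phi -` ball e0 r)"
  have "open (dom1 \<inter> phi -` ball e0 r)"
    by (rule continuous_open_preimage[OF continuous_phi open_dom1]) simp
  moreover have "continuous_on UNIV (\<lambda>k. inv h \<otimes> k)"
    by (intro continuous_on_group_mult continuous_on_const continuous_on_id)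
  ultimately have "open N"
    unfolding N_def using continuous_open_preimage[of UNIV] by fastforce
  moreover have "h \<in> N" using r by (simp add: N_def e0_def[symmetric])
  moreover have "\<Lambda> (inv k \<otimes> a \<otimes> k) = \<Lambda> (inv h \<otimes> a \<otimes> h)" if k: "k \<in> N" for k
  proof -
    define x where "x = phi (inv h \<otimes> k)"
    have x: "x \<in> ball e0 r" "k = h \<otimes> E x"
      using k by (auto simp: N_def x_def m_assoc[symmetric])
    define q where "q u = e0 + u *\<^sub>R (x - e0)" for u :: real
    \<comment> \<open>An open set of parameters around \<open>[0, 1]\<close>: the derivative of
      \<Lambda> is given along curves on open sets.\<close>
    define I where "I = q -` ball e0 r"
    have qc: "continuous_on UNIV q" unfolding q_def by (intro continuous_intros)
    then have oI: "open I" unfolding I_def using continuous_open_preimage[of UNIV q] by fastforce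
    have qI: "u \<in> I" if "u \<in> {0..1}" for u
    proof -
      have "norm (u *\<^sub>R (x - e0)) \<le> norm (x - e0)" using that by (simp add: mult_left_le_one_le)
      then show ?thesis using x(1) by (simp add: I_def q_def dist_norm norm_minus_commute)
    qed
    have smq: "smooth_on S q" for S
      unfolding q_def by (intro smooth_on_add smooth_on_const smooth_on_bounded_linear bounded_linear_scaleR_left)
    define hh where "hh u = h \<otimes> E (q u)" for u
    define b where "b u = inv (hh u) \<otimes> a \<otimes> hh u" for u
    have bH: "b u \<in> H" for u by (simp add: b_def a)
    have smh: "smooth_into G I hh"
      unfolding hh_def
      by (intro smooth_into_mult smooth_into_const smooth_into_E_compose smq) (use r in \<open>auto simp: I_def\<close>)
    have der: "((\<lambda>u. \<Lambda> (b u)) has_vector_derivative 0) (at u within {0..1})" if u: "u \<in> {0..1}" for u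
    proof -
      define J where "J = (\<lambda>v. u + v) -` I"
      have oJ: "open J" unfolding J_def by (intro open_vimage oI continuous_intros)
      have J0: "0 \<in> J" using qI[OF u] by (simp add: J_def)
      have smv: "smooth_into G J (\<lambda>v. hh (u + v))"
        by (rule smooth_into_compose[OF fin_dim_euclidean smh])
          (auto simp: J_def intro!: smooth_on_add smooth_on_const smooth_on_id)
      then have "smooth_curve_at_0 G (\<lambda>v. hh (u + v))" using oJ J0 by (auto simp: smooth_curve_at_0_def)
      from smooth_curve_vel1[OF this] obtain Y where "vel1 (\<lambda>v. inv (hh (u + 0)) \<otimes> hh (u + v)) Y 0 UNIV" by blast
      then have Y: "vel1 (\<lambda>v. inv (hh u) \<otimes> hh (u + v)) Y 0 UNIV" by simp
      \<comment> \<open>Dividing by \<open>b u\<close> moves the point of differentiation to the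
        identity and keeps the curve in the isotropy subgroup; multiplicativity of \<Lambda> carries
        the result back.\<close>
      define c where "c v = inv (b u) \<otimes> b (u + v)" for v
      have "vel1 (\<lambda>v. (inv (b u) \<otimes> inv (inv (hh u) \<otimes> hh (u + v)) \<otimes> inv (inv (b u))) \<otimes> (inv (hh u) \<otimes> hh (u + v)))
          (Adj (inv (b u)) (- Y) + Y) 0 UNIV"
        by (intro vel1_mult vel1_conj vel1_inv Y)
      moreover have "(inv (b u) \<otimes> inv (inv (hh u) \<otimes> hh (u + v)) \<otimes> inv (inv (b u))) \<otimes> (inv (hh u) \<otimes> hh (u + v)) = c v" for v
        by (simp add: c_def b_def inv_mult_group m_assoc inv_cancel)
      ultimately have v: "vel1 c (Adj (inv (b u)) (- Y) + Y) 0 UNIV" by simp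
      have "\<eta> (Adj (inv (b u)) (- Y) + Y) = 0"
        using bH by (simp add: blinfun.add_right eta_Adj_H blinfun.minus_right)
      moreover have smc: "smooth_into G J c"
        unfolding c_def b_def by (intro smooth_into_mult smooth_into_inv smooth_into_const smv)
      have "((\<lambda>v. \<Lambda> (c v)) has_vector_derivative
          2 * of_real pi * \<i> * of_real (\<eta> (Adj (inv (b u)) (- Y) + Y))) (at 0)"
        by (rule Lam_derivative[OF oJ J0 smc _ v]) (use bH in \<open>auto simp: c_def\<close>)
      ultimately have "((\<lambda>v. \<Lambda> (c v)) has_vector_derivative 0) (at 0)" by simp
      from has_vector_derivative_mult_right[OF this, of "\<Lambda> (b u)"]
      have "((\<lambda>v. \<Lambda> (b u) * \<Lambda> (c v)) has_vector_derivative 0) (at (- u + u))" by simp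
      moreover have "((\<lambda>w. - u + w) has_vector_derivative 1) (at u)"
        by (auto intro!: derivative_eq_intros)
      ultimately have "((\<lambda>w. \<Lambda> (b u) * \<Lambda> (c (- u + w))) has_vector_derivative 0) (at u)"
        using vector_diff_chain_at[of "\<lambda>w. - u + w" 1 u] by (fastforce simp: o_def)
      moreover have "\<Lambda> (b u) * \<Lambda> (c (- u + w)) = \<Lambda> (b w)" for w
        using bH by (simp add: c_def Lam_mult[symmetric] m_assoc[symmetric])
      ultimately show ?thesis by (simp add: has_vector_derivative_at_within)
    qed
    obtain l where "\<And>u. u \<in> {0..1} \<Longrightarrow> \<Lambda> (b u) = l"
      using has_vector_derivative_zero_constant[OF convex_real_interval(5) der] by metis
    then have "\<Lambda> (b 1) = \<Lambda> (b 0)" by simp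
    then show ?thesis using x(2) by (simp add: b_def hh_def q_def)
  qed
  ultimately show thesis using that by blast
qed

lemma continuous_orbit_map: "continuous_on UNIV (\<lambda>h. coadj G h \<nu>)"
proof (rule blinfun_continuous_on_pointwise[OF fin_dim_model])
  fix B
  have "continuous_on UNIV (\<lambda>h. Adj (inv h) B)"
    by (rule continuous_on_compose2[OF continuous_Adj continuous_inv]) simp
  then show "continuous_on UNIV (\<lambda>h. coadj G h \<nu> B)"
    unfolding coadj_apply by (intro continuous_intros)
qed

text \<open>The locally constant function descends to the orbit, where connectedness is available. A
  level set and its complement are compact, so their images are closed, disjoint and cover the
  orbit.\<close>

lemma Lam_conj_const:
  assumes a: "\<And>h. inv h \<otimes> a \<otimes> h \<in> H" and comp: "compact (carrier G)"
    and conn: "connected (coadjoint_orbit G \<eta>)"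
  shows "\<Lambda> (inv h \<otimes> a \<otimes> h) = \<Lambda> a"
proof -
  define f where "f h = \<Lambda> (inv h \<otimes> a \<otimes> h)" for h
  define S where "S = {h. f h = f \<one>}"
  let ?\<pi> = "\<lambda>h. coadj G h \<eta>"
  have loc: "\<exists>N. open N \<and> h \<in> N \<and> (\<forall>k\<in>N. f k = f h)" for h
    using Lam_conj_locally_const[OF a, of h] unfolding f_def by metis
  have "open S" "open (- S)"
    using loc by (auto simp: S_def open_subopen[of "{h. f h = f \<one>}"] open_subopen[of "- {h. f h = f \<one>}"] subset_iff) metis+
  then have "compact S" "compact (- S)"
    using comp closed_Int_compact[of S UNIV] closed_Int_compact[of "- S" UNIV] by (auto simp: carrier_UNIV closed_def)
  then have cl: "closed (?\<pi> ` S)" "closed (?\<pi> ` (- S))"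
    using compact_imp_closed[OF compact_continuous_image[OF continuous_on_subset[OF continuous_orbit_map subset_UNIV]]]
    by blast+
  \<comment> \<open>Replacing h by \<open>h b\<close> conjugates the argument of \<Lambda> by an
    element of its domain, which a character with commuting values does not see.\<close>
  have inv: "f h = f k" if "?\<pi> h = ?\<pi> k" for h k
  proof -
    define b where "b = inv h \<otimes> k"
    have b: "b \<in> H" "k = h \<otimes> b" using that by (auto simp: b_def coadj_eq_iff m_assoc[symmetric])
    have "inv k \<otimes> a \<otimes> k = inv b \<otimes> (inv h \<otimes> a \<otimes> h) \<otimes> b" using b by (simp add: inv_mult_group m_assoc)
    then show ?thesis using b a by (simp add: f_def Lam_mult Lam_inv)
  qed
  have disj: "?\<pi> ` S \<inter> ?\<pi> ` (- S) = {}"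
  proof (rule equals0I)
    fix \<nu> assume "\<nu> \<in> ?\<pi> ` S \<inter> ?\<pi> ` (- S)"
    then obtain h k where "h \<in> S" "k \<in> - S" "?\<pi> h = ?\<pi> k" by blast
    then show False using inv[of h k] by (simp add: S_def)
  qed
  have orb: "coadjoint_orbit G \<eta> = ?\<pi> ` S \<union> ?\<pi> ` (- S)" by (auto simp: coadjoint_orbit_def)
  have "?\<pi> \<one> \<in> ?\<pi> ` S" by (rule imageI) (simp add: S_def)
  moreover have "?\<pi> ` S \<inter> coadjoint_orbit G \<eta> = {} \<or> ?\<pi> ` (- S) \<inter> coadjoint_orbit G \<eta> = {}"
    by (rule connected_closedD[OF conn _ _ cl]) (simp_all add: disj orb)
  ultimately have "?\<pi> ` (- S) = {}" unfolding orb by blast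
  then have "h \<in> S" by blast
  then show ?thesis by (simp add: S_def f_def)
qed

lemma evolution_end:
  assumes ev: "evolution G \<eta> \<Lambda> A \<sigma>" and g: "right_log_solution G A g" and iso: "closed_isotopy G \<eta> A \<psi>"
    and comp: "compact (carrier G)" and conn: "connected (coadjoint_orbit G \<eta>)"
  shows "g 1 \<in> H" and "coef (\<sigma> 1) h = \<Lambda> (g 1) * coef (\<sigma> 0) h"
proof -
  have fix': "coadj G (g 1) (coadj G k \<eta>) = coadj G k \<eta>" for k by (rule closed_isotopy_fixes[OF iso g])
  show g1: "g 1 \<in> H" using fix'[of \<one>] by (simp add: H_iff)
  have a: "inv k \<otimes> g 1 \<otimes> k \<in> H" for k
    using fix'[of k] by (simp add: H_iff coadj_mult coadj_inv_cancel)
  have "bundle_section G \<eta> \<Lambda> (\<sigma> 1)"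
    using ev by (intro family_coef(1)) (auto simp: evolution_def)
  \<comment> \<open>Used for the factorization \<open>g_1 h = h (h^-1 g_1 h)\<close>.\<close>
  from coef_mult[OF this a[of h], of h]
  have "coef (\<sigma> 1) (g 1 \<otimes> h) = coef (\<sigma> 1) h / \<Lambda> (inv h \<otimes> g 1 \<otimes> h)"
    by (simp add: m_assoc[symmetric])
  then show "coef (\<sigma> 1) h = \<Lambda> (g 1) * coef (\<sigma> 0) h"
    using evolution_along_solution[OF ev g, of h] Lam_conj_const[OF a comp conn, of h] Lam_nonzero[OF g1]
    by (simp add: field_simps)
qed

end

section \<open>The invariant mean of a compact subgroup\<close>

lemma average_mono:
  fixes u w :: "'a \<Rightarrow> real"
  assumes "finite S" "S \<noteq> {}" "\<And>a. a \<in> S \<Longrightarrow> u a \<le> w a"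
  shows "(\<Sum>a\<in>S. u a) / card S \<le> (\<Sum>a\<in>S. w a) / card S"
  using assms by (intro divide_right_mono sum_mono) auto

lemma average_const: "finite S \<Longrightarrow> S \<noteq> {} \<Longrightarrow> (\<Sum>a\<in>S. c) / card S = (c::real)"
  by (simp add: card_gt_0_iff)

locale compact_subgroup = lie_group G
  for G :: "('g::{t2_space,second_countable_topology}, 'e::banach) lie_struct" (structure) +
  fixes K :: "'g set"
  assumes compact_K: "compact K"
    and one_K: "\<one> \<in> K"
    and mult_K: "a \<in> K \<Longrightarrow> b \<in> K \<Longrightarrow> a \<otimes> b \<in> K"
    and inv_K: "a \<in> K \<Longrightarrow> inv a \<in> K"
begin

definition avgl :: "'g set \<Rightarrow> ('g \<Rightarrow> real) \<Rightarrow> 'g \<Rightarrow> real" where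
  "avgl S f x = (\<Sum>a\<in>S. f (a \<otimes> x)) / card S"

text \<open>The inverse makes right averages correspond to left averages under the substitution of
  \<open>x^-1\<close> for x, so that statements about \<open>RA\<close> can be read off from
  \<open>LA\<close>.\<close>

definition avgr :: "'g set \<Rightarrow> ('g \<Rightarrow> real) \<Rightarrow> 'g \<Rightarrow> real" where
  "avgr S f x = (\<Sum>a\<in>S. f (x \<otimes> inv a)) / card S"

text \<open>Iterated finite averages are kept as operators: additivity of the mean needs a single
  operator that is good for two functions at once.\<close>

inductive_set LA :: "(('g \<Rightarrow> real) \<Rightarrow> 'g \<Rightarrow> real) set" where
  LA_id: "(\<lambda>f. f) \<in> LA"
| LA_avg: "T \<in> LA \<Longrightarrow> finite S \<Longrightarrow> S \<noteq> {} \<Longrightarrow> S \<subseteq> K \<Longrightarrow> (\<lambda>f. avgl S (T f)) \<in> LA"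

inductive_set RA :: "(('g \<Rightarrow> real) \<Rightarrow> 'g \<Rightarrow> real) set" where
  RA_id: "(\<lambda>f. f) \<in> RA"
| RA_avg: "T \<in> RA \<Longrightarrow> finite S \<Longrightarrow> S \<noteq> {} \<Longrightarrow> S \<subseteq> K \<Longrightarrow> (\<lambda>f. avgr S (T f)) \<in> RA"

lemma LA_compose: "T \<in> LA \<Longrightarrow> T' \<in> LA \<Longrightarrow> (\<lambda>f. T (T' f)) \<in> LA"
  by (induction rule: LA.induct) (auto intro: LA.intros)

lemma LA_translate:
  assumes "a \<in> K" shows "(\<lambda>f x. f (a \<otimes> x)) \<in> LA"
  using LA_avg[OF LA_id, of "{a}"] assms by (simp add: avgl_def[abs_def])

lemma LA_le: "T \<in> LA \<Longrightarrow> (\<And>x. x \<in> K \<Longrightarrow> f x \<le> g x) \<Longrightarrow> x \<in> K \<Longrightarrow> T f x \<le> T g x"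
  by (induction arbitrary: x rule: LA.induct)
    (auto simp: avgl_def intro!: average_mono mult_K)

lemma LA_const: "T \<in> LA \<Longrightarrow> T (\<lambda>x. c) = (\<lambda>x. c)"
  by (induction rule: LA.induct) (auto simp: avgl_def average_const)

lemma LA_add: "T \<in> LA \<Longrightarrow> T (\<lambda>x. f x + g x) = (\<lambda>x. T f x + T g x)"
  by (induction rule: LA.induct) (auto simp: avgl_def sum.distrib add_divide_distrib)

lemma LA_cmult: "T \<in> LA \<Longrightarrow> T (\<lambda>x. c * f x) = (\<lambda>x. c * T f x)"
  by (induction rule: LA.induct) (auto simp: avgl_def sum_distrib_left)

lemma LA_shift: "T \<in> LA \<Longrightarrow> T (\<lambda>x. f (x \<otimes> b)) = (\<lambda>x. T f (x \<otimes> b))"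
  by (induction rule: LA.induct) (auto simp: avgl_def m_assoc)

lemma LA_sum:
  assumes T: "T \<in> LA" and "finite I"
  shows "T (\<lambda>x. \<Sum>i\<in>I. f i x) = (\<lambda>x. \<Sum>i\<in>I. T (f i) x)"
  using assms(2) by (induction I rule: finite_induct) (auto simp: LA_const[OF T] LA_add[OF T])

lemma LA_continuous: "T \<in> LA \<Longrightarrow> continuous_on K f \<Longrightarrow> continuous_on K (T f)"
proof (induction rule: LA.induct)
  case (LA_avg T S)
  then have "continuous_on K (T f)" by simp
  then have "continuous_on K (\<lambda>x. T f (a \<otimes> x))" if "a \<in> S" for a
    by (rule continuous_on_compose2)
      (use that LA_avg.hyps mult_K in \<open>auto intro: continuous_on_group_mult continuous_on_const continuous_on_id\<close>)
  then show ?case using LA_avg.hyps unfolding avgl_def[abs_def] by (intro continuous_intros) auto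
qed simp

lemma LA_close:
  assumes "T \<in> LA" "\<And>x. x \<in> K \<Longrightarrow> \<bar>f x - c\<bar> \<le> e" "x \<in> K" shows "\<bar>T f x - c\<bar> \<le> e"
  using LA_le[OF assms(1), of f "\<lambda>_. c + e"] LA_le[OF assms(1), of "\<lambda>_. c - e" f] assms(2,3)
  by (simp add: LA_const[OF assms(1)] abs_le_iff) (smt (verit, best))

text \<open>Left translations commute with right translations by associativity, and linearity
  extends this to averages.\<close>

lemma LA_RA_commute: "R \<in> RA \<Longrightarrow> T \<in> LA \<Longrightarrow> T (R f) = R (T f)"
proof (induction rule: RA.induct)
  case (RA_avg R S)
  have "T (avgr S (R f)) = T (\<lambda>x. inverse (card S) * (\<Sum>a\<in>S. R f (x \<otimes> inv a)))"
    by (simp add: avgr_def[abs_def] divide_inverse mult.commute)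
  also have "\<dots> = (\<lambda>x. inverse (card S) * (\<Sum>a\<in>S. T (R f) (x \<otimes> inv a)))"
    unfolding LA_cmult[OF RA_avg.prems] LA_sum[OF RA_avg.prems RA_avg.hyps(2)] LA_shift[OF RA_avg.prems] ..
  also have "\<dots> = avgr S (T (R f))"
    by (simp add: avgr_def[abs_def] divide_inverse mult.commute)
  finally show ?case using RA_avg by simp
qed simp

lemma RA_of_LA:
  assumes "T \<in> LA" obtains R where "R \<in> RA" "\<And>f x. R f x = T (\<lambda>x. f (inv x)) (inv x)"
proof -
  have "\<exists>R\<in>RA. \<forall>f x. R f x = T (\<lambda>x. f (inv x)) (inv x)"
    using assms
  proof (induction rule: LA.induct)
    case LA_id
    then show ?case by (intro bexI[OF _ RA_id]) simp
  next
    case (LA_avg T S)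
    then obtain R where R: "R \<in> RA" "\<forall>f x. R f x = T (\<lambda>x. f (inv x)) (inv x)" by blast
    then have "(\<lambda>f. avgr S (R f)) \<in> RA" using LA_avg.hyps by (intro RA_avg)
    moreover have "avgr S (R f) x = avgl S (T (\<lambda>x. f (inv x))) (inv x)" for f x
      by (simp add: avgr_def avgl_def R(2) inv_mult_group)
    ultimately show ?case by (intro bexI[of _ "\<lambda>f. avgr S (R f)"]) auto
  qed
  then show thesis using that by blast
qed

lemma RA_close:
  assumes "R \<in> RA" "\<And>x. x \<in> K \<Longrightarrow> \<bar>f x - c\<bar> \<le> e" "x \<in> K" shows "\<bar>R f x - c\<bar> \<le> e"
  using assms(1,3)
proof (induction arbitrary: x rule: RA.induct)
  case (RA_avg R S)
  have 1: "\<bar>R f (x \<otimes> inv a) - c\<bar> \<le> e" if "a \<in> S" for a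
    using RA_avg that by (intro RA_avg.IH mult_K inv_K) auto
  have "avgr S (R f) x \<le> (\<Sum>a\<in>S. c + e) / card S"
    unfolding avgr_def by (intro average_mono RA_avg.hyps) (use 1 in fastforce)
  moreover have "(\<Sum>a\<in>S. c - e) / card S \<le> avgr S (R f) x"
    unfolding avgr_def by (intro average_mono RA_avg.hyps) (use 1 in fastforce)
  ultimately show ?case unfolding average_const[OF RA_avg.hyps(2,3)] by linarith
qed (use assms in simp)

text \<open>The defect \<open>f (x v) - f x\<close> vanishes for v the identity; compactness of K
  makes the neighbourhood of v uniform in x.\<close>

lemma right_equicontinuous:
  assumes f: "continuous_on K f" and e: "e > (0::real)"
  obtains V where "open V" "\<one> \<in> V" "\<And>x v. x \<in> K \<Longrightarrow> v \<in> K \<Longrightarrow> v \<in> V \<Longrightarrow> \<bar>f (x \<otimes> v) - f x\<bar> \<le> e"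
proof -
  have "continuous_on (K \<times> K) (\<lambda>p. f (snd p \<otimes> fst p) - f (snd p))"
    by (intro continuous_intros continuous_on_compose2[OF f] continuous_on_group_mult) (auto simp: mult_K)
  from continuous_on_prod_compactE[OF this compact_K one_K e] obtain V where
    V: "\<one> \<in> V" "open V" "\<forall>x\<in>V \<inter> K. \<forall>t\<in>K. dist ((\<lambda>p. f (snd p \<otimes> fst p) - f (snd p)) (x, t))
      ((\<lambda>p. f (snd p \<otimes> fst p) - f (snd p)) (\<one>, t)) \<le> e"
    by metis
  show thesis
  proof (rule that[OF V(2,1)])
    fix x v assume "x \<in> K" "v \<in> K" "v \<in> V"
    then have "v \<in> V \<inter> K" by blast
    from bspec[OF bspec[OF V(3) this] \<open>x \<in> K\<close>]
    have "dist (f (x \<otimes> v) - f x) (f (x \<otimes> \<one>) - f x) \<le> e" by simp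
    then show "\<bar>f (x \<otimes> v) - f x\<bar> \<le> e" by (simp add: dist_real_def)
  qed
qed

lemma finite_left_cover:
  assumes "open V" "\<one> \<in> V"
  obtains D where "finite D" "D \<noteq> {}" "D \<subseteq> K" "\<And>x. x \<in> K \<Longrightarrow> \<exists>d\<in>D. inv d \<otimes> x \<in> V"
proof -
  have "open ((\<lambda>x. inv d \<otimes> x) -` V)" for d
    by (intro open_vimage assms continuous_on_group_mult continuous_on_const continuous_on_id)
  moreover have "K \<subseteq> (\<Union>d\<in>K. (\<lambda>x. inv d \<otimes> x) -` V)" using assms(2) by auto
  ultimately obtain D where D: "D \<subseteq> K" "finite D" "K \<subseteq> (\<Union>d\<in>D. (\<lambda>x. inv d \<otimes> x) -` V)"
    using compactE_image[OF compact_K, of K "\<lambda>d. (\<lambda>x. inv d \<otimes> x) -` V"] by metis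
  moreover have "D \<noteq> {}" using D(3) one_K by auto
  ultimately show thesis using that[of D] by blast
qed

text \<open>If an average were far below its near-minimal upper bound somewhere, it would be so on a whole
  translate of \<open>V\<close>, and averaging once more over boundedly many translates would beat the bound.\<close>

lemma LA_nearly_constant:
  assumes f: "continuous_on K f" and e: "e > 0"
  obtains T c where "T \<in> LA" "\<And>x. x \<in> K \<Longrightarrow> \<bar>T f x - c\<bar> \<le> e"
proof -
  define d where "d = e / 2"
  have d: "d > 0" using e by (simp add: d_def)
  obtain V where V: "open V" "\<one> \<in> V" "\<And>x v. x \<in> K \<Longrightarrow> v \<in> K \<Longrightarrow> v \<in> V \<Longrightarrow> \<bar>f (x \<otimes> v) - f x\<bar> \<le> d"
    using right_equicontinuous[OF f d] by blast
  obtain D where D: "finite D" "D \<noteq> {}" "D \<subseteq> K" "\<And>x. x \<in> K \<Longrightarrow> \<exists>d\<in>D. inv d \<otimes> x \<in> V"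
    using finite_left_cover[OF V(1,2)] by blast
  \<comment> \<open>The number n of translates depends only on f and e, not on the average T chosen
    later; hence the gain \<open>d / n\<close> can be fixed in advance.\<close>
  define n where "n = real (card D)"
  have n: "n > 0" using D by (simp add: n_def card_gt_0_iff)
  \<comment> \<open>All upper bounds attainable on K by some left average of f.\<close>
  define P where "P = {s. \<exists>T\<in>LA. \<forall>x\<in>K. T f x \<le> s}"
  have "bounded (f ` K)" using compact_continuous_image[OF f compact_K] by (rule compact_imp_bounded)
  then obtain B where B: "\<And>x. x \<in> K \<Longrightarrow> \<bar>f x\<bar> \<le> B" by (auto simp: bounded_iff)
  have "B \<in> P" unfolding P_def using B LA_id by (auto simp: abs_le_iff intro!: bexI[OF _ LA_id])
  have bd: "- B \<le> s" if s: "s \<in> P" for s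
  proof -
    obtain T where T: "T \<in> LA" "\<forall>x\<in>K. T f x \<le> s" using s by (auto simp: P_def)
    have "\<bar>T f \<one> - 0\<bar> \<le> B" by (rule LA_close[OF T(1) _ one_K]) (use B in simp)
    moreover have "T f \<one> \<le> s" using T(2) one_K by blast
    ultimately show ?thesis by simp
  qed
  then have bb: "bdd_below P" by (auto simp: bdd_below_def)
  have "Inf P < Inf P + d / n" using d n by simp
  then obtain s where s: "s \<in> P" "s < Inf P + d / n"
    using cInf_less_iff[OF _ bb] \<open>B \<in> P\<close> by blast
  then obtain T where T: "T \<in> LA" "\<And>x. x \<in> K \<Longrightarrow> T f x \<le> s" by (auto simp: P_def)
  have lower: "s - 2 * d \<le> T f x0" if x0: "x0 \<in> K" for x0
  proof (rule ccontr)
    assume "\<not> s - 2 * d \<le> T f x0"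
    then have low: "T f x0 < s - 2 * d" by simp
    \<comment> \<open>Right translation by v commutes with T, so the uniform estimate for f passes
      to \<open>T f\<close>.\<close>
    have Vlow: "T f (x0 \<otimes> v) \<le> s - d" if v: "v \<in> K" "v \<in> V" for v
    proof -
      have "f (x \<otimes> v) \<le> f x + d" if "x \<in> K" for x using V(3)[OF that v] by linarith
      then have "T (\<lambda>x. f (x \<otimes> v)) x0 \<le> T (\<lambda>x. f x + d) x0"
        by (rule LA_le[OF T(1)]) (simp_all add: x0)
      then have "T f (x0 \<otimes> v) \<le> T f x0 + d"
        using LA_add[OF T(1), of f "\<lambda>_. d"] by (simp add: LA_shift[OF T(1)] LA_const[OF T(1)])
      then show ?thesis using low by simp
    qed
    \<comment> \<open>These translates move any point x of K into \<open>x0 V\<close> for at least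
      one index, where \<open>T f\<close> is below the bound by d; the other summands stay below
      s.\<close>
    define S where "S = (\<lambda>d. x0 \<otimes> inv d) ` D"
    have inj: "inj_on (\<lambda>d. x0 \<otimes> inv d) D" by (rule inj_onI) (simp, metis in_carrier inv_inv)
    have S: "finite S" "S \<noteq> {}" "S \<subseteq> K" "real (card S) = n"
      using D x0 inj by (auto simp: S_def n_def card_image intro: mult_K inv_K)
    have "avgl S (T f) x \<le> s - d / n" if x: "x \<in> K" for x
    proof -
      obtain b where b: "b \<in> D" "inv b \<otimes> x \<in> V" using D(4)[OF x] by blast
      let ?a = "x0 \<otimes> inv b"
      have a: "?a \<in> S" using b by (simp add: S_def)
      have "T f (?a \<otimes> x) \<le> s - d"
        using Vlow[of "inv b \<otimes> x"] b D(3) x by (auto simp: m_assoc intro: mult_K inv_K)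
      moreover have "(\<Sum>a\<in>S - {?a}. T f (a \<otimes> x)) \<le> (\<Sum>a\<in>S - {?a}. s)"
        using S(3) x by (intro sum_mono T(2) mult_K) auto
      moreover have "(\<Sum>a\<in>S - {?a}. s) = (n - 1) * s"
        using S a by (simp add: card_Diff_singleton of_nat_diff card_gt_0_iff Suc_le_eq algebra_simps)
      ultimately have "(\<Sum>a\<in>S. T f (a \<otimes> x)) \<le> n * s - d"
        using sum.remove[OF S(1) a, of "\<lambda>a. T f (a \<otimes> x)"] by (simp add: algebra_simps)
      then have "(\<Sum>a\<in>S. T f (a \<otimes> x)) / n \<le> (n * s - d) / n" using n by (simp add: divide_right_mono)
      then show ?thesis using n S(4) by (simp add: avgl_def diff_divide_distrib)
    qed
    then have "s - d / n \<in> P" unfolding P_def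
      by (intro CollectI bexI[OF _ LA_avg[OF T(1) S(1-3)]] ballI)
    then have "Inf P \<le> s - d / n" using bb by (rule cInf_lower)
    then show False using s(2) by simp
  qed
  have "\<bar>T f x - s\<bar> \<le> e" if "x \<in> K" for x
    using T(2)[OF that] lower[OF that] by (simp add: d_def)
  then show thesis using that T(1) by blast
qed

lemma RA_nearly_constant:
  assumes f: "continuous_on K f" and e: "e > 0"
  obtains R c where "R \<in> RA" "\<And>x. x \<in> K \<Longrightarrow> \<bar>R f x - c\<bar> \<le> e"
proof -
  have "continuous_on K (\<lambda>x. f (inv x))"
    by (rule continuous_on_compose2[OF f]) (auto intro!: continuous_on_group_inv continuous_on_id simp: inv_K)
  then obtain T c where T: "T \<in> LA" "\<And>x. x \<in> K \<Longrightarrow> \<bar>T (\<lambda>x. f (inv x)) x - c\<bar> \<le> e"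
    using LA_nearly_constant[OF _ e] by blast
  then show thesis using RA_of_LA[OF T(1)] that inv_K by metis
qed

text \<open>The function \<open>T (R f) = R (T f)\<close> is close to both constants at the
  identity. This comparison of a left with a right average is the source of uniqueness.\<close>

lemma LA_RA_close:
  assumes "T \<in> LA" "\<And>x. x \<in> K \<Longrightarrow> \<bar>T f x - c\<bar> \<le> e" "R \<in> RA" "\<And>x. x \<in> K \<Longrightarrow> \<bar>R f x - d\<bar> \<le> e'"
  shows "\<bar>c - d\<bar> \<le> e + e'"
proof -
  have "\<bar>R (T f) \<one> - c\<bar> \<le> e" by (rule RA_close[OF assms(3,2) one_K])
  moreover have "\<bar>T (R f) \<one> - d\<bar> \<le> e'" by (rule LA_close[OF assms(1,4) one_K])
  ultimately show ?thesis using LA_RA_commute[OF assms(3,1), of f] by simp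
qed

definition is_mean :: "('g \<Rightarrow> real) \<Rightarrow> real \<Rightarrow> bool" where
  "is_mean f c \<longleftrightarrow> (\<forall>e>0. \<exists>T\<in>LA. \<forall>x\<in>K. \<bar>T f x - c\<bar> \<le> e)"

definition is_mean_r :: "('g \<Rightarrow> real) \<Rightarrow> real \<Rightarrow> bool" where
  "is_mean_r f c \<longleftrightarrow> (\<forall>e>0. \<exists>R\<in>RA. \<forall>x\<in>K. \<bar>R f x - c\<bar> \<le> e)"

text \<open>Nearly constant left and right averages give intervals around c and d, and every left
  interval meets every right one. The infimum m of the upper ends of the left intervals is then a
  common limit of both kinds of averages.\<close>

lemma mean_exists:
  assumes f: "continuous_on K f"
  shows "\<exists>c. is_mean f c \<and> is_mean_r f c"
proof -
  define S where "S = {c + e | c e. e > 0 \<and> (\<exists>T\<in>LA. \<forall>x\<in>K. \<bar>T f x - c\<bar> \<le> e)}"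
  define m where "m = Inf S"
  have SI: "c + e \<in> S" if "e > 0" "T \<in> LA" "\<And>x. x \<in> K \<Longrightarrow> \<bar>T f x - c\<bar> \<le> e" for c e T
    using that by (auto simp: S_def)
  have low: "d - e' \<le> s" if R: "R \<in> RA" "\<And>x. x \<in> K \<Longrightarrow> \<bar>R f x - d\<bar> \<le> e'" and s: "s \<in> S" for R d e' s
  proof -
    obtain c e T where *: "s = c + e" "T \<in> LA" "\<And>x. x \<in> K \<Longrightarrow> \<bar>T f x - c\<bar> \<le> e"
      using s by (auto simp: S_def)
    show ?thesis using LA_RA_close[OF *(2,3) R] *(1) by simp
  qed
  obtain T1 c1 where 1: "T1 \<in> LA" "\<And>x. x \<in> K \<Longrightarrow> \<bar>T1 f x - c1\<bar> \<le> 1" using LA_nearly_constant[OF f zero_less_one] by blast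
  have ne: "S \<noteq> {}" using SI[OF _ 1] by auto
  obtain R1 d1 where R1: "R1 \<in> RA" "\<And>x. x \<in> K \<Longrightarrow> \<bar>R1 f x - d1\<bar> \<le> 1" using RA_nearly_constant[OF f zero_less_one] by blast
  have bb: "bdd_below S" using low[OF R1] by (auto simp: bdd_below_def)
  have ml: "d - e \<le> m" if R: "R \<in> RA" "\<And>x. x \<in> K \<Longrightarrow> \<bar>R f x - d\<bar> \<le> e" for R d e
    unfolding m_def by (rule cInf_greatest[OF ne low[OF R]])
  have mu: "m \<le> c + e" if "e > 0" "T \<in> LA" "\<And>x. x \<in> K \<Longrightarrow> \<bar>T f x - c\<bar> \<le> e" for c e T
    unfolding m_def by (rule cInf_lower[OF SI[OF that] bb])
  have approx: "(\<exists>T\<in>LA. \<forall>x\<in>K. \<bar>T f x - m\<bar> \<le> e) \<and> (\<exists>R\<in>RA. \<forall>x\<in>K. \<bar>R f x - m\<bar> \<le> e)" if e: "e > 0" for e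
  proof -
    \<comment> \<open>The bounds below put c and d within \<open>3 e / 4\<close> of m; the last
      quarter is the deviation of the averages from c and d.\<close>
    have e4: "e / 4 > 0" using e by simp
    obtain T c where T: "T \<in> LA" "\<And>x. x \<in> K \<Longrightarrow> \<bar>T f x - c\<bar> \<le> e / 4" using LA_nearly_constant[OF f e4] by blast
    obtain R d where R: "R \<in> RA" "\<And>x. x \<in> K \<Longrightarrow> \<bar>R f x - d\<bar> \<le> e / 4" using RA_nearly_constant[OF f e4] by blast
    have *: "m \<le> c + e / 4" "d - e / 4 \<le> m" "\<bar>c - d\<bar> \<le> e / 2"
      using mu[OF e4 T] ml[OF R] LA_RA_close[OF T R] by auto
    have "\<bar>T f x - m\<bar> \<le> e" if "x \<in> K" for x using * T(2)[OF that] by linarith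
    moreover have "\<bar>R f x - m\<bar> \<le> e" if "x \<in> K" for x using * R(2)[OF that] by linarith
    ultimately show ?thesis using T(1) R(1) by blast
  qed
  then show ?thesis unfolding is_mean_def is_mean_r_def by blast
qed

lemma mean_unique:
  assumes "is_mean f c" "is_mean_r f d" shows "c = d"
proof (rule ccontr)
  assume "c \<noteq> d"
  define e where "e = \<bar>c - d\<bar> / 3"
  have e: "e > 0" using \<open>c \<noteq> d\<close> by (simp add: e_def)
  obtain T where T: "T \<in> LA" "\<And>x. x \<in> K \<Longrightarrow> \<bar>T f x - c\<bar> \<le> e"
    using assms(1) e unfolding is_mean_def by blast
  obtain R where R: "R \<in> RA" "\<And>x. x \<in> K \<Longrightarrow> \<bar>R f x - d\<bar> \<le> e"
    using assms(2) e unfolding is_mean_r_def by blast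
  have "\<bar>c - d\<bar> \<le> e + e"
    by (rule LA_RA_close[OF T(1) _ R(1)]) (use T(2) R(2) in auto)
  moreover have "\<bar>c - d\<bar> = 3 * e" by (simp add: e_def)
  ultimately show False using e by simp
qed

definition mean :: "('g \<Rightarrow> real) \<Rightarrow> real" where
  "mean f = (SOME c. is_mean f c \<and> is_mean_r f c)"

lemma mean_works:
  assumes "continuous_on K f" shows "is_mean f (mean f)" "is_mean_r f (mean f)"
  using someI_ex[OF mean_exists[OF assms]] by (auto simp: mean_def)

lemma mean_eqI:
  assumes "continuous_on K f" "is_mean f c \<or> is_mean_r f c" shows "mean f = c"
  using assms mean_works[OF assms(1)] mean_unique by blast

text \<open>Invariance under left averaging is checked on right averages: R commutes with T, and T
  preserves closeness to a constant.\<close>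

lemma mean_LA:
  assumes f: "continuous_on K f" and T: "T \<in> LA" shows "mean (T f) = mean f"
proof (rule mean_eqI[OF LA_continuous[OF T f]], rule disjI2)
  show "is_mean_r (T f) (mean f)"
    unfolding is_mean_r_def
  proof (intro allI impI)
    fix e :: real assume "e > 0"
    then obtain R where R: "R \<in> RA" "\<And>x. x \<in> K \<Longrightarrow> \<bar>R f x - mean f\<bar> \<le> e"
      using mean_works(2)[OF f] unfolding is_mean_r_def by blast
    have "\<bar>R (T f) x - mean f\<bar> \<le> e" if "x \<in> K" for x
      unfolding LA_RA_commute[OF R(1) T, symmetric] by (rule LA_close[OF T]) (use R(2) that in auto)
    then show "\<exists>R\<in>RA. \<forall>x\<in>K. \<bar>R (T f) x - mean f\<bar> \<le> e" using R(1) by blast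
  qed
qed

lemma mean_translate: "continuous_on K f \<Longrightarrow> a \<in> K \<Longrightarrow> mean (\<lambda>x. f (a \<otimes> x)) = mean f"
  using mean_LA[OF _ LA_translate] by blast

text \<open>After T makes f nearly constant, T' does the same for \<open>T g\<close>, whose mean is
  still that of g; applying T' does not spoil the estimate for f.\<close>

lemma mean_add:
  assumes f: "continuous_on K f" and g: "continuous_on K g"
  shows "mean (\<lambda>x. f x + g x) = mean f + mean g"
proof (rule mean_eqI[OF continuous_on_add[OF f g]], rule disjI1)
  show "is_mean (\<lambda>x. f x + g x) (mean f + mean g)"
    unfolding is_mean_def
  proof (intro allI impI)
    fix e :: real assume "e > 0"
    then have e: "e / 2 > 0" by simp
    obtain T where T: "T \<in> LA" "\<And>x. x \<in> K \<Longrightarrow> \<bar>T f x - mean f\<bar> \<le> e / 2"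
      using mean_works(1)[OF f] e unfolding is_mean_def by blast
    obtain T' where T': "T' \<in> LA" "\<And>x. x \<in> K \<Longrightarrow> \<bar>T' (T g) x - mean g\<bar> \<le> e / 2"
      using mean_works(1)[OF LA_continuous[OF T(1) g]] mean_LA[OF g T(1)] e unfolding is_mean_def by metis
    have "\<bar>T' (T (\<lambda>x. f x + g x)) x - (mean f + mean g)\<bar> \<le> e" if x: "x \<in> K" for x
    proof -
      have "\<bar>T' (T f) x - mean f\<bar> \<le> e / 2" by (rule LA_close[OF T'(1)]) (use T(2) x in auto)
      then show ?thesis
        using T'(2)[OF x] unfolding LA_add[OF T(1)] LA_add[OF T'(1)] by linarith
    qed
    then show "\<exists>T\<in>LA. \<forall>x\<in>K. \<bar>T (\<lambda>x. f x + g x) x - (mean f + mean g)\<bar> \<le> e"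
      by (intro bexI[OF _ LA_compose[OF T'(1) T(1)]] ballI)
  qed
qed

lemma mean_cmult:
  assumes f: "continuous_on K f" shows "mean (\<lambda>x. c * f x) = c * mean f"
proof (rule mean_eqI[OF continuous_on_mult_left[OF f]], rule disjI1)
  show "is_mean (\<lambda>x. c * f x) (c * mean f)"
    unfolding is_mean_def
  proof (intro allI impI)
    fix e :: real assume e: "e > 0"
    then have "e / (\<bar>c\<bar> + 1) > 0" by simp
    then obtain T where T: "T \<in> LA" "\<And>x. x \<in> K \<Longrightarrow> \<bar>T f x - mean f\<bar> \<le> e / (\<bar>c\<bar> + 1)"
      using mean_works(1)[OF f] unfolding is_mean_def by blast
    have "\<bar>T (\<lambda>x. c * f x) x - c * mean f\<bar> \<le> e" if "x \<in> K" for x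
    proof -
      have "\<bar>T (\<lambda>x. c * f x) x - c * mean f\<bar> = \<bar>c\<bar> * \<bar>T f x - mean f\<bar>"
        using T(1) by (simp add: LA_cmult abs_mult[symmetric] right_diff_distrib)
      also have "\<dots> \<le> \<bar>c\<bar> * (e / (\<bar>c\<bar> + 1))" using T(2)[OF that] by (intro mult_left_mono) auto
      also have "\<dots> \<le> e" using e by (simp add: field_simps)
      finally show ?thesis .
    qed
    then show "\<exists>T\<in>LA. \<forall>x\<in>K. \<bar>T (\<lambda>x. c * f x) x - c * mean f\<bar> \<le> e" using T(1) by blast
  qed
qed

lemma mean_const [simp]: "mean (\<lambda>x. c) = c"
  by (rule mean_eqI) (auto simp: is_mean_def intro!: bexI[OF _ LA_id])

lemma mean_le:
  assumes f: "continuous_on K f" and le: "\<And>x. x \<in> K \<Longrightarrow> f x \<le> c" shows "mean f \<le> c"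
proof (rule field_le_epsilon)
  fix e :: real assume "e > 0"
  then obtain T where T: "T \<in> LA" "\<And>x. x \<in> K \<Longrightarrow> \<bar>T f x - mean f\<bar> \<le> e"
    using mean_works(1)[OF f] unfolding is_mean_def by blast
  have "T f \<one> \<le> c" using LA_le[OF T(1), of f "\<lambda>_. c" \<one>] le one_K by (simp add: LA_const[OF T(1)])
  then show "mean f \<le> c + e" using T(2)[OF one_K] by linarith
qed

lemma mean_diff:
  "continuous_on K f \<Longrightarrow> continuous_on K g \<Longrightarrow> mean (\<lambda>x. f x - g x) = mean f - mean g"
  using mean_add[of f "\<lambda>x. - 1 * g x"] mean_cmult[of g "- 1"] by (simp add: continuous_on_minus)

lemma mean_mono:
  assumes "continuous_on K f" "continuous_on K g" "\<And>x. x \<in> K \<Longrightarrow> f x \<le> g x" shows "mean f \<le> mean g"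
proof -
  have "mean (\<lambda>x. f x - g x) \<le> 0"
    by (rule mean_le) (use assms in \<open>auto intro: continuous_on_diff\<close>)
  then show ?thesis using mean_diff assms by simp
qed

lemma mean_cong:
  assumes "continuous_on K f" "\<And>x. x \<in> K \<Longrightarrow> f x = g x" shows "mean f = mean g"
proof -
  have "continuous_on K g" using assms continuous_on_cong[of K K f g] by simp
  then show ?thesis using assms mean_mono[of f g] mean_mono[of g f] by force
qed

lemma mean_abs_le:
  assumes "continuous_on K f" "\<And>x. x \<in> K \<Longrightarrow> \<bar>f x\<bar> \<le> c" shows "\<bar>mean f\<bar> \<le> c"
proof -
  have "mean f \<le> c" by (rule mean_le) (use assms in \<open>auto simp: abs_le_iff\<close>)
  moreover have "mean (\<lambda>x. - c) \<le> mean f"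
    by (rule mean_mono) (use assms in \<open>auto simp: abs_le_iff minus_le_iff\<close>)
  ultimately show ?thesis by (simp add: abs_le_iff)
qed

text \<open>Finitely many translates of V cover K, so the average over them is at least
  \<open>e / card S\<close> everywhere, and averaging does not change the mean.\<close>

lemma mean_pos:
  assumes f: "continuous_on K f" and nn: "\<And>x. x \<in> K \<Longrightarrow> f x \<ge> 0"
    and V: "open V" "\<one> \<in> V" and pos: "e > 0" "\<And>x. x \<in> K \<Longrightarrow> x \<in> V \<Longrightarrow> f x \<ge> e"
  shows "mean f > 0"
proof -
  obtain D where D: "finite D" "D \<noteq> {}" "D \<subseteq> K" "\<And>x. x \<in> K \<Longrightarrow> \<exists>d\<in>D. inv d \<otimes> x \<in> V"
    using finite_left_cover[OF V] by blast
  define S where "S = (\<lambda>d. inv d) ` D"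
  have S: "finite S" "S \<noteq> {}" "S \<subseteq> K" using D by (auto simp: S_def inv_K)
  have T: "avgl S \<in> LA" using LA_avg[OF LA_id S] by simp
  have card: "card S > 0" using S by (simp add: card_gt_0_iff)
  have ge: "e / card S \<le> avgl S f x" if x: "x \<in> K" for x
  proof -
    obtain d where d: "d \<in> D" "inv d \<otimes> x \<in> V" using D(4)[OF x] by blast
    then have "e \<le> f (inv d \<otimes> x)" using D(3) x by (intro pos) (auto intro: mult_K inv_K)
    also have "\<dots> \<le> (\<Sum>a\<in>S. f (a \<otimes> x))"
      by (rule member_le_sum[of "inv d" S "\<lambda>a. f (a \<otimes> x)"])
        (use d S x in \<open>auto simp: S_def intro!: nn mult_K\<close>)
    finally show ?thesis using card by (simp add: avgl_def divide_right_mono)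
  qed
  have "mean (\<lambda>x. e / card S) \<le> mean (avgl S f)"
    by (rule mean_mono[OF continuous_on_const LA_continuous[OF T f] ge])
  then have "e / card S \<le> mean f" using mean_LA[OF f T] by simp
  moreover have "e / card S > 0" using pos(1) card by simp
  ultimately show ?thesis by linarith
qed

definition cmean :: "('g \<Rightarrow> complex) \<Rightarrow> complex" where
  "cmean f = Complex (mean (\<lambda>x. Re (f x))) (mean (\<lambda>x. Im (f x)))"

lemma cmean_add:
  "continuous_on K f \<Longrightarrow> continuous_on K g \<Longrightarrow> cmean (\<lambda>x. f x + g x) = cmean f + cmean g"
  by (simp add: cmean_def mean_add continuous_on_Re continuous_on_Im complex_eq_iff)

lemma cmean_cmult:
  assumes f: "continuous_on K f" shows "cmean (\<lambda>x. c * f x) = c * cmean f"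
proof -
  have c: "continuous_on K (\<lambda>x. Re (f x))" "continuous_on K (\<lambda>x. Im (f x))"
    using f by (auto intro: continuous_on_Re continuous_on_Im)
  then have cc: "continuous_on K (\<lambda>x. a * Re (f x))" "continuous_on K (\<lambda>x. a * Im (f x))" for a
    by (auto intro: continuous_intros)
  show ?thesis
    by (simp add: cmean_def complex_eq_iff mean_diff[OF cc(1) cc(2)] mean_add[OF cc(2) cc(1)] mean_add[OF cc(1) cc(2)] mean_cmult c)
qed

text \<open>The factor 2 comes from bounding real and imaginary part separately.\<close>

lemma cmean_norm_le:
  assumes f: "continuous_on K f" and "\<And>x. x \<in> K \<Longrightarrow> norm (f x) \<le> c" shows "norm (cmean f) \<le> 2 * c"
proof -
  have "\<bar>mean (\<lambda>x. Re (f x))\<bar> \<le> c"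
    by (rule mean_abs_le) (use assms abs_Re_le_cmod order_trans in \<open>blast intro: continuous_on_Re\<close>)+
  moreover have "\<bar>mean (\<lambda>x. Im (f x))\<bar> \<le> c"
    by (rule mean_abs_le) (use assms abs_Im_le_cmod order_trans in \<open>blast intro: continuous_on_Im\<close>)+
  ultimately show ?thesis using cmod_le[of "cmean f"] by (simp add: cmean_def)
qed

lemma cmean_diff:
  "continuous_on K f \<Longrightarrow> continuous_on K g \<Longrightarrow> cmean (\<lambda>x. f x - g x) = cmean f - cmean g"
  by (simp add: cmean_def mean_diff continuous_on_Re continuous_on_Im complex_eq_iff)

lemma cmean_translate:
  "continuous_on K f \<Longrightarrow> a \<in> K \<Longrightarrow> cmean (\<lambda>x. f (a \<otimes> x)) = cmean f"
  using mean_translate[of "\<lambda>x. Re (f x)" a] mean_translate[of "\<lambda>x. Im (f x)" a]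
  by (simp add: cmean_def continuous_on_Re continuous_on_Im)

lemma cmean_cong:
  assumes "continuous_on K f" "\<And>x. x \<in> K \<Longrightarrow> f x = g x" shows "cmean f = cmean g"
  using assms mean_cong[of "\<lambda>x. Re (f x)" "\<lambda>x. Re (g x)"] mean_cong[of "\<lambda>x. Im (f x)" "\<lambda>x. Im (g x)"]
  by (simp add: cmean_def continuous_on_Re continuous_on_Im)

end

section \<open>Differentiation under the mean\<close>

text \<open>Differentiability in x with derivatives jointly continuous in x and b. The parameter b
  ranges over a mere topological space, so that the isotropy subgroup can be used without a manifold
  structure.\<close>

primrec param_Ck :: "nat \<Rightarrow> 'h set \<Rightarrow> ('a::real_normed_vector \<Rightarrow> 'h::topological_space \<Rightarrow> 'b::real_normed_vector) \<Rightarrow> 'a set \<Rightarrow> bool" where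
  "param_Ck 0 K R U \<longleftrightarrow> continuous_on (U \<times> K) (\<lambda>p. R (fst p) (snd p))"
| "param_Ck (Suc k) K R U \<longleftrightarrow> continuous_on (U \<times> K) (\<lambda>p. R (fst p) (snd p)) \<and>
     (\<exists>D. (\<forall>x\<in>U. \<forall>b\<in>K. ((\<lambda>x. R x b) has_derivative D x b) (at x)) \<and>
       (\<forall>v. param_Ck k K (\<lambda>x b. D x b v) U))"

lemma param_Ck_continuous: "param_Ck k K R U \<Longrightarrow> continuous_on (U \<times> K) (\<lambda>p. R (fst p) (snd p))"
  by (cases k) auto

lemma continuous_on_section:
  assumes "continuous_on (U \<times> K) (\<lambda>p. R (fst p) (snd p))" "x \<in> U" shows "continuous_on K (R x)"
proof -
  have "continuous_on K (\<lambda>b. (x, b))" by (intro continuous_intros)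
  from continuous_on_compose2[OF assms(1) this] assms(2) show ?thesis by auto
qed

lemma uniform_in_parameter:
  fixes R :: "'a::metric_space \<Rightarrow> 'h::topological_space \<Rightarrow> 'b::metric_space"
  assumes "continuous_on (U \<times> K) (\<lambda>p. R (fst p) (snd p))" "compact K" "x \<in> U" "open U" "e > 0"
  obtains d where "d > 0" "ball x d \<subseteq> U" "\<And>y b. y \<in> ball x d \<Longrightarrow> b \<in> K \<Longrightarrow> dist (R y b) (R x b) \<le> e"
proof -
  obtain X where X: "x \<in> X" "open X" and XR: "\<forall>y\<in>X \<inter> U. \<forall>b\<in>K.
      dist ((\<lambda>p. R (fst p) (snd p)) (y, b)) ((\<lambda>p. R (fst p) (snd p)) (x, b)) \<le> e"
    using continuous_on_prod_compactE[OF assms(1,2,3,5)] by metis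
  have "open (X \<inter> U)" "x \<in> X \<inter> U" using X assms(3,4) by auto
  then obtain d where d: "d > 0" "ball x d \<subseteq> X \<inter> U" using open_contains_ball by blast
  show thesis
  proof (rule that[OF d(1)])
    show "ball x d \<subseteq> U" using d(2) by blast
    fix y b assume "y \<in> ball x d" "b \<in> K"
    then have "y \<in> X \<inter> U" using d(2) by blast
    from bspec[OF bspec[OF XR this] \<open>b \<in> K\<close>] show "dist (R y b) (R x b) \<le> e" by simp
  qed
qed

context compact_subgroup
begin

lemma cmean_bounded_linear:
  fixes D :: "'a::real_normed_vector \<Rightarrow> 'g \<Rightarrow> complex"
  assumes fd: "fin_dim TYPE('a)" and lin: "\<And>b. b \<in> K \<Longrightarrow> linear (\<lambda>v. D v b)"
    and cont: "\<And>v. continuous_on K (D v)"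
  shows "bounded_linear (\<lambda>v. cmean (D v))"
proof -
  obtain B :: "'a set" and M where B: "finite B" "M > 0"
    "\<And>(f::'a \<Rightarrow> complex) x. linear f \<Longrightarrow> norm (f x) \<le> M * norm x * (\<Sum>b\<in>B. norm (f b))"
    using linear_bound_on_basis[OF fd] by blast
  have "continuous_on K (\<lambda>b. \<Sum>i\<in>B. norm (D i b))"
    by (intro continuous_on_sum continuous_on_norm cont)
  then have "bounded ((\<lambda>b. \<Sum>i\<in>B. norm (D i b)) ` K)"
    using compact_continuous_image compact_K compact_imp_bounded by blast
  then obtain C where "\<forall>y\<in>(\<lambda>b. \<Sum>i\<in>B. norm (D i b)) ` K. norm y \<le> C" unfolding bounded_iff by blast
  then have C: "(\<Sum>i\<in>B. norm (D i b)) \<le> C" if "b \<in> K" for b using that by fastforce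
  show ?thesis
  proof (rule bounded_linear_intro[of _ "2 * (M * C)"])
    fix v w :: 'a and r :: real
    have "cmean (D (v + w)) = cmean (\<lambda>b. D v b + D w b)"
      by (rule cmean_cong[OF cont]) (rule linear_add[OF lin])
    then show "cmean (D (v + w)) = cmean (D v) + cmean (D w)" by (simp add: cmean_add cont)
    have "cmean (D (r *\<^sub>R v)) = cmean (\<lambda>b. of_real r * D v b)"
      by (rule cmean_cong[OF cont]) (simp add: linear_scale[OF lin] scaleR_conv_of_real)
    then show "cmean (D (r *\<^sub>R v)) = r *\<^sub>R cmean (D v)" by (simp add: cmean_cmult cont scaleR_conv_of_real)
    have "norm (D v b) \<le> M * norm v * C" if b: "b \<in> K" for b
    proof -
      have "norm (D v b) \<le> M * norm v * (\<Sum>i\<in>B. norm (D i b))" by (rule B(3)[OF lin[OF b]])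
      also have "\<dots> \<le> M * norm v * C" using C[OF b] B(2) by (intro mult_left_mono) auto
      finally show ?thesis .
    qed
    then have "norm (cmean (D v)) \<le> 2 * (M * norm v * C)" by (rule cmean_norm_le[OF cont])
    then show "norm (cmean (D v)) \<le> norm v * (2 * (M * C))" by (simp add: mult_ac)
  qed
qed

text \<open>The mean is bounded in the supremum norm, so a linearization error uniform in b
  suffices. Joint continuity of the derivatives and compactness of K give this uniformity, and the
  mean value inequality turns it into an error estimate.\<close>

lemma cmean_has_derivative:
  fixes R :: "'a::real_normed_vector \<Rightarrow> 'g \<Rightarrow> complex" and D :: "'a \<Rightarrow> 'g \<Rightarrow> 'a \<Rightarrow> complex"
  assumes fd: "fin_dim TYPE('a)" and U: "open U" and x: "x \<in> U"
    and R: "continuous_on (U \<times> K) (\<lambda>p. R (fst p) (snd p))"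
    and D: "\<And>x b. x \<in> U \<Longrightarrow> b \<in> K \<Longrightarrow> ((\<lambda>x. R x b) has_derivative D x b) (at x)"
    and Dc: "\<And>v. continuous_on (U \<times> K) (\<lambda>p. D (fst p) (snd p) v)"
  shows "((\<lambda>x. cmean (R x)) has_derivative (\<lambda>v. cmean (\<lambda>b. D x b v))) (at x)"
  unfolding has_derivative_at_alt
proof (intro conjI allI impI)
  have Dk: "continuous_on K (\<lambda>b. D y b v)" if "y \<in> U" for y v
    using continuous_on_section[of U K "\<lambda>x b. D x b v", OF Dc that] .
  have Rk: "continuous_on K (R y)" if "y \<in> U" for y
    using continuous_on_section[OF R that] .
  have lin: "linear (D y b)" if "y \<in> U" "b \<in> K" for y b
    using has_derivative_linear[OF D[OF that]] .
  show "bounded_linear (\<lambda>v. cmean (\<lambda>b. D x b v))"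
    by (rule cmean_bounded_linear[OF fd]) (use lin Dk x in auto)
  obtain B :: "'a set" and M where B: "finite B" "M > 0"
    "\<And>(f::'a \<Rightarrow> complex) x. linear f \<Longrightarrow> norm (f x) \<le> M * norm x * (\<Sum>b\<in>B. norm (f b))"
    using linear_bound_on_basis[OF fd] by blast
  fix e :: real assume "e > 0"
  \<comment> \<open>M turns finitely many directional estimates into an operator norm of at most
    \<open>e / 2\<close>; the factor 2 of \<open>cmean_norm_le\<close> then restores e.\<close>
  then have e: "e / (2 * M) > 0" using B(2) by simp
  define S where "S y b = (\<Sum>i\<in>B. norm (D y b i - D x b i))" for y b
  have "continuous_on (U \<times> K) (\<lambda>p. D x (snd p) i)" for i
    by (rule continuous_on_compose2[OF Dk[OF x] continuous_on_snd[OF continuous_on_id]]) auto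
  then have "continuous_on (U \<times> K) (\<lambda>p. S (fst p) (snd p))"
    unfolding S_def by (intro continuous_on_sum continuous_on_norm continuous_on_diff Dc)
  from uniform_in_parameter[OF this compact_K x U e] obtain d where
    d: "d > 0" "ball x d \<subseteq> U" "\<And>y b. y \<in> ball x d \<Longrightarrow> b \<in> K \<Longrightarrow> dist (S y b) (S x b) \<le> e / (2 * M)"
    by blast
  have S: "S y b \<le> e / (2 * M)" if "y \<in> ball x d" "b \<in> K" for y b
    using d(3)[OF that] by (simp add: S_def dist_real_def)
  show "\<exists>d>0. \<forall>y. norm (y - x) < d \<longrightarrow>
      norm (cmean (R y) - cmean (R x) - cmean (\<lambda>b. D x b (y - x))) \<le> e * norm (y - x)"
  proof (intro exI[of _ d] conjI allI impI d)
    fix y assume "norm (y - x) < d"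
    then have y: "y \<in> ball x d" by (simp add: dist_norm norm_minus_commute)
    then have yU: "y \<in> U" using d(2) by blast
    have "norm (R y b - R x b - D x b (y - x)) \<le> norm (y - x) * (e / 2)" if b: "b \<in> K" for b
    proof (rule differentiable_bound_linearization[of x y "ball x d" "\<lambda>x. R x b" "\<lambda>x. D x b" x])
      fix t :: real assume "t \<in> {0..1}"
      then have "norm (t *\<^sub>R (y - x)) \<le> norm (y - x)" by (simp add: mult_left_le_one_le)
      then show "x + t *\<^sub>R (y - x) \<in> ball x d" using y by (simp add: dist_norm norm_minus_commute)
    next
      fix w assume w: "w \<in> ball x d"
      then have wU: "w \<in> U" using d(2) by blast
      show "((\<lambda>x. R x b) has_derivative D w b) (at w within ball x d)"
        by (rule has_derivative_at_withinI[OF D[OF wU b]])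
      show "onorm (D w b - D x b) \<le> e / 2"
      proof (rule onorm_bound)
        fix v
        have "linear (\<lambda>v. D w b v - D x b v)"
          by (intro linear_compose_sub lin wU x b)
        from B(3)[OF this, of v] have "norm (D w b v - D x b v) \<le> M * norm v * S w b" by (simp add: S_def)
        also have "\<dots> \<le> M * norm v * (e / (2 * M))" using S[OF w b] B(2) by (intro mult_left_mono) auto
        also have "\<dots> = e / 2 * norm v" using B(2) by simp
        finally show "norm ((D w b - D x b) v) \<le> e / 2 * norm v" by simp
      qed (use \<open>e > 0\<close> in simp)
    qed (use d in auto)
    moreover have "continuous_on K (\<lambda>b. R y b - R x b - D x b (y - x))"
      by (intro continuous_on_diff Rk Dk yU x)
    ultimately have "norm (cmean (\<lambda>b. R y b - R x b - D x b (y - x))) \<le> 2 * (norm (y - x) * (e / 2))"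
      by (intro cmean_norm_le)
    then show "norm (cmean (R y) - cmean (R x) - cmean (\<lambda>b. D x b (y - x))) \<le> e * norm (y - x)"
      using Rk[OF yU] Rk[OF x] Dk[OF x] by (simp add: cmean_diff continuous_on_diff mult.commute)
  qed
qed

lemma cmean_Ck:
  fixes R :: "'a::real_normed_vector \<Rightarrow> 'g \<Rightarrow> complex"
  assumes fd: "fin_dim TYPE('a)" and U: "open U" and "param_Ck k K R U"
  shows "Ck_on k (\<lambda>x. cmean (R x)) U"
  using assms(3)
proof (induction k arbitrary: R)
  case 0
  then have R: "continuous_on (U \<times> K) (\<lambda>p. R (fst p) (snd p))" by simp
  have "\<exists>d>0. \<forall>y\<in>U. dist y x < d \<longrightarrow> dist (cmean (R y)) (cmean (R x)) < e"
    if x: "x \<in> U" and e: "e > 0" for x e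
  proof -
    \<comment> \<open>\<open>cmean_norm_le\<close> doubles the bound, leaving \<open>e / 2\<close>,
      strictly below e.\<close>
    have "e / 4 > 0" using e by simp
    from uniform_in_parameter[OF R compact_K x U this] obtain d where
      d: "d > 0" "ball x d \<subseteq> U" "\<And>y b. y \<in> ball x d \<Longrightarrow> b \<in> K \<Longrightarrow> dist (R y b) (R x b) \<le> e / 4" by blast
    have "dist (cmean (R y)) (cmean (R x)) < e" if "y \<in> U" "dist y x < d" for y
    proof -
      have c: "continuous_on K (R y)" "continuous_on K (R x)"
        using continuous_on_section[OF R] that x by auto
      have "norm (cmean (\<lambda>b. R y b - R x b)) \<le> 2 * (e / 4)"
        using d(3)[of y] that by (intro cmean_norm_le continuous_on_diff c) (simp add: dist_norm norm_minus_commute)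
      then show ?thesis using e by (simp add: cmean_diff c dist_norm)
    qed
    then show ?thesis using d(1) by blast
  qed
  then show ?case by (simp add: continuous_on_iff)
next
  case (Suc k)
  then obtain D where D: "\<forall>x\<in>U. \<forall>b\<in>K. ((\<lambda>x. R x b) has_derivative D x b) (at x)"
    "\<And>v. param_Ck k K (\<lambda>x b. D x b v) U" by auto
  show ?case
  proof (rule Ck_on_SucI[OF U])
    fix x assume x: "x \<in> U"
    show "((\<lambda>x. cmean (R x)) has_derivative (\<lambda>v. cmean (\<lambda>b. D x b v))) (at x)"
    proof (rule cmean_has_derivative[OF fd U x])
      show "continuous_on (U \<times> K) (\<lambda>p. D (fst p) (snd p) v)" for v
        using param_Ck_continuous[OF D(2)] by simp
    qed (use Suc.prems D(1) in auto)
  qed (use Suc.IH D(2) in auto)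
qed

end

context lie_group
begin

section \<open>Functions smooth in a parameter and a group element\<close>

definition joint_smooth :: "'a::real_normed_vector set \<Rightarrow> ('a \<Rightarrow> 'g \<Rightarrow> 'v::real_normed_vector) \<Rightarrow> bool" where
  "joint_smooth U q \<longleftrightarrow>
     (\<forall>(V, \<tau>)\<in>charts G. smooth_on (U \<times> \<tau> ` V) (\<lambda>p. q (fst p) (inv_into V \<tau> (snd p))))"

lemma joint_smoothD:
  assumes "joint_smooth U q" "(V, \<tau>) \<in> charts G"
  shows "smooth_on (U \<times> \<tau> ` V) (\<lambda>p. q (fst p) (inv_into V \<tau> (snd p)))"
  using bspec[OF assms(1)[unfolded joint_smooth_def] assms(2)] by simp

lemma joint_smooth_continuous:
  assumes q: "joint_smooth U q" and U: "open U"
  shows "continuous_on (U \<times> UNIV) (\<lambda>p. q (fst p) (snd p))"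
proof -
  have "isCont (\<lambda>p. q (fst p) (snd p)) (x, h)" if x: "x \<in> U" for x h
  proof -
    obtain V \<tau> where V: "(V, \<tau>) \<in> charts G" "h \<in> V" by (rule chartE)
    have "continuous_on (U \<times> V) (\<lambda>p. (\<lambda>p. q (fst p) (inv_into V \<tau> (snd p))) (fst p, \<tau> (snd p)))"
      by (rule continuous_on_compose2[OF smooth_on_continuous[OF joint_smoothD[OF q V(1)]]])
        (auto intro!: continuous_on_Pair continuous_on_fst continuous_on_snd continuous_on_id
          continuous_on_compose2[OF chart_continuous(1)[OF V(1)]])
    then have "continuous_on (U \<times> V) (\<lambda>p. q (fst p) (snd p))"
      by (rule continuous_on_cong[THEN iffD1, rotated -1]) (use V in auto)
    then show ?thesis using continuous_on_eq_continuous_at[of "U \<times> V"] U chart_open(1)[OF V(1)] x V(2)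
      by (auto intro: open_Times)
  qed
  then show ?thesis using U by (auto simp: continuous_on_eq_continuous_at open_Times)
qed

lemma joint_smooth_derivative:
  fixes q :: "'a::real_normed_vector \<Rightarrow> 'g \<Rightarrow> 'v::real_normed_vector"
  assumes q: "joint_smooth U q" and U: "open U"
  shows "x \<in> U \<Longrightarrow> (\<lambda>x. q x b) differentiable (at x)"
    and "joint_smooth U (\<lambda>x b. frechet_derivative (\<lambda>x. q x b) (at x) v)"
proof -
  have D: "((\<lambda>x. q x (inv_into V \<tau> y)) has_derivative
      (\<lambda>v. frechet_derivative (\<lambda>p. q (fst p) (inv_into V \<tau> (snd p))) (at (x, y)) (v, 0))) (at x)"
    if V: "(V, \<tau>) \<in> charts G" and x: "x \<in> U" and y: "y \<in> \<tau> ` V" for V \<tau> x y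
  proof -
    have o: "open (U \<times> \<tau> ` V)" using U chart_open(2)[OF V] by (rule open_Times)
    have "((\<lambda>x. (x, y)) has_derivative (\<lambda>v. (v, 0))) (at x)" by (auto intro!: derivative_eq_intros)
    from diff_chain_at[OF this smooth_on_derivative[OF o joint_smoothD[OF q V]]] x y
    show ?thesis by (simp add: o_def)
  qed
  show "(\<lambda>x. q x b) differentiable (at x)" if x: "x \<in> U"
  proof -
    obtain V \<tau> where V: "(V, \<tau>) \<in> charts G" "b \<in> V" by (rule chartE)
    show ?thesis using D[OF V(1) x imageI[OF V(2)]] V by (auto intro: differentiableI)
  qed
  have "smooth_on (U \<times> \<tau> ` V) (\<lambda>p. frechet_derivative (\<lambda>x. q x (inv_into V \<tau> (snd p))) (at (fst p)) v)"
    if V: "(V, \<tau>) \<in> charts G" for V \<tau>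
  proof (rule smooth_on_cong[OF smooth_on_frechet_derivative[OF _ joint_smoothD[OF q V], of "(v, 0)"]])
    show "open (U \<times> \<tau> ` V)" using U chart_open(2)[OF V] by (rule open_Times)
    fix p assume "p \<in> U \<times> \<tau> ` V"
    then show "frechet_derivative (\<lambda>p. q (fst p) (inv_into V \<tau> (snd p))) (at p) (v, 0) =
        frechet_derivative (\<lambda>x. q x (inv_into V \<tau> (snd p))) (at (fst p)) v"
      using frechet_derivative_at[OF D[OF V, of "fst p" "snd p"]] by (auto dest: fun_cong[of _ _ v])
  qed
  then show "joint_smooth U (\<lambda>x b. frechet_derivative (\<lambda>x. q x b) (at x) v)"
    unfolding joint_smooth_def by auto
qed

lemma continuous_on_weighted:
  fixes q :: "'a::real_normed_vector \<Rightarrow> 'g \<Rightarrow> complex"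
  assumes U: "open U" and L: "continuous_on K L" and q: "joint_smooth U q"
  shows "continuous_on (U \<times> K) (\<lambda>p. L (snd p) * q (fst p) (snd p))"
  by (intro continuous_on_mult continuous_on_compose2[OF L continuous_on_snd[OF continuous_on_id]]
      continuous_on_subset[OF joint_smooth_continuous[OF q U]]) auto

text \<open>All derivatives are taken in x and fall on q; the weight L remains a continuous factor.
  In the application L is \<Lambda> on the isotropy subgroup.\<close>

lemma param_Ck_joint_smooth:
  fixes q :: "'a::real_normed_vector \<Rightarrow> 'g \<Rightarrow> complex"
  assumes U: "open U" and L: "continuous_on K L" and "joint_smooth U q"
  shows "param_Ck k K (\<lambda>x b. L b * q x b) U"
  using assms(3)
proof (induction k arbitrary: q)
  case 0
  then show ?case using continuous_on_weighted[OF U L] by simp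
next
  case (Suc k)
  let ?D = "\<lambda>x b v. L b * frechet_derivative (\<lambda>x. q x b) (at x) v"
  have "((\<lambda>x. L b * q x b) has_derivative ?D x b) (at x)" if "x \<in> U" for x b
    using joint_smooth_derivative(1)[OF Suc.prems U that]
    by (intro has_derivative_mult_right) (simp add: frechet_derivative_works)
  moreover have "param_Ck k K (\<lambda>x b. ?D x b v) U" for v
    by (rule Suc.IH[OF joint_smooth_derivative(2)[OF Suc.prems U]])
  ultimately show ?case using continuous_on_weighted[OF U L Suc.prems] by (auto intro!: exI[of _ ?D])
qed

lemma smooth_fun_continuous:
  assumes f: "smooth_fun f" shows "continuous_on S f"
proof -
  have "isCont f h" for h
  proof -
    obtain U \<rho> where U: "(U, \<rho>) \<in> charts G" "h \<in> U" by (rule chartE)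
    have "continuous_on U (\<lambda>h. f (inv_into U \<rho> (\<rho> h)))"
      by (rule continuous_on_compose2[OF smooth_on_continuous[OF smooth_funD[OF f U(1)]] chart_continuous(1)[OF U(1)]]) simp
    then have "continuous_on U f"
      by (rule continuous_on_cong[THEN iffD1, rotated -1]) (use U in auto)
    then show ?thesis using U chart_open(1) continuous_on_eq_continuous_at by metis
  qed
  then show ?thesis by (simp add: continuous_at_imp_continuous_on)
qed

section \<open>Bump functions on a compact group\<close>

lemma open_neighbourhood_separation:
  fixes V :: "'g set"
  assumes comp: "compact (carrier G)" and V: "open V" "h \<in> V"
  obtains A B :: "'g set" where "open A" "open B" "h \<in> A" "- V \<subseteq> B" "A \<inter> B = {}"
proof -
  have "\<exists>A B. open A \<and> open B \<and> h \<in> A \<and> y \<in> B \<and> A \<inter> B = {}" if "y \<in> - V" for y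
    using that V(2) separation_t2[of h y] by blast
  then obtain A B where AB: "\<And>y. y \<in> - V \<Longrightarrow> open (A y) \<and> open (B y) \<and> h \<in> A y \<and> y \<in> B y \<and> A y \<inter> B y = {}"
    by metis
  have "compact (- V)"
    using compact_Int_closed[OF comp, of "- V"] V(1) by (simp add: carrier_UNIV closed_Compl)
  moreover have "open (B y)" if "y \<in> - V" for y using AB that by blast
  moreover have "- V \<subseteq> (\<Union>y\<in>- V. B y)" using AB by blast
  ultimately obtain F where F: "F \<subseteq> - V" "finite F" "- V \<subseteq> (\<Union>y\<in>F. B y)"
    by (rule compactE_image)
  show thesis
  proof (rule that[of "\<Inter>y\<in>F. A y" "\<Union>y\<in>F. B y"])
    show "open (\<Inter>y\<in>F. A y)" using F AB by (intro open_INT) auto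
    show "open (\<Union>y\<in>F. B y)" using F AB by (intro open_UN) auto
    show "h \<in> (\<Inter>y\<in>F. A y)" using F AB by auto
    show "(\<Inter>y\<in>F. A y) \<inter> (\<Union>y\<in>F. B y) = {}" using F(1) AB by blast
  qed (rule F(3))
qed

text \<open>Extension by zero from a chart is smooth if it vanishes on a neighbourhood of everything
  outside the chart domain. Such a neighbourhood B comes from separating the identity from the
  compact complement, and the chart bump is made small enough to avoid it.\<close>

lemma group_bump:
  assumes comp: "compact (carrier G)" and V: "open V" "\<one> \<in> V"
  obtains r :: "'g \<Rightarrow> real" where "smooth_fun r" "\<And>h. r h \<ge> 0" "r \<one> > 0" "\<And>h. r h \<noteq> 0 \<Longrightarrow> h \<in> V"
proof -
  obtain A B where AB: "open A" "open B" "\<one> \<in> A" "- dom1 \<subseteq> B" "A \<inter> B = {}"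
    using open_neighbourhood_separation[OF comp open_dom1 one_dom1] by blast
  have "open (W \<inter> E -` (A \<inter> V))"
    by (rule continuous_open_preimage[OF continuous_E open_W]) (use AB V in auto)
  moreover have "e0 \<in> W \<inter> E -` (A \<inter> V)" using AB V by simp
  ultimately obtain s where s: "s > 0" "ball e0 s \<subseteq> W \<inter> E -` (A \<inter> V)" using open_contains_ball by blast
  obtain \<beta> :: "'e \<Rightarrow> real" where \<beta>: "smooth_on UNIV \<beta>" "\<And>x. \<beta> x \<ge> 0" "\<beta> e0 > 0"
    "\<And>x. norm (x - e0) \<ge> s \<Longrightarrow> \<beta> x = 0"
    using smooth_bump[OF fin_dim_model s(1)] by blast
  define r where "r h = (if h \<in> dom1 then \<beta> (phi h) else 0)" for h
  have supp: "h \<in> A \<inter> V" if "r h \<noteq> 0" for h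
  proof -
    have h: "h \<in> dom1" "\<beta> (phi h) \<noteq> 0" using that by (auto simp: r_def split: if_splits)
    then have "norm (phi h - e0) < s" using \<beta>(4)[of "phi h"] by (meson not_le)
    then have "phi h \<in> ball e0 s" by (simp add: dist_norm norm_minus_commute)
    then have "E (phi h) \<in> A \<inter> V" using s(2) by blast
    then show ?thesis using h by simp
  qed
  have "smooth_on (\<rho> ` U) (\<lambda>x. r (inv_into U \<rho> x))" if c: "(U, \<rho>) \<in> charts G" for U \<rho>
  proof (rule smooth_on_local)
    fix x assume x: "x \<in> \<rho> ` U"
    let ?k = "inv_into U \<rho>"
    have cont: "continuous_on (\<rho> ` U) ?k" by (rule chart_continuous(2)[OF c])
    show "\<exists>N. open N \<and> x \<in> N \<and> smooth_on (\<rho> ` U \<inter> N) (\<lambda>x. r (?k x))"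
    proof (cases "?k x \<in> dom1")
      case True
      let ?N = "\<rho> ` U \<inter> ?k -` dom1"
      have "open ?N" by (rule continuous_open_preimage[OF cont chart_open(2)[OF c] open_dom1])
      moreover have "smooth_on ?N (\<lambda>x. phi (?k x))"
        by (rule smooth_into_chart[OF smooth_into_subset[OF smooth_into_chart_inv[OF c]] chart1]) auto
      then have "smooth_on ?N (\<lambda>x. \<beta> (phi (?k x)))"
        by (rule smooth_on_compose[OF fin_dim_model \<beta>(1)]) simp
      then have "smooth_on ?N (\<lambda>x. r (?k x))" by (rule smooth_on_cong) (simp add: r_def)
      then have "smooth_on (\<rho> ` U \<inter> ?N) (\<lambda>x. r (?k x))" by (rule smooth_on_subset) blast
      moreover have "x \<in> ?N" using True x by simp
      ultimately show ?thesis by (intro exI[of _ ?N] conjI)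
    next
      \<comment> \<open>Such a point lies in B, and r vanishes on all of B.\<close>
      case False
      let ?N = "\<rho> ` U \<inter> ?k -` B"
      have "open ?N" by (rule continuous_open_preimage[OF cont chart_open(2)[OF c] AB(2)])
      moreover have "smooth_on (\<rho> ` U \<inter> ?N) (\<lambda>x. r (?k x))"
        by (rule smooth_on_cong[OF smooth_on_const[of _ 0]]) (use supp AB(5) in force)
      moreover have "x \<in> ?N" using False x AB(4) by blast
      ultimately show ?thesis by (intro exI[of _ ?N] conjI)
    qed
  qed
  then have "smooth_fun r" unfolding smooth_fun_def by auto
  moreover have "r h \<ge> 0" for h using \<beta>(2) by (simp add: r_def)
  moreover have "r \<one> > 0" using \<beta>(3) by (simp add: r_def e0_def)
  ultimately show thesis using that supp by blast
qed

end

lemma (in compact_subgroup) smooth_fun_cmean: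
  fixes r :: "'g \<Rightarrow> complex"
  assumes L: "continuous_on K L" and r: "smooth_fun r"
  shows "smooth_fun (\<lambda>h. cmean (\<lambda>b. L b * r (h \<otimes> b)))"
proof -
  have "smooth_on (\<rho> ` U) (\<lambda>x. cmean (\<lambda>b. L b * r (inv_into U \<rho> x \<otimes> b)))"
    if c: "(U, \<rho>) \<in> charts G" for U \<rho>
  proof -
    have "smooth_on (\<rho> ` U \<times> \<tau> ` V) (\<lambda>p. r (inv_into U \<rho> (fst p) \<otimes> inv_into V \<tau> (snd p)))"
      if d: "(V, \<tau>) \<in> charts G" for V \<tau>
      by (intro smooth_fun_compose[OF r] smooth_into_mult
          smooth_into_compose[OF fin_dim_model smooth_into_chart_inv[OF c] smooth_on_fst[OF smooth_on_id]]
          smooth_into_compose[OF fin_dim_model smooth_into_chart_inv[OF d] smooth_on_snd[OF smooth_on_id]]) auto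
    then have "joint_smooth (\<rho> ` U) (\<lambda>x b. r (inv_into U \<rho> x \<otimes> b))"
      unfolding joint_smooth_def by auto
    then have "Ck_on k (\<lambda>x. cmean (\<lambda>b. L b * r (inv_into U \<rho> x \<otimes> b))) (\<rho> ` U)" for k
      by (intro cmean_Ck fin_dim_model chart_open(2)[OF c] param_Ck_joint_smooth L)
    then show ?thesis using chart_open(2)[OF c] by (simp add: smooth_on_open_iff)
  qed
  then show ?thesis unfolding smooth_fun_def by auto
qed

context prequantum
begin

section \<open>Sections with a prescribed evolution\<close>

definition equivariant :: "('g \<Rightarrow> complex) \<Rightarrow> bool" where
  "equivariant f \<longleftrightarrow> (\<forall>h. \<forall>b\<in>H. f (h \<otimes> b) = f h / \<Lambda> b)"

text \<open>Averaging \<open>\<Lambda> b * r (h b)\<close> over b produces equivariance by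
  invariance of the mean. The average could vanish identically, so r is supported where \<Lambda>
  stays close to 1 on the isotropy subgroup.\<close>

lemma equivariant_smooth_exists:
  assumes comp: "compact (carrier G)"
  obtains f where "smooth_fun f" "equivariant f" "f \<one> \<noteq> 0"
proof -
  have "H = (\<lambda>h. coadj G h \<eta>) -` {\<eta>}" using H_iff by blast
  moreover have "closed ((\<lambda>h. coadj G h \<eta>) -` {\<eta>})"
    by (rule closed_vimage[OF closed_singleton continuous_orbit_map])
  ultimately have "compact H" using compact_Int_closed[OF comp] by (simp add: carrier_UNIV)
  then interpret compact_subgroup G H by unfold_locales auto
  \<comment> \<open>The radius 1/2 ensures that the real part of \<Lambda> is at least 1/2 wherever
    r is nonzero on the isotropy subgroup.\<close>
  obtain V where V: "open V" "\<one> \<in> V" "\<And>b. b \<in> H \<Longrightarrow> b \<in> V \<Longrightarrow> dist (\<Lambda> b) (\<Lambda> \<one>) < 1 / 2"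
  proof -
    have "\<Lambda> \<one> \<in> ball (\<Lambda> \<one>) (1 / 2)" by simp
    then obtain V where "open V" "\<one> \<in> V" "\<forall>b\<in>H. b \<in> V \<longrightarrow> \<Lambda> b \<in> ball (\<Lambda> \<one>) (1 / 2)"
      using Lam_continuous one_H open_ball unfolding continuous_on_topological by metis
    then show thesis using that[of V] by (simp add: dist_commute)
  qed
  obtain r :: "'g \<Rightarrow> real" where r: "smooth_fun r" "\<And>h. r h \<ge> 0" "r \<one> > 0" "\<And>h. r h \<noteq> 0 \<Longrightarrow> h \<in> V"
    using group_bump[OF comp V(1,2)] by blast
  define f where "f h = cmean (\<lambda>b. \<Lambda> b * of_real (r (h \<otimes> b)))" for h
  have rc: "continuous_on S r" for S by (rule smooth_fun_continuous[OF r(1)])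
  have Fc: "continuous_on H (\<lambda>b. \<Lambda> b * of_real (r (h \<otimes> b)))" for h
    by (intro continuous_on_mult Lam_continuous continuous_on_of_real continuous_on_compose2[OF rc[of UNIV]]
        continuous_on_group_mult continuous_on_const continuous_on_id) auto
  have "smooth_fun (\<lambda>h. of_real (r h) :: complex)"
    using r(1) unfolding smooth_fun_def by (auto intro!: smooth_on_bounded_linear_compose[OF bounded_linear_of_real])
  then have "smooth_fun f" unfolding f_def by (rule smooth_fun_cmean[OF Lam_continuous])
  moreover have "equivariant f"
    unfolding equivariant_def
  proof (intro allI ballI)
    fix h a assume a: "a \<in> H"
    \<comment> \<open>Substituting \<open>a b\<close> for b; the factor \<open>\<Lambda> a\<close>
      then comes out of the mean.\<close>
    have "f h = cmean (\<lambda>b. \<Lambda> (a \<otimes> b) * of_real (r (h \<otimes> (a \<otimes> b))))"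
      using cmean_translate[OF Fc a, of h] by (simp add: f_def)
    also have "\<dots> = cmean (\<lambda>b. \<Lambda> a * (\<Lambda> b * of_real (r ((h \<otimes> a) \<otimes> b))))"
      by (rule cmean_cong[symmetric, OF continuous_on_mult[OF continuous_on_const Fc]])
        (use a in \<open>simp add: Lam_mult m_assoc\<close>)
    also have "\<dots> = \<Lambda> a * f (h \<otimes> a)" unfolding f_def by (rule cmean_cmult[OF Fc])
    finally show "f (h \<otimes> a) = f h / \<Lambda> a" using a by simp
  qed
  moreover have "f \<one> \<noteq> 0"
  proof -
    have half: "r b * (1 / 2) \<le> Re (\<Lambda> b * of_real (r b))" if b: "b \<in> H" for b
    proof (cases "r b = 0")
      case False
      then have "norm (\<Lambda> b - 1) < 1 / 2" using V(3)[OF b r(4)] by (simp add: dist_norm)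
      then have "\<bar>Re (\<Lambda> b - 1)\<bar> < 1 / 2" using abs_Re_le_cmod order_le_less_trans by blast
      then have "1 / 2 \<le> Re (\<Lambda> b)" using abs_ge_minus_self[of "Re (\<Lambda> b - 1)"] by simp
      from mult_right_mono[OF this r(2)[of b]] show ?thesis by (simp add: mult.commute)
    qed simp
    have hc: "continuous_on H (\<lambda>b. r b * (1 / 2))" by (rule continuous_on_mult_right[OF rc])
    have "0 < mean (\<lambda>b. r b * (1 / 2))"
    \<comment> \<open>Where r exceeds half its value at the identity, \<open>r / 2\<close> exceeds a
      quarter of that value.\<close>
    proof (rule mean_pos[of _ "r -` {r \<one> / 2 <..}" "r \<one> / 4"])
      show "open (r -` {r \<one> / 2 <..})" by (rule open_vimage[OF _ rc]) simp
    qed (use r hc in auto)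
    also have "\<dots> \<le> mean (\<lambda>b. Re (\<Lambda> b * of_real (r b)))"
      by (rule mean_mono[OF hc _ half]) (use continuous_on_Re[OF Fc[of \<one>]] in simp)
    also have "\<dots> = Re (f \<one>)" by (simp add: f_def cmean_def)
    finally show ?thesis by auto
  qed
  ultimately show thesis using that by blast
qed

text \<open>The inverse of \<open>coef\<close>. The representative h is an arbitrary choice; for
  equivariant f the class does not depend on it.\<close>

definition section_of :: "('g \<Rightarrow> complex) \<Rightarrow> ('e \<Rightarrow>\<^sub>L real) \<Rightarrow> ('g \<times> complex) set" where
  "section_of f \<nu> = (let h = SOME h. coadj G h \<eta> = \<nu> in cls h (f h))"

lemma section_of_coadj:
  assumes "equivariant f" shows "section_of f (coadj G h \<eta>) = cls h (f h)"
proof -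
  define k where "k = (SOME k. coadj G k \<eta> = coadj G h \<eta>)"
  have "coadj G k \<eta> = coadj G h \<eta>" unfolding k_def by (rule someI[of _ h]) simp
  note k = cls_over[OF this]
  have "f (h \<otimes> (inv h \<otimes> k)) = f h / \<Lambda> (inv h \<otimes> k)"
    using assms k(2) by (simp add: equivariant_def)
  then have "f k = f h / \<Lambda> (inv h \<otimes> k)" by (simp add: inv_cancel)
  then have "cls k (f k) = cls h (f h)" using k by simp
  then show ?thesis by (simp add: section_of_def k_def[symmetric])
qed

lemma section_of_props:
  assumes "equivariant f"
  shows "bundle_section G \<eta> \<Lambda> (section_of f)" "coef (section_of f) = f"
  using section_of_coadj[OF assms] coef_eq by (auto simp: bundle_section_iff)

text \<open>Left translation solves the transport equation explicitly: \<open>f (g_t^-1 h)\<close>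
  is constant along \<open>g_t h\<close>, and it stays equivariant because the isotropy subgroup
  acts from the right.\<close>

lemma section_of_evolution:
  assumes f: "smooth_fun f" "equivariant f" and g: "right_log_solution G A g"
  defines "\<sigma> \<equiv> \<lambda>t. section_of (\<lambda>h. f (inv (g t) \<otimes> h))"
  shows "smooth_section G \<eta> \<Lambda> (\<sigma> 0)" "evolution G \<eta> \<Lambda> A \<sigma>" "coef (\<sigma> 0) = f"
proof -
  have eq: "equivariant (\<lambda>h. f (inv (g t) \<otimes> h))" for t
    using f(2) by (simp add: equivariant_def m_assoc[symmetric])
  have sec: "bundle_section G \<eta> \<Lambda> (\<sigma> t)" and coef: "coef (\<sigma> t) = (\<lambda>h. f (inv (g t) \<otimes> h))" for t
    using section_of_props[OF eq] by (auto simp: \<sigma>_def)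
  have sharp: "sharp G \<eta> (\<sigma> t) (cls k z) = f (inv (g t) \<otimes> k) / z" if "z \<noteq> 0" for t k z
    using sharp_eq_coef[OF sec that] coef by simp
  have g0: "g 0 = \<one>" and smg: "smooth_into G {0..1} g" using g by (auto simp: right_log_solution_def)
  show "coef (\<sigma> 0) = f" by (simp add: coef g0)
  have fam_chart: "smooth_on ({0..1} \<times> \<rho> ` U \<times> (- {0})) (\<lambda>(t, x, z). sharp G \<eta> (\<sigma> t) (cls (inv_into U \<rho> x) z))"
    if c: "(U, \<rho>) \<in> charts G" for U \<rho>
  proof -
    let ?S = "{0..1} \<times> \<rho> ` U \<times> (- {0}) :: (real \<times> 'e \<times> complex) set"
    have 1: "smooth_into G ?S (\<lambda>p. g (fst p))"
      by (rule smooth_into_compose[OF fin_dim_euclidean smg]) (auto intro!: smooth_on_fst smooth_on_id)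
    have 2: "smooth_into G ?S (\<lambda>p. inv_into U \<rho> (fst (snd p)))"
      by (rule smooth_into_compose[OF fin_dim_model smooth_into_chart_inv[OF c]])
        (auto intro!: smooth_on_fst smooth_on_snd smooth_on_id)
    have "smooth_on ?S (\<lambda>p. f (inv (g (fst p)) \<otimes> inv_into U \<rho> (fst (snd p))))"
      by (intro smooth_fun_compose[OF f(1)] smooth_into_mult smooth_into_inv 1 2)
    moreover have "smooth_on ?S (\<lambda>p. inverse (snd (snd p)))"
      by (rule smooth_on_compose[OF fin_dim_euclidean smooth_on_inverse])
        (auto intro!: smooth_on_snd smooth_on_id)
    ultimately have "smooth_on ?S (\<lambda>p. f (inv (g (fst p)) \<otimes> inv_into U \<rho> (fst (snd p))) * inverse (snd (snd p)))"
      by (rule smooth_on_bounded_bilinear[OF bounded_bilinear_mult])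
    then show ?thesis
    proof (rule smooth_on_cong)
      fix p assume "p \<in> ?S"
      then have "snd (snd p) \<noteq> 0" by auto
      then show "f (inv (g (fst p)) \<otimes> inv_into U \<rho> (fst (snd p))) * inverse (snd (snd p)) =
          (case p of (t, x, z) \<Rightarrow> sharp G \<eta> (\<sigma> t) (cls (inv_into U \<rho> x) z))"
        by (simp add: split_def sharp divide_inverse)
    qed
  qed
  have fam: "smooth_section_family G \<eta> \<Lambda> \<sigma>"
    unfolding smooth_section_family_def using sec fam_chart by auto
  show "smooth_section G \<eta> \<Lambda> (\<sigma> 0)"
  proof -
    have "smooth_on (\<rho> ` U \<times> (- {0})) (\<lambda>(x, z). sharp G \<eta> (\<sigma> 0) (cls (inv_into U \<rho> x) z))"
      if c: "(U, \<rho>) \<in> charts G" for U \<rho>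
    proof -
      have "smooth_on (\<rho> ` U \<times> (- {0}))
          (\<lambda>p. (\<lambda>(t, x, z). sharp G \<eta> (\<sigma> t) (cls (inv_into U \<rho> x) z)) (0, p))"
        by (rule smooth_on_compose[OF fin_dim_prod[OF fin_dim_euclidean fin_dim_prod[OF fin_dim_model fin_dim_euclidean]] fam_chart[OF c]])
          (auto intro!: smooth_on_Pair smooth_on_const smooth_on_id)
      then show ?thesis by (simp add: split_def)
    qed
    then show ?thesis unfolding smooth_section_def using sec by auto
  qed
  show "evolution G \<eta> \<Lambda> A \<sigma>"
    unfolding evolution_iff[OF fam]
  proof (intro ballI allI)
    fix t :: real and h assume t: "t \<in> {0..1}"
    have "smooth_fun (coef (\<sigma> t))" by (rule family_coef(3)[OF fam t])
    then have "((\<lambda>s. coef (\<sigma> t) (h \<otimes> (inv h \<otimes> inv (g s \<otimes> inv (g t)) \<otimes> inv (inv h)))) has_vector_derivative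
        ld (coef (\<sigma> t)) h (Adj (inv h) (- A t))) (at t within {0..1})"
      by (rule ld_vel1) (intro vel1_conj vel1_inv right_log_solution_vel1[OF g t])
    \<comment> \<open>With t fixed, \<open>f_s h = f_t (g_t g_s^-1 h)\<close>; conjugation by
      \<open>h^-1\<close> moves \<open>g_t g_s^-1\<close>, the inverse of \<open>g_s g_t^-1\<close>,
      to the right of h.\<close>
    moreover have "coef (\<sigma> t) (h \<otimes> (inv h \<otimes> inv (g s \<otimes> inv (g t)) \<otimes> inv (inv h))) = coef (\<sigma> s) h" for s
      by (simp add: coef inv_mult_group m_assoc inv_cancel)
    moreover have "ld (coef (\<sigma> t)) h (Adj (inv h) (- A t)) = - ld (coef (\<sigma> t)) h (Adj (inv h) (A t))"
      using linear_neg[OF ld_linear[OF \<open>smooth_fun (coef (\<sigma> t))\<close>]]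
        linear_neg[OF bounded_linear.linear[OF Adj_bounded_linear]] by simp
    ultimately show "((\<lambda>s. coef (\<sigma> s) h) has_vector_derivative - ld (coef (\<sigma> t)) h (Adj (inv h) (A t))) (at t within {0..1})"
      by (simp only:)
  qed
qed

end

theorem theorem6:
  fixes G :: "('g::{t2_space,second_countable_topology}, 'e::banach) lie_struct"
    and \<eta> :: "'e \<Rightarrow>\<^sub>L real"
    and \<Lambda> :: "'g \<Rightarrow> complex"
    and A :: "real \<Rightarrow> 'e"
    and \<psi> :: "real \<Rightarrow> ('e \<Rightarrow>\<^sub>L real) \<Rightarrow> ('e \<Rightarrow>\<^sub>L real)"
    and g :: "real \<Rightarrow> 'g"
  assumes "lie_group G"
    and "compact (carrier G)"
    and "connected (coadjoint_orbit G \<eta>)"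
    and "isotropy_character G \<eta> \<Lambda>"
    and "smooth_on {0..1} A"
    and "closed_isotopy G \<eta> A \<psi>"
    and "right_log_solution G A g"
  shows "g 1 \<in> isotropy G \<eta> \<and> kappa G \<eta> \<Lambda> A = \<Lambda> (g 1)"
proof -
  interpret lie_group G by (rule assms(1))
  interpret prequantum G \<eta> \<Lambda> by unfold_locales (rule assms(4))
  obtain f where f: "smooth_fun f" "equivariant f" "f \<one>\<^bsub>G\<^esub> \<noteq> 0"
    using equivariant_smooth_exists[OF assms(2)] by blast
  note \<sigma> = section_of_evolution[OF f(1,2) assms(7)]
  note fin = evolution_end[OF _ assms(7,6,2,3)]
  have g1: "g 1 \<in> isotropy G \<eta>" by (rule fin(1)[OF \<sigma>(2)])
  have "kappa G \<eta> \<Lambda> A = \<Lambda> (g 1)"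
    unfolding kappa_def
  proof (rule the_equality, intro conjI allI impI ballI)
    show "norm (\<Lambda> (g 1)) = 1" by (rule Lam_norm[OF g1])
    fix \<sigma> \<sigma>t \<nu>
    assume s: "evolution G \<eta> \<Lambda> A \<sigma>t" "\<forall>\<nu>\<in>coadjoint_orbit G \<eta>. \<sigma>t 0 \<nu> = \<sigma> \<nu>" and "\<nu> \<in> coadjoint_orbit G \<eta>"
    then obtain h where h: "\<nu> = coadj G h \<eta>" "\<sigma> (coadj G h \<eta>) = \<sigma>t 0 (coadj G h \<eta>)"
      by (auto simp: coadjoint_orbit_def)
    have "bundle_section G \<eta> \<Lambda> (\<sigma>t 0)" "bundle_section G \<eta> \<Lambda> (\<sigma>t 1)"
      using s(1) family_coef(1)[of \<sigma>t] by (auto simp: evolution_def)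
    then show "\<sigma>t 1 \<nu> = fibre_scale (\<Lambda> (g 1)) (\<sigma> \<nu>)"
      using fin(2)[OF s(1), of h] by (simp add: h section_eq_cls fibre_scale_cls)
  next
    \<comment> \<open>Uniqueness of the constant: the section built from f is tested at \<eta>,
      where its initial coefficient \<open>f 1\<close> is nonzero and can be cancelled.\<close>
    fix k
    let ?\<sigma> = "\<lambda>t. section_of (\<lambda>h. f (inv\<^bsub>G\<^esub> (g t) \<otimes>\<^bsub>G\<^esub> h))"
    assume "norm k = 1 \<and> (\<forall>\<sigma> \<sigma>t. smooth_section G \<eta> \<Lambda> \<sigma> \<longrightarrow> evolution G \<eta> \<Lambda> A \<sigma>t \<longrightarrow>
        (\<forall>\<nu>\<in>coadjoint_orbit G \<eta>. \<sigma>t 0 \<nu> = \<sigma> \<nu>) \<longrightarrow>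
        (\<forall>\<nu>\<in>coadjoint_orbit G \<eta>. \<sigma>t 1 \<nu> = fibre_scale k (\<sigma> \<nu>)))"
    then have k: "\<forall>\<nu>\<in>coadjoint_orbit G \<eta>. ?\<sigma> 1 \<nu> = fibre_scale k (?\<sigma> 0 \<nu>)"
      using \<sigma>(1,2) by blast
    have "\<eta> \<in> coadjoint_orbit G \<eta>" unfolding coadjoint_orbit_def by (rule image_eqI[of _ _ "\<one>\<^bsub>G\<^esub>"]) simp_all
    then have e: "?\<sigma> 1 (coadj G \<one>\<^bsub>G\<^esub> \<eta>) = fibre_scale k (?\<sigma> 0 (coadj G \<one>\<^bsub>G\<^esub> \<eta>))" using k by simp
    have "bundle_section G \<eta> \<Lambda> (?\<sigma> t)" if "t \<in> {0..1}" for t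
      using \<sigma>(2) family_coef(1)[of ?\<sigma>] that by (auto simp: evolution_def)
    then have "coef (?\<sigma> 1) \<one>\<^bsub>G\<^esub> = k * coef (?\<sigma> 0) \<one>\<^bsub>G\<^esub>"
      using e section_eq_cls[of "?\<sigma> 1" "\<one>\<^bsub>G\<^esub>"] section_eq_cls[of "?\<sigma> 0" "\<one>\<^bsub>G\<^esub>"] by (simp add: fibre_scale_cls)
    then show "k = \<Lambda> (g 1)" using fin(2)[OF \<sigma>(2), of "\<one>\<^bsub>G\<^esub>"] \<sigma>(3) f(3) by simp
  qed
  then show ?thesis using g1 by blast
qed

end
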